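(* Let $\Omega\subset\mathbb{R}^N$ be a bounded open connected set, $r,s\in(0,1)$, $\Gamma\in(0,1)$, and let $p_n\in(1,\infty)$, $\alpha_n,\beta_n\ge1$ be increasing sequences with $p_n,\alpha_n,\beta_n\to\infty$, $\alpha_n+\beta_n=p_n$ for all $n$, and $$\lim_{n\to\infty}\frac{\alpha_n}{p_n}=\Gamma,\qquad \lim_{n\to\infty}\frac{\beta_n}{p_n}=1-\Gamma.$$ For each $n$ let $\lambda_n$ be the minimum of $\mathcal{J}_n$ and let $(u_n,v_n)$ be the corresponding minimizer with $u_n,v_n>0$ a.e. in $\Omega$ and $\int_\Omega|u_n|^{\alpha_n}|v_n|^{\beta_n}dx=1$. Then $$\lambda_\infty:=\lim_{n\to\infty}(\lambda_n)^{\frac1{p_n}}=\max\left\{\frac1R,\frac{1}{R^{\Gamma r+(1-\Gamma)s}}\right\},\qquad R:=\max_{x\in\Omega}\mathrm{dist}(x,\partial\Omega).$$ Moreover, there exists $(u_\infty,v_\infty)\in W^{1,\infty}_0(\Omega)\times W^{1,\infty}_0(\Omega)$ such that $\|u_\infty^{\Gamma}v_\infty^{1-\Gamma}\|_{L^\infty(\Omega)}=1$, $(u_n,v_n)\to(u_\infty,v_\infty)$ uniformly in $\Omega$ (up to subsequences), and $$\lambda_\infty=\mathcal{J}_\infty(u_\infty,v_\infty)=\min\left\{\mathcal{J}_\infty(w,z):(w,z)\in W^{1,\infty}_0(\Omega)\times W^{1,\infty}_0(\Omega),\ wz\ne0\right\}.$$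
   Context: Functions in $W_0^{1,p}(\Omega)$ are extended by $0$ to $\mathbb{R}^N$, and for $t\in(0,1)$ $$[w]_{p,t}^p=\iint_{\mathbb{R}^{2N}}\frac{|w(x)-w(y)|^p}{|x-y|^{N+tp}}\,dx\,dy.$$ For each $n$, $$\mathcal{J}_n(w,z)=\frac12\,\frac{\|\nabla w\|_{L^{p_n}(\Omega)}^{p_n}+[w]_{p_n,r}^{p_n}+\|\nabla z\|_{L^{p_n}(\Omega)}^{p_n}+[z]_{p_n,s}^{p_n}}{\int_\Omega |w|^{\alpha_n}|z|^{\beta_n}\,dx},$$ $$\lambda_n=\min\{\mathcal{J}_n(w,z):(w,z)\in W_0^{1,p_n}(\Omega)\times W_0^{1,p_n}(\Omega),\ wz\ne0\},$$ where $wz\neq0$ means that the product is not a.e. zero. This minimum is attained, and there is a minimizer $(u_n,v_n)$ with $u_n,v_n>0$ a.e. in $\Omega$ and $\int_\Omega|u_n|^{\alpha_n}|v_n|^{\beta_n}dx=1$ (it is a weak solution of the eigenvalue system $-\Delta_{p_n}u+(-\Delta)^r_{p_n}u=\frac{2\alpha_n}{p_n}\lambda_n|u|^{\alpha_n-2}u|v|^{\beta_n}$, $-\Delta_{p_n}v+(-\Delta)^s_{p_n}v=\frac{2\beta_n}{p_n}\lambda_n|u|^{\alpha_n}|v|^{\beta_n-2}v$ in $\Omega$, $u=v=0$ in $\mathbb{R}^N\setminus\Omega$). The limiting functional is $$\mathcal{J}_\infty(w,z)=\frac{\max\{\|\nabla w\|_{L^\infty(\Omega)},|w|_r,\|\nabla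 z\|_{L^\infty(\Omega)},|z|_s\}}{\||w|^\Gamma|z|^{1-\Gamma}\|_{L^\infty(\Omega)}},\qquad |w|_t=\sup_{x,y\in\Omega,\ x\ne y}\frac{|w(x)-w(y)|}{|x-y|^t}\quad (t\in(0,1)).$$ $W_0^{1,\infty}(\Omega)$ denotes the functions belonging to $W^{1,\infty}(\Omega)\cap W_0^{1,q}(\Omega)$ for every $q<\infty$ (Lipschitz functions vanishing on $\partial\Omega$). *)

theory Defs
  imports "HOL-Probability.Essential_Supremum"
begin

text \<open>Elements of the function spaces below are represented by functions on the whole space, of
  which only the values on \<open>\<Omega>\<close> matter: everything is integrated over \<open>\<Omega>\<close>, and the extension by
  zero is made explicit by an indicator function. Norms, energies and quotients take values in
  \<open>ennreal\<close>, so that no quantity is silently set to zero when an integral or a supremum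
  is infinite.\<close>

section \<open>Test functions and weak gradients\<close>

fun C_k :: "nat \<Rightarrow> ('a::euclidean_space \<Rightarrow> real) \<Rightarrow> bool" where
  "C_k 0 f \<longleftrightarrow> continuous_on UNIV f"
| "C_k (Suc k) f \<longleftrightarrow>
     (\<forall>x. f differentiable at x) \<and> (\<forall>b\<in>Basis. C_k k (\<lambda>x. frechet_derivative f (at x) b))"

definition test_functions :: "'a::euclidean_space set \<Rightarrow> ('a \<Rightarrow> real) set" where
  "test_functions \<Omega> =
     {\<phi>. (\<forall>k. C_k k \<phi>) \<and> compact (closure {x. \<phi> x \<noteq> 0}) \<and> closure {x. \<phi> x \<noteq> 0} \<subseteq> \<Omega>}"

definition gradient :: "('a::euclidean_space \<Rightarrow> real) \<Rightarrow> 'a \<Rightarrow> 'a" where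
  "gradient \<phi> x = (\<Sum>b\<in>Basis. frechet_derivative \<phi> (at x) b *\<^sub>R b)"

definition locally_integrable ::
  "'a::euclidean_space set \<Rightarrow> ('a \<Rightarrow> 'b::euclidean_space) \<Rightarrow> bool" where
  "locally_integrable \<Omega> f \<longleftrightarrow> f \<in> borel_measurable (lebesgue_on \<Omega>) \<and>
     (\<forall>K. compact K \<and> K \<subseteq> \<Omega> \<longrightarrow> integrable (lebesgue_on K) f)"

definition has_weak_gradient ::
  "'a::euclidean_space set \<Rightarrow> ('a \<Rightarrow> real) \<Rightarrow> ('a \<Rightarrow> 'a) \<Rightarrow> bool" where
  "has_weak_gradient \<Omega> w g \<longleftrightarrow> locally_integrable \<Omega> w \<and> locally_integrable \<Omega> g \<and>
     (\<forall>\<phi>\<in>test_functions \<Omega>. \<forall>b\<in>Basis.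
        (LINT x|lebesgue_on \<Omega>. w x * frechet_derivative \<phi> (at x) b)
          = - (LINT x|lebesgue_on \<Omega>. (g x \<bullet> b) * \<phi> x))"

text \<open>The weak gradient is unique up to a null set, so the choice is immaterial.\<close>

definition weak_gradient :: "'a::euclidean_space set \<Rightarrow> ('a \<Rightarrow> real) \<Rightarrow> 'a \<Rightarrow> 'a" where
  "weak_gradient \<Omega> w = (SOME g. has_weak_gradient \<Omega> w g)"

section \<open>Lebesgue and Sobolev spaces\<close>

text \<open>\<open>Lp_pow \<Omega> p f\<close> is the \<open>p\<close>-th power of the \<open>L\<^sup>p\<close> norm.\<close>

definition Lp_pow ::
  "'a::euclidean_space set \<Rightarrow> real \<Rightarrow> ('a \<Rightarrow> 'b::euclidean_space) \<Rightarrow> ennreal" where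
  "Lp_pow \<Omega> p f = (\<integral>\<^sup>+x. ennreal (norm (f x) powr p) \<partial>lebesgue_on \<Omega>)"

definition Lp_space ::
  "'a::euclidean_space set \<Rightarrow> real \<Rightarrow> ('a \<Rightarrow> 'b::euclidean_space) set" where
  "Lp_space \<Omega> p = {f. f \<in> borel_measurable (lebesgue_on \<Omega>) \<and> Lp_pow \<Omega> p f < \<infinity>}"

definition Linf_norm ::
  "'a::euclidean_space set \<Rightarrow> ('a \<Rightarrow> 'b::euclidean_space) \<Rightarrow> ennreal" where
  "Linf_norm \<Omega> f = esssup (lebesgue_on \<Omega>) (\<lambda>x. ennreal (norm (f x)))"

definition Linf_space ::
  "'a::euclidean_space set \<Rightarrow> ('a \<Rightarrow> 'b::euclidean_space) set" where
  "Linf_space \<Omega> = {f. f \<in> borel_measurable (lebesgue_on \<Omega>) \<and> Linf_norm \<Omega> f < \<infinity>}"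

definition W1p :: "'a::euclidean_space set \<Rightarrow> real \<Rightarrow> ('a \<Rightarrow> real) set" where
  "W1p \<Omega> p = {w \<in> Lp_space \<Omega> p. \<exists>g \<in> Lp_space \<Omega> p. has_weak_gradient \<Omega> w g}"

text \<open>The closure of the test functions in the \<open>W\<^sup>1\<^sup>,\<^sup>p\<close> norm.\<close>

definition W01p :: "'a::euclidean_space set \<Rightarrow> real \<Rightarrow> ('a \<Rightarrow> real) set" where
  "W01p \<Omega> p = {w \<in> W1p \<Omega> p. \<exists>\<phi> :: nat \<Rightarrow> 'a \<Rightarrow> real. (\<forall>k. \<phi> k \<in> test_functions \<Omega>) \<and>
     (\<lambda>k. Lp_pow \<Omega> p (\<lambda>x. w x - \<phi> k x)) \<longlonglongrightarrow> 0 \<and>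
     (\<lambda>k. Lp_pow \<Omega> p (\<lambda>x. weak_gradient \<Omega> w x - gradient (\<phi> k) x)) \<longlonglongrightarrow> 0}"

definition W1inf :: "'a::euclidean_space set \<Rightarrow> ('a \<Rightarrow> real) set" where
  "W1inf \<Omega> = {w \<in> Linf_space \<Omega>. \<exists>g \<in> Linf_space \<Omega>. has_weak_gradient \<Omega> w g}"

text \<open>Every class in this space has a Lipschitz representative. The continuity condition selects
  it, as is needed for the pointwise suprema in \<open>holder_seminorm\<close> below.\<close>

definition W01inf :: "'a::euclidean_space set \<Rightarrow> ('a \<Rightarrow> real) set" where
  "W01inf \<Omega> = {w \<in> W1inf \<Omega>. continuous_on \<Omega> w \<and> (\<forall>q\<ge>1. w \<in> W01p \<Omega> q)}"

definition nonzero_product :: "'a::euclidean_space set \<Rightarrow> ('a \<Rightarrow> real) \<Rightarrow> ('a \<Rightarrow> real) \<Rightarrow> bool" where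
  "nonzero_product \<Omega> w z \<longleftrightarrow> \<not> (AE x in lebesgue_on \<Omega>. w x * z x = 0)"

section \<open>The functionals\<close>

text \<open>The \<open>p\<close>-th power of the Gagliardo seminorm of the extension of \<open>w\<close> by zero; the null set
  \<open>x = y\<close> contributes \<open>0 / 0 = 0\<close>.\<close>

definition gagliardo_pow :: "'a::euclidean_space set \<Rightarrow> real \<Rightarrow> real \<Rightarrow> ('a \<Rightarrow> real) \<Rightarrow> ennreal" where
  "gagliardo_pow \<Omega> p t w =
     (\<integral>\<^sup>+x. (\<integral>\<^sup>+y. ennreal (\<bar>indicator \<Omega> x * w x - indicator \<Omega> y * w y\<bar> powr p
                        / norm (x - y) powr (real DIM('a) + t * p)) \<partial>lebesgue) \<partial>lebesgue)"

definition coupling ::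
  "'a::euclidean_space set \<Rightarrow> real \<Rightarrow> real \<Rightarrow> ('a \<Rightarrow> real) \<Rightarrow> ('a \<Rightarrow> real) \<Rightarrow> ennreal" where
  "coupling \<Omega> \<alpha> \<beta> w z = (\<integral>\<^sup>+x. ennreal (\<bar>w x\<bar> powr \<alpha> * \<bar>z x\<bar> powr \<beta>) \<partial>lebesgue_on \<Omega>)"

definition J_fun ::
  "'a::euclidean_space set \<Rightarrow> real \<Rightarrow> real \<Rightarrow> real \<Rightarrow> real \<Rightarrow> real
     \<Rightarrow> ('a \<Rightarrow> real) \<Rightarrow> ('a \<Rightarrow> real) \<Rightarrow> ennreal" where
  "J_fun \<Omega> r s p \<alpha> \<beta> w z =
     1 / 2 * ((Lp_pow \<Omega> p (weak_gradient \<Omega> w) + gagliardo_pow \<Omega> p r w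
             + Lp_pow \<Omega> p (weak_gradient \<Omega> z) + gagliardo_pow \<Omega> p s z)
            / coupling \<Omega> \<alpha> \<beta> w z)"

definition holder_seminorm :: "'a::euclidean_space set \<Rightarrow> real \<Rightarrow> ('a \<Rightarrow> real) \<Rightarrow> ennreal" where
  "holder_seminorm \<Omega> t w =
     (SUP (x, y) \<in> {(x, y). x \<in> \<Omega> \<and> y \<in> \<Omega> \<and> x \<noteq> y}. ennreal (\<bar>w x - w y\<bar> / norm (x - y) powr t))"

definition J_inf ::
  "'a::euclidean_space set \<Rightarrow> real \<Rightarrow> real \<Rightarrow> real \<Rightarrow> ('a \<Rightarrow> real) \<Rightarrow> ('a \<Rightarrow> real) \<Rightarrow> ennreal" where
  "J_inf \<Omega> r s \<Gamma> w z =
     max (max (Linf_norm \<Omega> (weak_gradient \<Omega> w)) (holder_seminorm \<Omega> r w))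
         (max (Linf_norm \<Omega> (weak_gradient \<Omega> z)) (holder_seminorm \<Omega> s z))
       / Linf_norm \<Omega> (\<lambda>x. \<bar>w x\<bar> powr \<Gamma> * \<bar>z x\<bar> powr (1 - \<Gamma>))"

definition is_minimum :: "'b::order \<Rightarrow> 'b set \<Rightarrow> bool" where
  "is_minimum m S \<longleftrightarrow> m \<in> S \<and> (\<forall>x\<in>S. m \<le> x)"

definition is_maximum :: "'b::order \<Rightarrow> 'b set \<Rightarrow> bool" where
  "is_maximum m S \<longleftrightarrow> m \<in> S \<and> (\<forall>x\<in>S. x \<le> m)"

end

theory Submission
  imports Defs "HOL-Complex_Analysis.Great_Picard"
begin

text \<open>Upper bound for the limit: insert multiples of the cone over a largest inscribed ball into the
  quotients. Lower bound and compactness: Hoelder's inequality is replaced throughout by the pointwise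
  estimate \<open>t \<le> M + M\<^bsup>1-p\<^esup> t\<^sup>p\<close>, whose last term disappears as \<open>p \<rightarrow> \<infinity>\<close> once \<open>M\<close> exceeds the limit of the
  \<open>p\<close>-th roots of the energies. Averaging the fundamental theorem of calculus over balls around a point
  gives Morrey's inequality, hence equicontinuity and a uniformly convergent subsequence; averaging it
  over translates of a small ball gives the sharp Lipschitz constant of the limit, and comparing the
  Gagliardo energy on a product of two small balls gives its Hoelder constant. Functions of
  \<open>W\<^sub>0\<^sup>1\<^sup>,\<^sup>\<infinity>\<close> thus decay at the boundary like \<open>L d\<close> and \<open>L d\<^sup>t\<close>, where \<open>d\<close> is the distance to the
  boundary, which bounds the limiting functional from below.

  Conversely a Lipschitz function vanishing outside the domain has a bounded weak gradient and lies
  in every \<open>W\<^sub>0\<^sup>1\<^sup>,\<^sup>p\<close>: truncate it near the boundary, mollify, and take smooth approximations of almost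
  minimal Dirichlet energy, so that their gradients converge almost everywhere.\<close>

section \<open>Smooth functions and test functions\<close>

text \<open>The boundary of \<open>\<Omega>\<close> is arbitrary, so segments and translations may
  leave \<open>\<Omega>\<close>. Every estimate is therefore made for test functions on the whole
  space and passed to the limit, which yields Lipschitz bounds on all of space for extensions by
  zero. Morrey's inequality carries a dimensional constant and can only give compactness; since the
  claimed value is sharp, the constants of the limit function have to be found anew, from averages
  in which the threshold enters with factor one. The lower bound for the roots of
  \<open>lam n\<close> is not proved for single \<open>n\<close>. If the roots stayed at or below
  some number smaller than the claimed value along a subsequence, a limit of those minimizers would
  be a pair whose \<open>J_inf\<close> is just as small, contrary to the bound coming from the decay
  at the boundary. The compactness lemma serves a second purpose: fed with one fixed function and
  growing exponents, it identifies the elements of \<open>W01inf\<close> as restrictions of global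
  Lipschitz functions vanishing outside \<open>\<Omega>\<close>.\<close>

definition smooth :: "('a::euclidean_space \<Rightarrow> real) \<Rightarrow> bool" where
  "smooth f \<longleftrightarrow> (\<forall>k. C_k k f)"

text \<open>Induction on the order of differentiability, generalised over the member of
  \<open>S\<close>. Smoothness of a concrete function thus reduces to exhibiting a family of
  differentiable functions that contains it and is closed under partial derivatives.\<close>

lemma smooth_coinduct:
  assumes "f \<in> S"
    and diff: "\<And>f x. f \<in> S \<Longrightarrow> f differentiable at x"
    and deriv: "\<And>f b. f \<in> S \<Longrightarrow> b \<in> Basis \<Longrightarrow> (\<lambda>x. frechet_derivative f (at x) b) \<in> S"
  shows "smooth f"
proof -
  have "C_k k g" if "g \<in> S" for k g
    using that
  proof (induction k arbitrary: g)
    case 0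
    show ?case
      by (auto simp: continuous_on_eq_continuous_at intro: differentiable_imp_continuous_within diff[OF 0])
  next
    case (Suc k)
    then show ?case using diff deriv by auto
  qed
  then show ?thesis using assms(1) by (auto simp: smooth_def)
qed

lemma smooth_differentiable: "smooth f \<Longrightarrow> f differentiable at x"
  using C_k.simps(2)[of 0 f] unfolding smooth_def by blast

lemma smooth_partial:
  "smooth f \<Longrightarrow> b \<in> Basis \<Longrightarrow> smooth (\<lambda>x. frechet_derivative f (at x) b)"
  unfolding smooth_def using C_k.simps(2)[of _ f] by blast

lemma smooth_continuous_on: "smooth f \<Longrightarrow> continuous_on S f"
  using C_k.simps(1)[of f] unfolding smooth_def by (meson continuous_on_subset subset_UNIV)

lemma gradient_inner:
  assumes "f differentiable at x"
  shows "gradient f x \<bullet> h = frechet_derivative f (at x) h"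
proof -
  interpret D: linear "frechet_derivative f (at x)"
    using linear_frechet_derivative[OF assms] .
  have "frechet_derivative f (at x) h = frechet_derivative f (at x) (\<Sum>b\<in>Basis. (h \<bullet> b) *\<^sub>R b)"
    by (simp add: euclidean_representation)
  also have "\<dots> = (\<Sum>b\<in>Basis. (h \<bullet> b) * frechet_derivative f (at x) b)"
    by (simp add: D.sum D.scale)
  finally show ?thesis
    unfolding gradient_def inner_sum_left inner_scaleR_left
    by (simp add: inner_commute mult.commute)
qed

lemma has_derivative_gradient:
  assumes "f differentiable at x"
  shows "(f has_derivative (\<lambda>h. gradient f x \<bullet> h)) (at x)"
  using frechet_derivative_works[THEN iffD1, OF assms] gradient_inner[OF assms]
  by (metis (no_types, lifting) has_derivative_eq_rhs ext)

lemma gradient_eqI: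
  assumes "(f has_derivative (\<lambda>h. g \<bullet> h)) (at x)"
  shows "gradient f x = g"
proof -
  have "frechet_derivative f (at x) = (\<lambda>h. g \<bullet> h)"
    using frechet_derivative_at[OF assms] by simp
  then show ?thesis
    by (simp add: gradient_def euclidean_representation)
qed

lemma smooth_gradient_continuous_on: "smooth f \<Longrightarrow> continuous_on S (gradient f)"
  unfolding gradient_def [abs_def]
  by (intro continuous_intros smooth_continuous_on smooth_partial) auto

lemma gradient_lincomb:
  assumes "f differentiable at x" "g differentiable at x"
  shows "gradient (\<lambda>x. a * f x + b * g x) x = a *\<^sub>R gradient f x + b *\<^sub>R gradient g x"
  by (rule gradient_eqI)
     (auto intro!: derivative_eq_intros has_derivative_gradient assms simp: inner_add_left)

lemma smooth_lincomb:
  assumes "smooth f" "smooth g"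
  shows "smooth (\<lambda>x. a * f x + b * g x)"
proof -
  let ?S = "{\<lambda>x. a * f x + b * g x | f g. smooth f \<and> smooth g}"
  show ?thesis
  proof (rule smooth_coinduct[of _ ?S])
    show "(\<lambda>x. a * f x + b * g x) \<in> ?S" using assms by blast
  next
    fix h :: "'a \<Rightarrow> real" and x assume "h \<in> ?S"
    then obtain f g :: "'a \<Rightarrow> real" where h: "h = (\<lambda>x. a * f x + b * g x)" and fg: "smooth f" "smooth g" by auto
    show "h differentiable at x"
      unfolding h using smooth_differentiable[OF fg(1)] smooth_differentiable[OF fg(2)]
      by (intro derivative_intros) auto
  next
    fix h :: "'a \<Rightarrow> real" and c :: 'a assume "h \<in> ?S" and c: "c \<in> Basis"
    then obtain f g :: "'a \<Rightarrow> real" where h: "h = (\<lambda>x. a * f x + b * g x)" and fg: "smooth f" "smooth g" by auto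
    have "frechet_derivative h (at x) c =
        a * frechet_derivative f (at x) c + b * frechet_derivative g (at x) c" for x :: 'a
    proof -
      note d = smooth_differentiable[OF fg(1), of x] smooth_differentiable[OF fg(2), of x]
      have "h differentiable at x" unfolding h by (auto intro!: derivative_intros d)
      from gradient_inner[OF this, of c] gradient_lincomb[OF d, of a b] show ?thesis
        by (simp add: h inner_add_left gradient_inner d)
    qed
    then show "(\<lambda>x. frechet_derivative h (at x) c) \<in> ?S"
      using smooth_partial[OF fg(1) c] smooth_partial[OF fg(2) c] by auto
  qed
qed

section \<open>Explicit smooth functions built from \<open>exp (- c / t)\<close>\<close>

definition flat_exp :: "real \<Rightarrow> nat \<Rightarrow> real \<Rightarrow> real" where
  "flat_exp c m t = (if t > 0 then exp (- c / t) / t ^ m else 0)"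

lemma exp_minus_le_fact:
  fixes s :: real
  assumes "s > 0"
  shows "exp (- s) \<le> fact k / s ^ k"
proof -
  have s: "(\<lambda>n. s ^ n /\<^sub>R fact n) sums exp s" by (rule exp_converges)
  have "(\<Sum>n\<in>{k}. s ^ n /\<^sub>R fact n) \<le> (\<Sum>n. s ^ n /\<^sub>R fact n)"
    using assms by (intro sum_le_suminf sums_summable[OF s]) auto
  then have "s ^ k / fact k \<le> exp s"
    using sums_unique[OF s] by (simp add: divide_inverse mult.commute)
  then show ?thesis using assms by (simp add: exp_minus field_simps)
qed

text \<open>The exponential dominates each term of its series, here the one of degree
  \<open>m + 2\<close>. Two powers of \<open>t\<close> survive the division by \<open>t ^ m\<close>,
  and a quadratic bound is what makes the derivative at 0 vanish.\<close>

lemma flat_exp_le: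
  assumes c: "c > 0"
  shows "\<bar>flat_exp c m t\<bar> \<le> fact (m + 2) / c ^ (m + 2) * t\<^sup>2"
proof (cases "t > 0")
  case True
  have "exp (- (c / t)) \<le> fact (m + 2) / (c / t) ^ (m + 2)"
    using c True by (intro exp_minus_le_fact) auto
  then have "exp (- (c / t)) \<le> fact (m + 2) * t ^ (m + 2) / c ^ (m + 2)"
    by (simp only: power_divide divide_divide_eq_right)
  then have "exp (- (c / t)) / t ^ m \<le> fact (m + 2) * t ^ (m + 2) / c ^ (m + 2) / t ^ m"
    using True by (intro divide_right_mono) auto
  also have "\<dots> = fact (m + 2) / c ^ (m + 2) * t\<^sup>2"
    using True by (simp add: power_add del: fact_Suc power_Suc add_2_eq_Suc')
  finally show ?thesis using True by (simp add: flat_exp_def)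
qed (use c in \<open>auto simp: flat_exp_def\<close>)

lemma flat_exp_has_derivative:
  assumes c: "c > 0"
  shows "(flat_exp c m has_real_derivative
          c * flat_exp c (m + 2) t - real m * flat_exp c (m + 1) t) (at t)"
proof -
  consider "t > 0" | "t < 0" | "t = 0" by linarith
  then show ?thesis
  proof cases
    case 1
    have "((\<lambda>t. exp (- c / t) / t ^ m) has_real_derivative
          c * flat_exp c (m + 2) t - real m * flat_exp c (m + 1) t) (at t)"
      using 1
      apply (auto intro!: derivative_eq_intros simp: flat_exp_def)
      apply (cases m)
       apply (auto simp: field_simps power2_eq_square power_add)
      done
    then show ?thesis
      by (rule DERIV_cong_ev[THEN iffD1, rotated -1])
         (use 1 in \<open>auto simp: flat_exp_def eventually_nhds intro!: exI[of _ "{0<..}"]\<close>)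
  next
    case 2
    have "((\<lambda>t. 0) has_real_derivative
          c * flat_exp c (m + 2) t - real m * flat_exp c (m + 1) t) (at t)"
      using 2 by (auto simp: flat_exp_def)
    then show ?thesis
      by (rule DERIV_cong_ev[THEN iffD1, rotated -1])
         (use 2 in \<open>auto simp: flat_exp_def eventually_nhds intro!: exI[of _ "{..<0}"]\<close>)
  next
    \<comment> \<open>At 0 the quadratic bound forces the difference quotient to 0, and both terms
      of the claimed derivative are 0 there by the definition of \<open>flat_exp\<close>.\<close>
    case 3
    let ?C = "fact (m + 2) / c ^ (m + 2)"
    have "((\<lambda>h. flat_exp c m h / h) \<longlongrightarrow> 0) (at 0)"
    proof (rule Lim_null_comparison)
      show "\<forall>\<^sub>F h in at 0. norm (flat_exp c m h / h) \<le> ?C * \<bar>h\<bar>"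
      proof (rule eventually_at_filter[THEN iffD2], rule always_eventually, intro allI impI)
        fix h :: real assume "h \<noteq> 0"
        have "\<bar>flat_exp c m h\<bar> / \<bar>h\<bar> \<le> (?C * \<bar>h\<bar>\<^sup>2) / \<bar>h\<bar>"
          using divide_right_mono[OF flat_exp_le[OF c, of m h] abs_ge_zero[of h]]
          by (simp only: power2_abs)
        also have "\<dots> = ?C * \<bar>h\<bar>" using \<open>h \<noteq> 0\<close>
          by (simp only: power2_eq_square mult.assoc[symmetric] nonzero_mult_div_cancel_right abs_eq_0 not_False_eq_True)
        finally show "norm (flat_exp c m h / h) \<le> ?C * \<bar>h\<bar>"
          by simp
      qed
      show "((\<lambda>h. ?C * \<bar>h\<bar>) \<longlongrightarrow> 0) (at 0)"
        by (intro tendsto_mult_right_zero tendsto_rabs_zero tendsto_ident_at)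
    qed
    then show ?thesis
      using 3 c by (simp add: DERIV_def flat_exp_def)
  qed
qed

text \<open>A syntactic class closed under differentiation, to which \<open>smooth_coinduct\<close>
  applies at once. It has no quotients; the powers of \<open>1 / t\<close> produced by
  differentiating \<open>exp (- c / t)\<close> are instead built into \<open>flat_exp\<close>
  through its index \<open>m\<close>.\<close>

inductive elementary :: "('a::euclidean_space \<Rightarrow> real) \<Rightarrow> bool" where
  elementary_const: "elementary (\<lambda>x. c)"
| elementary_inner: "elementary (\<lambda>x. x \<bullet> b)"
| elementary_add: "elementary f \<Longrightarrow> elementary g \<Longrightarrow> elementary (\<lambda>x. f x + g x)"
| elementary_mult: "elementary f \<Longrightarrow> elementary g \<Longrightarrow> elementary (\<lambda>x. f x * g x)"
| elementary_flat_exp: "elementary f \<Longrightarrow> c > 0 \<Longrightarrow> elementary (\<lambda>x. flat_exp c m (f x))"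

lemma elementary_has_derivative:
  "elementary f \<Longrightarrow> \<exists>f'. (\<forall>x. (f has_derivative f' x) (at x)) \<and> (\<forall>h. elementary (\<lambda>x. f' x h))"
proof (induction rule: elementary.induct)
  case (elementary_const c)
  show ?case by (rule exI[of _ "\<lambda>x h. 0"]) (auto intro!: derivative_eq_intros elementary.intros)
next
  case (elementary_inner b)
  show ?case by (rule exI[of _ "\<lambda>x h. h \<bullet> b"]) (auto intro!: derivative_eq_intros elementary.intros)
next
  case (elementary_add f g)
  then obtain f' g' where "\<And>x. (f has_derivative f' x) (at x)" "\<And>h. elementary (\<lambda>x. f' x h)"
    "\<And>x. (g has_derivative g' x) (at x)" "\<And>h. elementary (\<lambda>x. g' x h)" by blast
  then show ?case
    by (intro exI[of _ "\<lambda>x h. f' x h + g' x h"]) (auto intro!: derivative_intros elementary.intros)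
next
  case (elementary_mult f g)
  then obtain f' g' where "\<And>x. (f has_derivative f' x) (at x)" "\<And>h. elementary (\<lambda>x. f' x h)"
    "\<And>x. (g has_derivative g' x) (at x)" "\<And>h. elementary (\<lambda>x. g' x h)" by blast
  then show ?case using elementary_mult(1,2)
    by (intro exI[of _ "\<lambda>x h. f x * g' x h + f' x h * g x"]) (auto intro!: derivative_intros elementary.intros)
next
  case (elementary_flat_exp f c m)
  then obtain f' where f': "\<And>x. (f has_derivative f' x) (at x)" "\<And>h. elementary (\<lambda>x. f' x h)" by blast
  let ?g = "\<lambda>x. c * flat_exp c (m + 2) (f x) + (- real m) * flat_exp c (m + 1) (f x)"
  have "((\<lambda>x. flat_exp c m (f x)) has_derivative (\<lambda>h. f' x h * ?g x)) (at x)" for x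
    using DERIV_compose_FDERIV[OF flat_exp_has_derivative[OF \<open>c > 0\<close>] f'(1)] by simp
  moreover have "elementary (\<lambda>x. f' x h * ?g x)" for h
    by (intro elementary.intros f' elementary_flat_exp)
  ultimately show ?case by (intro exI[of _ "\<lambda>x h. f' x h * ?g x"]) blast
qed

lemma elementary_smooth:
  assumes "elementary f"
  shows "smooth f"
proof (rule smooth_coinduct[of f "Collect elementary"])
  fix f :: "'a \<Rightarrow> real" and b x assume "f \<in> Collect elementary"
  then obtain f' where f': "\<And>x. (f has_derivative f' x) (at x)" "\<And>h. elementary (\<lambda>x. f' x h)"
    using elementary_has_derivative by blast
  have "frechet_derivative f (at x) = f' x" for x
    using frechet_derivative_at[OF f'(1)] by simp
  then show "(\<lambda>x. frechet_derivative f (at x) b) \<in> Collect elementary" using f' by simp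
  show "f differentiable at x" using f' by (auto simp: differentiable_def)
qed (use assms in auto)

lemma elementary_prod: "finite I \<Longrightarrow> (\<And>i. i \<in> I \<Longrightarrow> elementary (f i)) \<Longrightarrow> elementary (\<lambda>x. \<Prod>i\<in>I. f i x)"
  by (induction I rule: finite_induct) (auto intro: elementary.intros)

section \<open>Linear combinations, supports and bounds of test functions\<close>

lemma test_functions_lincomb:
  assumes "f \<in> test_functions \<Omega>" "g \<in> test_functions \<Omega>"
  shows "(\<lambda>x. a * f x + b * g x) \<in> test_functions \<Omega>"
proof -
  have "closure {x. a * f x + b * g x \<noteq> 0} \<subseteq> closure ({x. f x \<noteq> 0} \<union> {x. g x \<noteq> 0})"
    by (intro closure_mono) auto
  then have *: "closure {x. a * f x + b * g x \<noteq> 0} \<subseteq> closure {x. f x \<noteq> 0} \<union> closure {x. g x \<noteq> 0}"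
    by (simp add: closure_Un)
  moreover have "compact (closure {x. f x \<noteq> 0} \<union> closure {x. g x \<noteq> 0})"
    using assms by (auto simp: test_functions_def)
  ultimately have "compact (closure {x. a * f x + b * g x \<noteq> 0})"
    by (meson bounded_subset closed_closure compact_eq_bounded_closed)
  then show ?thesis
    using * assms smooth_lincomb[of f g a b] by (auto simp: test_functions_def smooth_def)
qed

lemma test_function_smooth: "f \<in> test_functions \<Omega> \<Longrightarrow> smooth f"
  by (simp add: test_functions_def smooth_def)

lemma test_function_zero: "f \<in> test_functions \<Omega> \<Longrightarrow> x \<notin> \<Omega> \<Longrightarrow> f x = 0"
  using closure_subset[of "{x. f x \<noteq> 0}"] by (auto simp: test_functions_def)

lemma gradient_zero_outside:
  assumes "x \<notin> closure {x. f x \<noteq> 0}"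
  shows "gradient f x = 0"
proof (rule gradient_eqI)
  have "((\<lambda>x. 0) has_derivative (\<lambda>h. 0 \<bullet> h)) (at x)" by simp
  then show "(f has_derivative (\<lambda>h. 0 \<bullet> h)) (at x)"
  proof (rule has_derivative_transform_within_open)
    show "open (- closure {x. f x \<noteq> 0})" by auto
    show "x \<in> - closure {x. f x \<noteq> 0}" using assms by simp
    show "\<And>y. y \<in> - closure {x. f x \<noteq> 0} \<Longrightarrow> 0 = f y"
      using closure_subset[of "{x. f x \<noteq> 0}"] by auto
  qed
qed

lemma test_function_gradient_zero: "f \<in> test_functions \<Omega> \<Longrightarrow> x \<notin> \<Omega> \<Longrightarrow> gradient f x = 0"
  by (rule gradient_zero_outside) (auto simp: test_functions_def)

lemma test_function_bounded:
  assumes "f \<in> test_functions \<Omega>"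
  obtains B where "\<And>x. \<bar>f x\<bar> \<le> B" "\<And>x. norm (gradient f x) \<le> B"
proof -
  let ?K = "closure {x. f x \<noteq> 0}"
  have K: "compact ?K" using assms by (auto simp: test_functions_def)
  note sm = test_function_smooth[OF assms]
  obtain B1 where B1: "\<And>x. x \<in> ?K \<Longrightarrow> norm (f x) \<le> B1"
    using compact_imp_bounded[OF compact_continuous_image[OF smooth_continuous_on[OF sm] K]]
    by (auto simp: bounded_iff)
  obtain B2 where B2: "\<And>x. x \<in> ?K \<Longrightarrow> norm (gradient f x) \<le> B2"
    using compact_imp_bounded[OF compact_continuous_image[OF smooth_gradient_continuous_on[OF sm] K]]
    by (auto simp: bounded_iff)
  have "\<bar>f x\<bar> \<le> max 0 (max B1 B2)" for x
    using B1[of x] closure_subset[of "{x. f x \<noteq> 0}"] by (cases "f x = 0") (auto simp: max_def)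
  moreover have "norm (gradient f x) \<le> max 0 (max B1 B2)" for x
    using B2[of x] gradient_zero_outside[of x f] by (cases "x \<in> ?K") auto
  ultimately show ?thesis by (rule that)
qed

section \<open>Uniqueness of weak gradients\<close>

text \<open>The positive and negative parts of \<open>F\<close> are the densities of two measures.
  These agree on boxes, an intersection-stable generator of the Borel sets, hence everywhere, and
  densities are unique almost everywhere. A Borel version \<open>G\<close> takes the place of
  \<open>F\<close> because the argument lives on \<open>lborel\<close>.\<close>

lemma AE_zero_of_box_integrals:
  fixes F :: "'a::euclidean_space \<Rightarrow> real"
  assumes F: "integrable lebesgue F"
    and box: "\<And>a b. (LINT x|lebesgue. F x * indicator (box a b) x) = 0"
  shows "AE x in lebesgue. F x = 0"
proof -
  obtain G where G [measurable]: "G \<in> borel_measurable lborel" and FG: "AE x in lborel. F x = G x"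
    using completion_ex_borel_measurable_real[of F lborel] F by auto
  note FG' = AE_completion[OF FG]
  have intG: "integrable lborel G"
    using integrable_cong_AE[OF _ _ FG', THEN iffD1] F by (simp add: integrable_completion measurable_completion)
  have boxG: "(LINT x|lborel. G x * indicator (box a b) x) = 0" for a b :: 'a
  proof -
    have "(LINT x|lborel. G x * indicator (box a b) x) = (LINT x|lebesgue. G x * indicator (box a b) x)"
      by (rule integral_completion[symmetric]) measurable
    also have "\<dots> = (LINT x|lebesgue. F x * indicator (box a b) x)"
    proof (rule integral_cong_AE)
      have m: "F \<in> borel_measurable lebesgue" "G \<in> borel_measurable lebesgue"
        using F by (auto simp: measurable_completion)
      show "(\<lambda>x. G x * indicator (box a b) x) \<in> borel_measurable lebesgue"
        "(\<lambda>x. F x * indicator (box a b) x) \<in> borel_measurable lebesgue"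
        using m by (auto intro!: borel_measurable_times borel_measurable_indicator)
      show "AE x in lebesgue. G x * indicator (box a b) x = F x * indicator (box a b) x"
        using FG' by eventually_elim simp
    qed
    finally show ?thesis using box by simp
  qed
  let ?p = "\<lambda>x. ennreal (G x)" and ?n = "\<lambda>x. ennreal (- G x)"
  have fin: "(\<integral>\<^sup>+x. ?p x \<partial>lborel) < \<infinity>" "(\<integral>\<^sup>+x. ?n x \<partial>lborel) < \<infinity>"
    using intG unfolding real_integrable_def by (auto simp: less_top)
  have eq: "emeasure (density lborel ?p) (box a b) = emeasure (density lborel ?n) (box a b)" for a b
  proof -
    let ?I = "indicator (box a b) :: 'a \<Rightarrow> real" and ?J = "indicator (box a b) :: 'a \<Rightarrow> ennreal"
    have int: "integrable lborel (\<lambda>x. G x * ?I x)"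
      using integrable_mult_indicator[OF _ intG, of "box a b"] by (simp add: mult.commute)
    have J: "(\<lambda>x. ennreal (G x * ?I x)) = (\<lambda>x. ?p x * ?J x)"
      "(\<lambda>x. ennreal (- (G x * ?I x))) = (\<lambda>x. ?n x * ?J x)"
      by (auto simp: fun_eq_iff split: split_indicator)
    have "enn2real (\<integral>\<^sup>+x. ?p x * ?J x \<partial>lborel) = enn2real (\<integral>\<^sup>+x. ?n x * ?J x \<partial>lborel)"
      using boxG[of a b] real_lebesgue_integral_def[OF int] by (simp add: J)
    \<comment> \<open>\<open>enn2real\<close> sends infinity to 0, so equality of the real values
      lifts back to \<open>ennreal\<close> only together with finiteness of both integrals.\<close>
    moreover have "(\<integral>\<^sup>+x. ?p x * ?J x \<partial>lborel) < \<infinity>" "(\<integral>\<^sup>+x. ?n x * ?J x \<partial>lborel) < \<infinity>"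
      using int unfolding real_integrable_def J by (auto simp: less_top)
    ultimately show ?thesis
      by (simp add: emeasure_density) (metis ennreal_enn2real infinity_ennreal_def)
  qed
  have "density lborel ?p = density lborel ?n"
  proof (rule measure_eqI_generator_eq)
    let ?E = "range (\<lambda>(a, b). box a b::'a set)"
    show "Int_stable ?E" by (auto simp: Int_stable_def box_Int_box)
    show "?E \<subseteq> Pow UNIV" "sets (density lborel ?p) = sigma_sets UNIV ?E"
      "sets (density lborel ?n) = sigma_sets UNIV ?E"
      by (simp_all add: borel_eq_box)
    let ?A = "\<lambda>n::nat. box (- (real n *\<^sub>R One)) (real n *\<^sub>R One) :: 'a set"
    show "range ?A \<subseteq> ?E" "(\<Union>i. ?A i) = UNIV" unfolding UN_box_eq_UNIV by auto
    show "emeasure (density lborel ?p) (?A i) \<noteq> \<infinity>" for i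
    proof -
      have "emeasure (density lborel ?p) (?A i) \<le> (\<integral>\<^sup>+x. ?p x \<partial>lborel)"
        by (auto simp: emeasure_density intro!: nn_integral_mono split: split_indicator)
      then show ?thesis using fin(1) by (auto simp: top_unique)
    qed
    show "emeasure (density lborel ?p) X = emeasure (density lborel ?n) X" if "X \<in> ?E" for X
      using that eq by auto
  qed
  then have "AE x in lborel. ?p x = ?n x"
    by (intro sigma_finite_measure.density_unique[OF sigma_finite_lborel]) auto
  with FG have "AE x in lborel. F x = 0"
  proof eventually_elim
    case (elim x)
    then show ?case by (cases "G x \<ge> 0") (auto simp: ennreal_neg ennreal_eq_0_iff)
  qed
  then show ?thesis by (rule AE_completion)
qed

text \<open>In one coordinate, the product of two flat exponentials centred at the endpoints is
  positive exactly between them. Letting the parameter \<open>1 / Suc n\<close> tend to 0 lifts it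
  to 1 there, and the product over all coordinates lives on the box.\<close>

lemma test_function_box_approx:
  fixes c d :: "'a::euclidean_space"
  assumes "cbox c d \<subseteq> \<Omega>"
  obtains \<phi> where "\<And>n. \<phi> n \<in> test_functions \<Omega>" "\<And>n x. \<bar>\<phi> n x\<bar> \<le> indicator (cbox c d) x"
    "\<And>x. (\<lambda>n. \<phi> n x) \<longlonglongrightarrow> indicator (box c d) x"
proof -
  define \<psi> where "\<psi> n b x = flat_exp (1 / Suc n) 0 (x \<bullet> b - c \<bullet> b) * flat_exp (1 / Suc n) 0 (d \<bullet> b - x \<bullet> b)"
    for n :: nat and b x :: 'a
  define \<phi> where "\<phi> n x = (\<Prod>b\<in>Basis. \<psi> n b x)" for n :: nat and x :: 'a
  have flat01: "0 \<le> flat_exp (1 / Suc n) 0 t" "flat_exp (1 / Suc n) 0 t \<le> 1" for n t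
    by (auto simp: flat_exp_def)
  have \<psi>01: "0 \<le> \<psi> n b x" "\<psi> n b x \<le> 1" for n b x
    unfolding \<psi>_def using flat01 by (auto intro: mult_le_one)
  have \<psi>0: "\<psi> n b x = 0" if "\<not> (c \<bullet> b < x \<bullet> b \<and> x \<bullet> b < d \<bullet> b)" for n b x
    using that by (auto simp: \<psi>_def flat_exp_def)
  have out: "\<phi> n x = 0" if "x \<notin> box c d" for n x
    using that \<psi>0[of _ x n] unfolding \<phi>_def mem_box by (auto intro!: prod_zero)
  have "elementary (\<psi> n b)" for n and b :: 'a
  proof -
    have "elementary (\<lambda>x::'a. flat_exp (1 / Suc n) 0 (x \<bullet> b + (- (c \<bullet> b))) * flat_exp (1 / Suc n) 0 (d \<bullet> b + (-1) * (x \<bullet> b)))"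
      by (intro elementary.intros) auto
    then show ?thesis by (simp add: \<psi>_def [abs_def])
  qed
  then have "smooth (\<phi> n)" for n
    unfolding \<phi>_def [abs_def] by (intro elementary_smooth elementary_prod) auto
  moreover have "closure {x. \<phi> n x \<noteq> 0} \<subseteq> cbox c d" for n
  proof -
    have "{x. \<phi> n x \<noteq> 0} \<subseteq> cbox c d" using out box_subset_cbox by blast
    then show ?thesis by (rule closure_minimal) (rule closed_cbox)
  qed
  ultimately have "\<phi> n \<in> test_functions \<Omega>" for n
    using assms by (fastforce simp: test_functions_def smooth_def
        intro: compact_closure[THEN iffD2] bounded_subset[OF bounded_cbox] dest: subset_trans[OF closure_subset])
  moreover have "\<bar>\<phi> n x\<bar> \<le> indicator (cbox c d) x" for n x
  proof (cases "x \<in> box c d")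
    case True
    then have "x \<in> cbox c d" using box_subset_cbox by blast
    then show ?thesis using \<psi>01
      by (auto simp: \<phi>_def abs_prod intro!: prod_le_1)
  qed (simp add: out)
  moreover have "(\<lambda>n. \<phi> n x) \<longlonglongrightarrow> indicator (box c d) x" for x
  proof (cases "x \<in> box c d")
    case True
    have lim: "(\<lambda>n. flat_exp (1 / Suc n) 0 t) \<longlonglongrightarrow> 1" if "t > 0" for t
    proof -
      have "(\<lambda>n. exp (- (1 / real (Suc n)) / t)) \<longlonglongrightarrow> exp (- 0 / t)"
        using that by (intro tendsto_intros LIMSEQ_Suc[OF lim_1_over_n]) auto
      then show ?thesis using that by (simp add: flat_exp_def)
    qed
    have "(\<lambda>n. \<phi> n x) \<longlonglongrightarrow> (\<Prod>b\<in>(Basis :: 'a set). 1 * 1)"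
      unfolding \<phi>_def \<psi>_def using True
      by (intro tendsto_prod tendsto_mult lim) (auto simp: mem_box)
    then show ?thesis using True by simp
  next
    case False
    then show ?thesis by (simp add: out)
  qed
  ultimately show ?thesis using that by blast
qed

lemma integrable_times_test_function:
  assumes \<Omega>: "open \<Omega>" and f: "locally_integrable \<Omega> (f :: 'a::euclidean_space \<Rightarrow> real)"
    and g: "continuous_on UNIV g" and K: "compact K" "K \<subseteq> \<Omega>" and z: "\<And>x. x \<notin> K \<Longrightarrow> g x = 0"
  shows "integrable (lebesgue_on \<Omega>) (\<lambda>x. f x * g x)"
proof -
  have \<Omega>s: "\<Omega> \<in> sets lebesgue" and Ks: "K \<in> sets lebesgue"
    using \<Omega> K by (auto intro: fmeasurableD lmeasurable_compact)
  have fK: "integrable lebesgue (\<lambda>x. indicator K x *\<^sub>R f x)"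
    using f K Ks by (subst integrable_restrict_space[symmetric]) (auto simp: locally_integrable_def)
  obtain B where B: "\<And>x. x \<in> K \<Longrightarrow> norm (g x) \<le> B"
    using compact_imp_bounded[OF compact_continuous_image[OF continuous_on_subset[OF g] K(1)]]
    by (auto simp: bounded_iff)
  have gm [measurable]: "g \<in> borel_measurable lebesgue"
    using borel_measurable_continuous_onI[OF g] by (simp add: measurable_completion)
  have "integrable lebesgue (\<lambda>x. g x * (indicator K x *\<^sub>R f x))"
  proof (rule Bochner_Integration.integrable_bound)
    show "integrable lebesgue (\<lambda>x. B * (indicator K x *\<^sub>R f x))" using fK by auto
    show "(\<lambda>x. g x * (indicator K x *\<^sub>R f x)) \<in> borel_measurable lebesgue"
      using fK by measurable
    have "norm (g x * (indicator K x *\<^sub>R f x)) \<le> norm (B * (indicator K x *\<^sub>R f x))" for x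
      using B[of x] by (auto simp: abs_mult split: split_indicator intro!: mult_right_mono)
    then show "AE x in lebesgue. norm (g x * (indicator K x *\<^sub>R f x)) \<le> norm (B * (indicator K x *\<^sub>R f x))"
      by simp
  qed
  moreover have "(\<lambda>x. g x * (indicator K x *\<^sub>R f x)) = (\<lambda>x. indicator \<Omega> x *\<^sub>R (f x * g x))"
    using K z by (auto simp: fun_eq_iff split: split_indicator)
  ultimately show ?thesis using \<Omega>s by (subst integrable_restrict_space) auto
qed

text \<open>Test functions converging boundedly to the indicator of a box give vanishing box
  integrals, so \<open>AE_zero_of_box_integrals\<close> applies on each closed box inside
  \<open>\<Omega>\<close>; countably many of these cover \<open>\<Omega>\<close>.\<close>

lemma fundamental_lemma:
  fixes f :: "'a::euclidean_space \<Rightarrow> real"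
  assumes \<Omega>: "open \<Omega>" and f: "locally_integrable \<Omega> f"
    and zero: "\<And>\<phi>. \<phi> \<in> test_functions \<Omega> \<Longrightarrow> (LINT x|lebesgue_on \<Omega>. f x * \<phi> x) = 0"
  shows "AE x in lebesgue_on \<Omega>. f x = 0"
proof -
  have \<Omega>s: "\<Omega> \<in> sets lebesgue" using \<Omega> by auto
  have fK: "integrable lebesgue (\<lambda>x. indicator K x *\<^sub>R f x)" if "compact K" "K \<subseteq> \<Omega>" for K
    using f that by (subst integrable_restrict_space[symmetric]) (auto simp: locally_integrable_def intro: fmeasurableD lmeasurable_compact)
  have box0: "(LINT x|lebesgue. f x * indicator (box c d) x) = 0" if cd: "cbox c d \<subseteq> \<Omega>" for c d
  proof -
    obtain \<phi> where \<phi>: "\<And>n. \<phi> n \<in> test_functions \<Omega>" "\<And>n x. \<bar>\<phi> n x\<bar> \<le> indicator (cbox c d) x"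
      "\<And>x. (\<lambda>n. \<phi> n x) \<longlonglongrightarrow> indicator (box c d) x"
      using test_function_box_approx[OF cd] by blast
    have out: "\<phi> n x = 0" if "x \<notin> cbox c d" for n x
      using \<phi>(2)[of n x] that by auto
    let ?g = "\<lambda>x. indicator (cbox c d) x *\<^sub>R f x"
    have g: "integrable lebesgue ?g" by (intro fK cd compact_cbox)
    have eq: "f x * \<phi> n x = ?g x * \<phi> n x" "f x * indicator (box c d) x = ?g x * indicator (box c d) x" for n x
      using out[of x n] box_subset_cbox[of c d] by (auto split: split_indicator)
    have m [measurable]: "\<phi> n \<in> borel_measurable lebesgue" for n
      using borel_measurable_continuous_onI[OF smooth_continuous_on[OF test_function_smooth[OF \<phi>(1)]]]
      by (simp add: measurable_completion)
    have "(\<lambda>n. LINT x|lebesgue. ?g x * \<phi> n x) \<longlonglongrightarrow> (LINT x|lebesgue. ?g x * indicator (box c d) x)"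
    proof (rule integral_dominated_convergence)
      show "integrable lebesgue (\<lambda>x. norm (?g x))" using g by simp
      show "(\<lambda>x. ?g x * \<phi> n x) \<in> borel_measurable lebesgue" for n using g by measurable
      show "(\<lambda>x. ?g x * indicator (box c d) x) \<in> borel_measurable lebesgue"
        using g by (intro borel_measurable_times borel_measurable_indicator borel_measurable_integrable) auto
      show "AE x in lebesgue. (\<lambda>n. ?g x * \<phi> n x) \<longlonglongrightarrow> ?g x * indicator (box c d) x"
        by (intro always_eventually allI tendsto_intros \<phi>)
      show "AE x in lebesgue. norm (?g x * \<phi> n x) \<le> norm (?g x)" for n
        using \<phi>(2)[of n] by (auto simp: abs_mult intro!: always_eventually mult_left_le split: split_indicator)
          (metis indicator_simps(1) mult_left_le abs_ge_zero)
    qed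
    moreover have "(LINT x|lebesgue. ?g x * \<phi> n x) = 0" for n
    proof -
      have "(LINT x|lebesgue. indicator \<Omega> x *\<^sub>R (f x * \<phi> n x)) = 0"
        using zero[OF \<phi>(1), of n] \<Omega>s by (subst (asm) integral_restrict_space) auto
      moreover have "(\<lambda>x. indicator \<Omega> x *\<^sub>R (f x * \<phi> n x)) = (\<lambda>x. ?g x * \<phi> n x)"
        using out[of _ n] cd by (auto simp: fun_eq_iff split: split_indicator)
      ultimately show ?thesis by (simp only:)
    qed
    ultimately have "(LINT x|lebesgue. ?g x * indicator (box c d) x) = 0"
      by (simp add: LIMSEQ_const_iff)
    then show ?thesis by (simp only: eq(2))
  qed
  have cb: "AE x in lebesgue. x \<in> cbox c d \<longrightarrow> f x = 0" if cd: "cbox c d \<subseteq> \<Omega>" for c d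
  proof -
    have "AE x in lebesgue. indicator (box c d) x *\<^sub>R f x = 0"
    proof (rule AE_zero_of_box_integrals)
      have "integrable lebesgue (\<lambda>x. indicator (box c d) x *\<^sub>R (indicator (cbox c d) x *\<^sub>R f x))"
        by (intro integrable_mult_indicator fK cd compact_cbox) auto
      also have "(\<lambda>x. indicator (box c d) x *\<^sub>R (indicator (cbox c d) x *\<^sub>R f x)) = (\<lambda>x. indicator (box c d) x *\<^sub>R f x)"
        using box_subset_cbox[of c d] by (auto simp: fun_eq_iff split: split_indicator)
      finally show "integrable lebesgue (\<lambda>x. indicator (box c d) x *\<^sub>R f x)" .
      fix a b :: 'a
      \<comment> \<open>Intersecting with an arbitrary \<open>box a b\<close> leaves a box whose
        closure is still inside \<open>cbox c d\<close>, so the integrals of the truncated function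
        are again of the kind \<open>box0\<close> handles.\<close>
      define l u where "l = (\<Sum>i\<in>Basis. max (c \<bullet> i) (a \<bullet> i) *\<^sub>R i)" and "u = (\<Sum>i\<in>Basis. min (d \<bullet> i) (b \<bullet> i) *\<^sub>R i)"
      have lu: "box c d \<inter> box a b = box l u" by (simp add: box_Int_box l_def u_def)
      have "cbox l u \<subseteq> cbox c d" by (auto simp: mem_box l_def u_def)
      then have "(LINT x|lebesgue. f x * indicator (box l u) x) = 0"
        using box0 cd by blast
      moreover have "(\<lambda>x. indicator (box c d) x *\<^sub>R f x * indicator (box a b) x) = (\<lambda>x. f x * indicator (box l u) x)"
        unfolding lu[symmetric] by (auto simp: fun_eq_iff split: split_indicator)
      ultimately show "(LINT x|lebesgue. indicator (box c d) x *\<^sub>R f x * indicator (box a b) x) = 0"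
        by (simp only:)
    qed
    moreover have "AE x in lebesgue. x \<notin> cbox c d - box c d"
      using negligible_frontier_interval[of c d] unfolding negligible_iff_null_sets by (rule AE_not_in)
    ultimately show ?thesis
    proof eventually_elim
      case (elim x)
      then show ?case by (cases "x \<in> box c d") auto
    qed
  qed
  obtain \<D> where D: "countable \<D>" "\<And>X. X \<in> \<D> \<Longrightarrow> X \<subseteq> \<Omega>" "\<And>X. X \<in> \<D> \<Longrightarrow> \<exists>a b. X = cbox a b" "\<Union>\<D> = \<Omega>"
    by (rule open_countable_Union_open_cbox[OF \<Omega>]) (rule that, auto simp: subset_iff)
  have "AE x in lebesgue. \<forall>X\<in>\<D>. x \<in> X \<longrightarrow> f x = 0"
  proof (rule AE_ball_countable[THEN iffD2, OF D(1)], rule ballI)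
    fix X assume "X \<in> \<D>"
    then obtain a b where ab: "X = cbox a b" "X \<subseteq> \<Omega>" using D(2,3)[of X] by auto
    show "AE x in lebesgue. x \<in> X \<longrightarrow> f x = 0" using cb[of a b] ab by simp
  qed
  then have "AE x in lebesgue. x \<in> \<Omega> \<longrightarrow> f x = 0"
  proof eventually_elim
    case (elim x)
    show ?case
    proof
      assume "x \<in> \<Omega>"
      then obtain X where "X \<in> \<D>" "x \<in> X" unfolding D(4)[symmetric] by (elim UnionE)
      then show "f x = 0" using elim by blast
    qed
  qed
  then show ?thesis using \<Omega>s by (subst AE_restrict_space_iff) auto
qed

lemma locally_integrable_inner:
  assumes "locally_integrable \<Omega> g"
  shows "locally_integrable \<Omega> (\<lambda>x. g x \<bullet> b)"
  using assms unfolding locally_integrable_def by auto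

lemma locally_integrable_diff:
  fixes f g :: "'a::euclidean_space \<Rightarrow> 'b::euclidean_space"
  assumes "locally_integrable \<Omega> f" "locally_integrable \<Omega> g"
  shows "locally_integrable \<Omega> (\<lambda>x. f x - g x)"
  using assms unfolding locally_integrable_def by auto

text \<open>In each coordinate the difference of two weak gradients integrates to zero against all
  test functions. This is what allows an explicitly constructed gradient to stand in for the
  \<open>SOME\<close> in \<open>weak_gradient\<close>.\<close>

lemma has_weak_gradient_unique:
  assumes \<Omega>: "open \<Omega>" and g: "has_weak_gradient \<Omega> w g" and g': "has_weak_gradient \<Omega> w g'"
  shows "AE x in lebesgue_on \<Omega>. g x = g' x"
proof -
  have "AE x in lebesgue_on \<Omega>. (g x - g' x) \<bullet> b = 0" if b: "b \<in> Basis" for b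
  proof (rule fundamental_lemma[OF \<Omega>])
    show "locally_integrable \<Omega> (\<lambda>x. (g x - g' x) \<bullet> b)"
      using g g' by (auto simp: has_weak_gradient_def intro!: locally_integrable_inner locally_integrable_diff)
    fix \<phi> assume \<phi>: "\<phi> \<in> test_functions \<Omega>"
    let ?K = "closure {x. \<phi> x \<noteq> 0}"
    have "integrable (lebesgue_on \<Omega>) (\<lambda>x. (h x \<bullet> b) * \<phi> x)" if "has_weak_gradient \<Omega> w h" for h
    proof (rule integrable_times_test_function[OF \<Omega>, where K = ?K])
      show "locally_integrable \<Omega> (\<lambda>x. h x \<bullet> b)"
        using that by (auto simp: has_weak_gradient_def intro!: locally_integrable_inner)
      show "\<phi> x = 0" if "x \<notin> ?K" for x using that closure_subset[of "{x. \<phi> x \<noteq> 0}"] by auto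
    qed (use \<phi> smooth_continuous_on[OF test_function_smooth[OF \<phi>]] in \<open>auto simp: test_functions_def\<close>)
    from this[OF g] this[OF g'] show "(LINT x|lebesgue_on \<Omega>. (g x - g' x) \<bullet> b * \<phi> x) = 0"
      using g g' \<phi> b by (simp add: inner_diff_left left_diff_distrib has_weak_gradient_def)
  qed
  then have "AE x in lebesgue_on \<Omega>. \<forall>b\<in>Basis. (g x - g' x) \<bullet> b = 0"
    by (intro AE_finite_allI) auto
  then show ?thesis
    by eventually_elim (metis euclidean_all_zero_iff right_minus_eq)
qed

lemma has_weak_gradient_weak_gradient:
  "has_weak_gradient \<Omega> w g \<Longrightarrow> has_weak_gradient \<Omega> w (weak_gradient \<Omega> w)"
  unfolding weak_gradient_def by (rule someI[of "has_weak_gradient \<Omega> w"])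

lemma AE_weak_gradient_eq:
  assumes "open \<Omega>" "has_weak_gradient \<Omega> w g"
  shows "AE x in lebesgue_on \<Omega>. weak_gradient \<Omega> w x = g x"
  using has_weak_gradient_unique[OF assms(1) has_weak_gradient_weak_gradient[OF assms(2)] assms(2)] .

section \<open>Mollification of Lipschitz functions\<close>

lemma elementary_sum: "finite I \<Longrightarrow> (\<And>i. i \<in> I \<Longrightarrow> elementary (f i)) \<Longrightarrow> elementary (\<lambda>x. \<Sum>i\<in>I. f i x)"
  by (induction I rule: finite_induct) (auto intro: elementary.intros)

lemma integrable_compact_support:
  fixes f :: "'a::euclidean_space \<Rightarrow> real"
  assumes "compact K" "continuous_on UNIV f" "\<And>x. x \<notin> K \<Longrightarrow> f x = 0"
  shows "integrable lborel f"
proof -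
  have "integrable lborel (\<lambda>x. indicator K x *\<^sub>R f x)"
    by (intro borel_integrable_compact assms(1) continuous_on_subset[OF assms(2)]) simp
  moreover have "(\<lambda>x. indicator K x *\<^sub>R f x) = f"
    using assms(3) by (force simp: fun_eq_iff split: split_indicator)
  ultimately show ?thesis by (simp only:)
qed

text \<open>The standard mollifier: the profile is \<open>flat_exp\<close> composed with the
  polynomial \<open>\<epsilon>\<^sup>2 - z \<bullet> z\<close>, divided by its integral. The
  integral is positive because the profile is positive on a ball, which has positive
  measure.\<close>

lemma smooth_bump:
  fixes \<epsilon> :: real
  assumes "\<epsilon> > 0"
  obtains \<eta> :: "'a::euclidean_space \<Rightarrow> real" where "smooth \<eta>" "\<And>z. 0 \<le> \<eta> z"
    "\<And>z. norm z \<ge> \<epsilon> \<Longrightarrow> \<eta> z = 0" "integrable lborel \<eta>" "(LINT z|lborel. \<eta> z) = 1"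
proof -
  define \<kappa> :: "'a \<Rightarrow> real" where "\<kappa> z = flat_exp 1 0 (\<epsilon>\<^sup>2 - z \<bullet> z)" for z
  have "elementary (\<lambda>z::'a. flat_exp 1 0 (\<epsilon>\<^sup>2 + (-1) * (\<Sum>b\<in>Basis. (z \<bullet> b) * (z \<bullet> b))))"
    by (intro elementary.intros elementary_sum) auto
  then have "elementary \<kappa>"
    by (simp add: \<kappa>_def [abs_def] euclidean_inner[symmetric])
  then have sm: "smooth \<kappa>" by (rule elementary_smooth)
  have nn: "0 \<le> \<kappa> z" for z by (simp add: \<kappa>_def flat_exp_def)
  have pos: "\<kappa> z > 0" if "norm z < \<epsilon>" for z
  proof -
    have "(norm z)\<^sup>2 < \<epsilon>\<^sup>2" using that assms by (intro power_strict_mono) auto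
    then show ?thesis by (simp add: \<kappa>_def flat_exp_def power2_norm_eq_inner)
  qed
  have zero: "\<kappa> z = 0" if "norm z \<ge> \<epsilon>" for z
  proof -
    have "\<epsilon>\<^sup>2 \<le> (norm z)\<^sup>2" using that assms by (intro power_mono) auto
    then show ?thesis by (simp add: \<kappa>_def flat_exp_def power2_norm_eq_inner)
  qed
  have int: "integrable lborel \<kappa>"
    by (rule integrable_compact_support[of "cball 0 \<epsilon>"]) (auto intro: smooth_continuous_on sm zero)
  define I where "I = (LINT z|lborel. \<kappa> z)"
  have "I \<noteq> 0"
  proof
    assume "I = 0"
    then have "AE z in lborel. \<kappa> z = 0"
      unfolding I_def using integral_nonneg_eq_0_iff_AE[OF int] nn by auto
    then have "AE z in lborel. z \<notin> ball (0::'a) \<epsilon>"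
      by eventually_elim (use pos in force)
    then have "emeasure lborel (ball (0::'a) \<epsilon>) = 0"
      by (subst (asm) AE_iff_measurable[of "ball 0 \<epsilon>"]) (auto simp: dist_norm)
    then show False using emeasure_lborel_ball_finite content_ball_pos[of \<epsilon> "0::'a"] assms
      by (simp add: measure_def)
  qed
  moreover have "I \<ge> 0" unfolding I_def using nn by simp
  ultimately have I: "I > 0" by simp
  show ?thesis
  \<comment> \<open>The summand \<open>0 * \<kappa> z\<close> only brings the scaled profile into
    the form of \<open>smooth_lincomb\<close>.\<close>
  proof (rule that[of "\<lambda>z. (1 / I) * \<kappa> z + 0 * \<kappa> z"])
    show "smooth (\<lambda>z. (1 / I) * \<kappa> z + 0 * \<kappa> z)" by (rule smooth_lincomb[OF sm sm])
  qed (use I nn zero int in \<open>auto simp: I_def[symmetric]\<close>)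
qed

text \<open>Differentiation under the integral falls on the kernel alone, so the convolutions of
  \<open>T\<close> with all smooth kernels form a family closed under partial derivatives, as
  \<open>smooth_coinduct\<close> asks. Integrating over a fixed box gives the form to which the
  Leibniz rule applies.\<close>

lemma smooth_convolution:
  fixes T \<psi> :: "'a::euclidean_space \<Rightarrow> real"
  assumes T: "continuous_on UNIV T" and "smooth \<psi>"
  shows "smooth (\<lambda>x. integral (cbox a b) (\<lambda>y. T y * \<psi> (x - y)))"
proof -
  let ?F = "\<lambda>\<psi> x. integral (cbox a b) (\<lambda>y. T y * \<psi> (x - y))"
  let ?S = "{?F \<psi> | \<psi>. smooth \<psi>}"
  have D: "(?F \<psi> has_derivative (\<lambda>h. integral (cbox a b) (\<lambda>y. T y * (gradient \<psi> (x - y) \<bullet> h)))) (at x)"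
    if \<psi>: "smooth \<psi>" for \<psi> x
  proof -
    let ?fx = "\<lambda>x y. T y *\<^sub>R blinfun_inner_right (gradient \<psi> (x - y))"
    note [continuous_intros] =
      continuous_on_compose2[OF smooth_continuous_on[OF \<psi>, of UNIV]]
      continuous_on_compose2[OF smooth_gradient_continuous_on[OF \<psi>, of UNIV]]
      continuous_on_compose2[OF T]
      bounded_linear.continuous_on[OF bounded_linear_blinfun_inner_right]
    have "(?F \<psi> has_derivative integral (cbox a b) (?fx x)) (at x within UNIV)"
    proof (rule leibniz_rule)
      show "((\<lambda>x. T t * \<psi> (x - t)) has_derivative blinfun_apply (?fx x t)) (at x within UNIV)" for x t
      proof -
        have "((\<lambda>x. x - t) has_derivative (\<lambda>h. h)) (at x)"
          by (auto intro!: derivative_eq_intros)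
        from has_derivative_compose[OF this has_derivative_gradient[OF smooth_differentiable[OF \<psi>]]]
        have "((\<lambda>x. \<psi> (x - t)) has_derivative (\<lambda>h. gradient \<psi> (x - t) \<bullet> h)) (at x)" .
        moreover have "blinfun_apply (?fx x t) = (\<lambda>h. T t * (gradient \<psi> (x - t) \<bullet> h))"
          by (simp add: fun_eq_iff blinfun.scaleR_left)
        ultimately show ?thesis by (metis has_derivative_mult_right)
      qed
      show "(\<lambda>y. T y * \<psi> (x - y)) integrable_on cbox a b" for x
        by (intro integrable_continuous continuous_intros) auto
      show "continuous_on (UNIV \<times> cbox a b) (\<lambda>(x, t). ?fx x t)"
        unfolding split_beta by (intro continuous_intros) auto
    qed auto
    moreover have "blinfun_apply (integral (cbox a b) (?fx x)) h =
        integral (cbox a b) (\<lambda>y. T y * (gradient \<psi> (x - y) \<bullet> h))" for h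
    proof -
      have "?fx x integrable_on cbox a b"
        by (intro integrable_continuous continuous_intros) auto
      then show ?thesis by (simp add: blinfun_apply_integral blinfun.scaleR_left)
    qed
    then have "blinfun_apply (integral (cbox a b) (?fx x)) =
        (\<lambda>h. integral (cbox a b) (\<lambda>y. T y * (gradient \<psi> (x - y) \<bullet> h)))"
      by (rule ext)
    ultimately show ?thesis by (simp only:)
  qed
  show ?thesis
  proof (rule smooth_coinduct[of _ ?S])
    show "?F \<psi> \<in> ?S" using assms(2) by blast
  next
    fix f :: "'a \<Rightarrow> real" and x assume "f \<in> ?S"
    then show "f differentiable at x" using D by (auto simp: differentiable_def)
  next
    fix f :: "'a \<Rightarrow> real" and c :: 'a assume "f \<in> ?S" and c: "c \<in> Basis"
    then obtain \<psi> where f: "f = ?F \<psi>" and \<psi>: "smooth \<psi>" by auto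
    have "(\<lambda>x. frechet_derivative f (at x) c) = ?F (\<lambda>x. frechet_derivative \<psi> (at x) c)"
      unfolding f frechet_derivative_at[OF D[OF \<psi>], symmetric]
      by (simp add: gradient_inner smooth_differentiable \<psi>)
    then show "(\<lambda>x. frechet_derivative f (at x) c) \<in> ?S"
      using smooth_partial[OF \<psi> c] by auto
  qed
qed

text \<open>Differentiate in the direction of the gradient itself: the directional derivative equals
  the squared norm of the gradient, and the Lipschitz bound caps it by \<open>L\<close> times that
  norm.\<close>

lemma norm_gradient_le_lipschitz:
  fixes f :: "'a::euclidean_space \<Rightarrow> real"
  assumes d: "f differentiable at x" and L: "L-lipschitz_on UNIV f"
  shows "norm (gradient f x) \<le> L"
proof (cases "gradient f x = 0")
  case True
  then show ?thesis using lipschitz_on_nonneg[OF L] by simp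
next
  case False
  let ?g = "gradient f x"
  have "((\<lambda>t. x + t *\<^sub>R ?g) has_derivative (\<lambda>t. t *\<^sub>R ?g)) (at 0)"
    by (auto intro!: derivative_eq_intros)
  moreover have "(f has_derivative (\<lambda>h. ?g \<bullet> h)) (at (x + 0 *\<^sub>R ?g))"
    using has_derivative_gradient[OF d] by simp
  ultimately have "((\<lambda>t. f (x + t *\<^sub>R ?g)) has_derivative (\<lambda>t. ?g \<bullet> (t *\<^sub>R ?g))) (at 0)"
    by (rule has_derivative_compose)
  then have "((\<lambda>t. f (x + t *\<^sub>R ?g)) has_real_derivative (?g \<bullet> ?g)) (at 0)"
    by (rule has_derivative_imp_has_field_derivative) (simp add: mult.commute)
  then have "((\<lambda>t. (f (x + t *\<^sub>R ?g) - f x) / t) \<longlongrightarrow> ?g \<bullet> ?g) (at 0)"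
    by (simp add: DERIV_def)
  then have "?g \<bullet> ?g \<le> L * norm ?g"
  proof (rule tendsto_upperbound)
    show "\<forall>\<^sub>F t in at 0. (f (x + t *\<^sub>R ?g) - f x) / t \<le> L * norm ?g"
    proof (rule eventually_at_filter[THEN iffD2], rule always_eventually, intro allI impI)
      fix t :: real assume "t \<noteq> 0"
      have "\<bar>f (x + t *\<^sub>R ?g) - f x\<bar> \<le> L * (\<bar>t\<bar> * norm ?g)"
        using lipschitz_onD[OF L, of "x + t *\<^sub>R ?g" x] by (simp add: dist_norm)
      then have "\<bar>(f (x + t *\<^sub>R ?g) - f x) / t\<bar> \<le> L * norm ?g"
        using \<open>t \<noteq> 0\<close> by (simp add: abs_divide divide_le_eq mult_ac)
      then show "(f (x + t *\<^sub>R ?g) - f x) / t \<le> L * norm ?g" by (simp only: abs_le_iff)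
    qed
  qed simp
  then have "norm ?g * norm ?g \<le> L * norm ?g"
    by (simp add: dot_square_norm power2_eq_square)
  then show ?thesis using False by simp
qed

lemma lborel_distr_reflect:
  "distr lborel borel (\<lambda>z. x - z) = (lborel :: 'a::euclidean_space measure)"
  using lborel_affine[of "-1" x] by (simp add: density_1)

text \<open>Cutting out the values of \<open>u\<close> between \<open>- \<delta>\<close> and
  \<open>\<delta>\<close> leaves an \<open>L\<close>-Lipschitz function supported in a compact
  subset of \<open>\<Omega>\<close>, and convolution with a probability density preserves
  \<open>L\<close>. Multiplying by a cutoff function would have spoiled the constant, on whose exact
  value the limit problem depends.\<close>

lemma lipschitz_test_function_approx:
  fixes u :: "'a::euclidean_space \<Rightarrow> real"
  assumes \<Omega>: "bounded \<Omega>" "open \<Omega>" and u: "L-lipschitz_on UNIV u" and zero: "\<And>x. x \<notin> \<Omega> \<Longrightarrow> u x = 0"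
    and e: "e > 0"
  obtains f where "f \<in> test_functions \<Omega>" "\<And>x. \<bar>f x - u x\<bar> \<le> e" "\<And>x. norm (gradient f x) \<le> L"
proof -
  have L: "L \<ge> 0" using u by (rule lipschitz_on_nonneg)
  define \<delta> where "\<delta> = e / 2"
  have \<delta>: "\<delta> > 0" using e by (simp add: \<delta>_def)
  define K where "K = {x. \<delta> \<le> \<bar>u x\<bar>}"
  have cu: "continuous_on UNIV u" using u by (rule lipschitz_on_continuous_on)
  have "K \<subseteq> \<Omega>" using zero \<delta> by (force simp: K_def)
  moreover have "closed K" unfolding K_def
    by (intro closed_Collect_le continuous_intros cu)
  ultimately have K: "compact K" "K \<subseteq> \<Omega>"
    using \<Omega>(1) by (auto simp: compact_eq_bounded_closed intro: bounded_subset)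
  define T where "T x = u x - max (- \<delta>) (min \<delta> (u x))" for x
  have T0: "T x = 0" if "x \<notin> K" for x using that by (auto simp: T_def K_def)
  have Tu: "\<bar>T x - u x\<bar> \<le> \<delta>" for x using \<delta> by (auto simp: T_def)
  have TL: "L-lipschitz_on UNIV T"
  proof (rule lipschitz_onI[OF _ L])
    fix x y :: 'a
    have "\<bar>T x - T y\<bar> \<le> \<bar>u x - u y\<bar>" by (auto simp: T_def max_def min_def)
    also have "\<dots> \<le> L * dist x y" using lipschitz_onD[OF u, of x y] by (simp add: dist_real_def)
    finally show "dist (T x) (T y) \<le> L * dist x y" by (simp add: dist_real_def)
  qed
  then have cT: "continuous_on UNIV T" by (rule lipschitz_on_continuous_on)
  obtain \<epsilon>' where \<epsilon>': "\<epsilon>' > 0" "(\<Union>x\<in>K. cball x \<epsilon>') \<subseteq> \<Omega>"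
    using compact_subset_open_imp_cball_epsilon_subset[OF K(1) \<Omega>(2) K(2)] by blast
  \<comment> \<open>The radius \<open>\<epsilon>'\<close> keeps the mollified support inside
    \<open>\<Omega>\<close>, the second entry makes the mollification error at most
    \<open>\<delta>\<close>; the \<open>+ 1\<close> covers \<open>L = 0\<close>.\<close>
  define \<epsilon> where "\<epsilon> = min \<epsilon>' (\<delta> / (L + 1))"
  have \<epsilon>: "\<epsilon> > 0" "\<epsilon> \<le> \<epsilon>'" using \<epsilon>' \<delta> L by (auto simp: \<epsilon>_def)
  have L\<epsilon>: "L * \<epsilon> \<le> \<delta>"
  proof -
    have "L * \<epsilon> \<le> L * (\<delta> / (L + 1))" using L by (intro mult_left_mono) (auto simp: \<epsilon>_def)
    also have "\<dots> = \<delta> * (L / (L + 1))" by simp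
    also have "\<dots> \<le> \<delta> * 1" using \<delta> L by (intro mult_left_mono) auto
    finally show ?thesis by simp
  qed
  obtain \<eta> :: "'a \<Rightarrow> real" where \<eta>: "smooth \<eta>" "\<And>z. 0 \<le> \<eta> z" "\<And>z. norm z \<ge> \<epsilon> \<Longrightarrow> \<eta> z = 0"
    "integrable lborel \<eta>" "(LINT z|lborel. \<eta> z) = 1"
    using smooth_bump[OF \<epsilon>(1)] by blast
  obtain a where a: "\<Omega> \<subseteq> cbox (- a) a" using bounded_subset_cbox_symmetric[OF \<Omega>(1)] by blast
  define f where "f x = integral (cbox (- a) a) (\<lambda>y. T y * \<eta> (x - y))" for x
  have sm: "smooth f" unfolding f_def [abs_def] by (rule smooth_convolution[OF cT \<eta>(1)])
  note cont [continuous_intros] =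
    continuous_on_compose2[OF smooth_continuous_on[OF \<eta>(1), of UNIV]] continuous_on_compose2[OF cT]
  have int: "integrable lborel (\<lambda>z. T (x - z) * \<eta> z)" for x
  proof (rule integrable_compact_support[of "cball 0 \<epsilon>"])
    show "continuous_on UNIV (\<lambda>z. T (x - z) * \<eta> z)" by (intro continuous_intros) auto
  qed (simp_all add: \<eta>(3))
  have f_eq: "f x = (LINT z|lborel. T (x - z) * \<eta> z)" for x
  proof -
    have "set_integrable lborel (cbox (- a) a) (\<lambda>y. T y * \<eta> (x - y))"
      unfolding set_integrable_def by (intro borel_integrable_compact continuous_intros compact_cbox) auto
    then have "f x = (LINT y|lborel. indicator (cbox (- a) a) y *\<^sub>R (T y * \<eta> (x - y)))"
      unfolding f_def by (simp add: set_borel_integral_eq_integral(2)[symmetric] set_lebesgue_integral_def)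
    also have "(\<lambda>y. indicator (cbox (- a) a) y *\<^sub>R (T y * \<eta> (x - y))) = (\<lambda>y. T y * \<eta> (x - y))"
      using T0 K a by (force simp: fun_eq_iff split: split_indicator)
    also have "(LINT y|lborel. T y * \<eta> (x - y)) = (LINT y|distr lborel borel (\<lambda>z. x - z). T y * \<eta> (x - y))"
      by (simp add: lborel_distr_reflect)
    also have "\<dots> = (LINT z|lborel. T (x - z) * \<eta> z)"
    proof (subst integral_distr)
      have "continuous_on UNIV (\<lambda>y. T y * \<eta> (x - y))" by (intro continuous_intros) auto
      then show "(\<lambda>y. T y * \<eta> (x - y)) \<in> borel_measurable borel"
        by (rule borel_measurable_continuous_onI)
    qed (auto simp: algebra_simps)
    finally show ?thesis .
  qed
  have fT: "\<bar>f x - T x\<bar> \<le> L * \<epsilon>" for x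
  proof -
    have "f x - T x = (LINT z|lborel. T (x - z) * \<eta> z - T x * \<eta> z)"
      using int \<eta>(4,5) by (simp add: f_eq)
    also have "\<bar>\<dots>\<bar> \<le> (LINT z|lborel. \<bar>T (x - z) * \<eta> z - T x * \<eta> z\<bar>)"
      by (rule integral_abs_bound)
    also have "\<dots> \<le> (LINT z|lborel. (L * \<epsilon>) * \<eta> z)"
    proof (rule integral_mono)
      fix z :: 'a
      show "\<bar>T (x - z) * \<eta> z - T x * \<eta> z\<bar> \<le> (L * \<epsilon>) * \<eta> z"
      proof (cases "norm z \<ge> \<epsilon>")
        case False
        have "\<bar>T (x - z) - T x\<bar> \<le> L * norm z"
          using lipschitz_onD[OF TL, of "x - z" x] by (simp add: dist_norm)
        also have "\<dots> \<le> L * \<epsilon>" using False L by (intro mult_left_mono) auto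
        finally have "\<bar>T (x - z) - T x\<bar> * \<eta> z \<le> (L * \<epsilon>) * \<eta> z"
          using \<eta>(2) by (intro mult_right_mono) auto
        then show ?thesis using \<eta>(2)[of z] by (simp add: left_diff_distrib[symmetric] abs_mult)
      qed (simp add: \<eta>(3))
    qed (use int \<eta>(4) in auto)
    finally show ?thesis using \<eta>(5) by simp
  qed
  have "L-lipschitz_on UNIV f"
  proof (rule lipschitz_onI[OF _ L])
    fix x y :: 'a
    have "f x - f y = (LINT z|lborel. T (x - z) * \<eta> z - T (y - z) * \<eta> z)"
      using int by (simp add: f_eq)
    also have "\<bar>\<dots>\<bar> \<le> (LINT z|lborel. \<bar>T (x - z) * \<eta> z - T (y - z) * \<eta> z\<bar>)"
      by (rule integral_abs_bound)
    also have "\<dots> \<le> (LINT z|lborel. (L * dist x y) * \<eta> z)"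
    proof (rule integral_mono)
      fix z :: 'a
      have "\<bar>T (x - z) - T (y - z)\<bar> \<le> L * dist x y"
        using lipschitz_onD[OF TL, of "x - z" "y - z"] by (simp add: dist_norm)
      then have "\<bar>T (x - z) - T (y - z)\<bar> * \<eta> z \<le> (L * dist x y) * \<eta> z"
        using \<eta>(2) by (intro mult_right_mono) auto
      then show "\<bar>T (x - z) * \<eta> z - T (y - z) * \<eta> z\<bar> \<le> (L * dist x y) * \<eta> z"
        using \<eta>(2)[of z] by (simp add: left_diff_distrib[symmetric] abs_mult)
    qed (use int \<eta>(4) in auto)
    finally show "dist (f x) (f y) \<le> L * dist x y" using \<eta>(5) by (simp add: dist_real_def)
  qed
  then have grad: "norm (gradient f x) \<le> L" for x
    by (rule norm_gradient_le_lipschitz[OF smooth_differentiable[OF sm]])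
  have "\<bar>f x - u x\<bar> \<le> e" for x
    using fT[of x] Tu[of x] L\<epsilon> unfolding \<delta>_def by linarith
  moreover have "f \<in> test_functions \<Omega>"
  proof -
    let ?C = "{x + y | x y. x \<in> K \<and> y \<in> cball 0 \<epsilon>}"
    have C: "compact ?C" by (intro compact_sums K compact_cball)
    have "?C \<subseteq> (\<Union>x\<in>K. cball x \<epsilon>')" using \<epsilon>(2) by (force simp: dist_norm)
    then have C\<Omega>: "?C \<subseteq> \<Omega>" using \<epsilon>' by blast
    have "f x = 0" if "x \<notin> ?C" for x
    proof -
      have "T (x - z) * \<eta> z = 0" for z
      proof (rule ccontr)
        assume "T (x - z) * \<eta> z \<noteq> 0"
        then have "x - z \<in> K" "norm z < \<epsilon>" using T0 \<eta>(3)[of z] by (auto simp: not_le[symmetric])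
        then have "x \<in> ?C" by (intro CollectI exI[of _ "x - z"] exI[of _ z]) auto
        then show False using that by blast
      qed
      then have "(\<lambda>z. T (x - z) * \<eta> z) = (\<lambda>z. 0)" by (rule ext)
      then show ?thesis unfolding f_eq by simp
    qed
    then have "closure {x. f x \<noteq> 0} \<subseteq> ?C"
      by (intro closure_minimal compact_imp_closed C) blast
    then show ?thesis using C\<Omega> C sm
      by (auto simp: test_functions_def smooth_def compact_eq_bounded_closed intro: bounded_subset)
  qed
  ultimately show ?thesis using that grad by blast
qed

section \<open>Lipschitz functions are Sobolev functions\<close>

lemma borel_imp_lebesgue_measurable: "f \<in> borel_measurable borel \<Longrightarrow> f \<in> borel_measurable lebesgue"
  by (simp add: measurable_completion)

lemma integral_lebesgue_on_eq_lborel: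
  fixes F :: "'a::euclidean_space \<Rightarrow> real"
  assumes "open \<Omega>" "F \<in> borel_measurable borel" "\<And>x. x \<notin> \<Omega> \<Longrightarrow> F x = 0"
  shows "(LINT x|lebesgue_on \<Omega>. F x) = (LINT x|lborel. F x)"
proof -
  have "(LINT x|lebesgue_on \<Omega>. F x) = (LINT x|lebesgue. indicator \<Omega> x *\<^sub>R F x)"
    using assms(1) by (intro integral_restrict_space) auto
  also have "(\<lambda>x. indicator \<Omega> x *\<^sub>R F x) = F"
    using assms(3) by (auto simp: fun_eq_iff split: split_indicator)
  also have "(LINT x|lebesgue. F x) = (LINT x|lborel. F x)"
    using assms(2) by (intro integral_completion) auto
  finally show ?thesis .
qed

lemma nn_integral_lebesgue_on_eq_lborel:
  fixes F :: "'a::euclidean_space \<Rightarrow> ennreal"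
  assumes "open \<Omega>" "\<And>x. x \<notin> \<Omega> \<Longrightarrow> F x = 0"
  shows "(\<integral>\<^sup>+x. F x \<partial>lebesgue_on \<Omega>) = (\<integral>\<^sup>+x. F x \<partial>lborel)"
proof -
  have "(\<integral>\<^sup>+x. F x \<partial>lebesgue_on \<Omega>) = (\<integral>\<^sup>+x. F x * indicator \<Omega> x \<partial>lebesgue)"
    using assms(1) by (intro nn_integral_restrict_space) auto
  also have "(\<lambda>x. F x * indicator \<Omega> x) = F"
    using assms(2) by (auto simp: fun_eq_iff split: split_indicator)
  finally show ?thesis by (simp add: nn_integral_completion)
qed

section \<open>Integration by parts for test functions\<close>

lemma lborel_distr_translate:
  "distr lborel borel (\<lambda>z. z + x) = (lborel :: 'a::euclidean_space measure)"
  using lborel_affine[of 1 x] by (simp add: density_1 add.commute)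

text \<open>By translation invariance every difference quotient of \<open>F\<close> has integral 0.
  The quotients are bounded through the Lipschitz constant and vanish outside one fixed ball, so
  dominated convergence carries this over to the directional derivative.\<close>

lemma integral_partial_zero:
  fixes F :: "'a::euclidean_space \<Rightarrow> real"
  assumes d: "\<And>x. (F has_derivative (\<lambda>h. G x \<bullet> h)) (at x)" and G: "continuous_on UNIV G"
    and K: "bounded K" "\<And>x. x \<notin> K \<Longrightarrow> F x = 0" "\<And>x. x \<notin> K \<Longrightarrow> G x = 0"
  shows "(LINT x|lborel. G x \<bullet> b) = 0"
proof -
  obtain \<rho> where \<rho>: "K \<subseteq> cball 0 \<rho>"
    using K(1) by (auto simp: bounded_iff subset_iff)
  have "bounded (G ` cball 0 \<rho>)"
    by (intro compact_imp_bounded compact_continuous_image continuous_on_subset[OF G]) auto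
  then obtain M0 where M0: "\<And>x. x \<in> cball 0 \<rho> \<Longrightarrow> norm (G x) \<le> M0" unfolding bounded_iff by blast
  define M where "M = max 0 M0"
  have M: "norm (G x) \<le> M" for x
    using M0[of x] K(3)[of x] \<rho> by (cases "x \<in> K") (auto simp: M_def)
  have cF: "continuous_on UNIV F"
    by (rule has_derivative_continuous_on) (use d in auto)
  have Fm [measurable]: "F \<in> borel_measurable borel" by (rule borel_measurable_continuous_onI[OF cF])
  have Gm [measurable]: "G \<in> borel_measurable borel" by (rule borel_measurable_continuous_onI[OF G])
  have lip: "\<bar>F x - F y\<bar> \<le> M * norm (x - y)" for x y
  proof -
    have "norm (F x - F y) \<le> M * norm (x - y)"
    proof (rule differentiable_bound[where S = UNIV and f' = "\<lambda>x h. G x \<bullet> h"])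
      show "onorm (\<lambda>h. G x \<bullet> h) \<le> M" for x
        by (rule order_trans[OF onorm_bound[of "norm (G x)"]])
           (auto simp: M Cauchy_Schwarz_ineq2)
    qed (use d in auto)
    then show ?thesis by simp
  qed
  define D where "D n x = real (Suc n) * (F (x + (1 / Suc n) *\<^sub>R b) - F x)" for n x
  have Fint: "integrable lborel F"
    by (rule integrable_compact_support[OF compact_cball cF]) (use K(2) \<rho> in blast)
  have tr: "integrable lborel (\<lambda>x. F (x + c)) \<and> (LINT x|lborel. F (x + c)) = (LINT x|lborel. F x)" for c
  proof -
    have "(LINT x|lborel. F x) = (LINT x|distr lborel borel (\<lambda>z. z + c). F x)"
      by (simp add: lborel_distr_translate)
    also have "\<dots> = (LINT x|lborel. F (x + c))" by (rule integral_distr) auto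
    moreover have "integrable (distr lborel borel (\<lambda>z. z + c)) F"
      by (simp add: lborel_distr_translate Fint)
    then have "integrable lborel (\<lambda>x. F (x + c))" by (subst (asm) integrable_distr_eq) auto
    ultimately show ?thesis by simp
  qed
  have D0: "(LINT x|lborel. D n x) = 0" for n
    using tr[of "(1 / Suc n) *\<^sub>R b"] Fint by (simp add: D_def)
  have "(\<lambda>n. LINT x|lborel. D n x) \<longlonglongrightarrow> (LINT x|lborel. G x \<bullet> b)"
  proof (rule integral_dominated_convergence)
    let ?w = "\<lambda>x. indicator (cball 0 (\<rho> + norm b)) x *\<^sub>R (M * norm b)"
    show "integrable lborel ?w" by (intro borel_integrable_compact) auto
    show "AE x in lborel. norm (D n x) \<le> ?w x" for n
    proof (rule always_eventually, rule allI)
      fix x :: 'a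
      show "norm (D n x) \<le> ?w x"
      proof (cases "x \<in> cball 0 (\<rho> + norm b)")
        case True
        have "\<bar>F (x + (1 / Suc n) *\<^sub>R b) - F x\<bar> \<le> M * (norm b / Suc n)"
          using lip[of "x + (1 / Suc n) *\<^sub>R b" x] by simp
        then have "real (Suc n) * \<bar>F (x + (1 / Suc n) *\<^sub>R b) - F x\<bar> \<le> real (Suc n) * (M * (norm b / Suc n))"
          by (intro mult_left_mono) auto
        also have "\<dots> = M * norm b" by (simp del: of_nat_Suc)
        finally show ?thesis using True by (simp add: D_def abs_mult del: of_nat_Suc)
      next
        case False
        define c where "c = (1 / Suc n) *\<^sub>R b"
        have "norm c = 1 / Suc n * norm b" by (simp add: c_def)
        also have "\<dots> \<le> 1 * norm b" by (intro mult_right_mono) auto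
        finally have c: "norm c \<le> norm b" by simp
        have F': "norm x > \<rho> + norm b" using False by simp
        have "norm x \<le> norm (x + c) + norm c" using norm_triangle_ineq4[of "x + c" c] by simp
        then have "\<not> norm x \<le> \<rho>" "\<not> norm (x + c) \<le> \<rho>"
          using F' c norm_ge_zero[of b] by linarith+
        then have "x \<notin> K" "x + c \<notin> K" using \<rho> by auto
        then have "F x = 0" "F (x + c) = 0" using K(2) by auto
        then show ?thesis using False by (simp add: D_def c_def)
      qed
    qed
    show "AE x in lborel. (\<lambda>n. D n x) \<longlonglongrightarrow> G x \<bullet> b"
    proof (rule always_eventually, rule allI)
      fix x :: 'a
      have "((\<lambda>t. x + t *\<^sub>R b) has_derivative (\<lambda>t. t *\<^sub>R b)) (at 0)"
        by (auto intro!: derivative_eq_intros)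
      moreover have "(F has_derivative (\<lambda>h. G x \<bullet> h)) (at (x + 0 *\<^sub>R b))"
        using d[of x] by simp
      ultimately have "((\<lambda>t. F (x + t *\<^sub>R b)) has_derivative (\<lambda>t. G x \<bullet> (t *\<^sub>R b))) (at 0)"
        by (rule has_derivative_compose)
      then have "((\<lambda>t. F (x + t *\<^sub>R b)) has_real_derivative (G x \<bullet> b)) (at 0)"
        by (rule has_derivative_imp_has_field_derivative) (simp add: mult.commute)
      then have lim: "((\<lambda>t. (F (x + t *\<^sub>R b) - F x) / t) \<longlongrightarrow> G x \<bullet> b) (at 0)"
        by (simp add: DERIV_def)
      have "filterlim (\<lambda>n. 1 / real (Suc n)) (at 0) sequentially"
        unfolding filterlim_at using LIMSEQ_Suc[OF lim_1_over_n] by (simp del: of_nat_Suc)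
      from filterlim_compose[OF lim this] show "(\<lambda>n. D n x) \<longlonglongrightarrow> G x \<bullet> b"
        by (simp add: D_def mult.commute)
    qed
  qed (auto simp: D_def)
  then show ?thesis by (simp add: D0 LIMSEQ_const_iff)
qed

lemma test_functions_integration_by_parts:
  fixes f \<phi> :: "'a::euclidean_space \<Rightarrow> real"
  assumes f: "f \<in> test_functions \<Omega>" and \<phi>: "\<phi> \<in> test_functions \<Omega>"
  shows "(LINT x|lborel. f x * (gradient \<phi> x \<bullet> b)) = - (LINT x|lborel. (gradient f x \<bullet> b) * \<phi> x)"
proof -
  note sm = test_function_smooth[OF f] test_function_smooth[OF \<phi>]
  note [continuous_intros] = sm[THEN smooth_continuous_on] sm[THEN smooth_gradient_continuous_on]
  define K where "K = closure {x. f x \<noteq> 0}"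
  have K: "compact K" using f by (simp add: test_functions_def K_def)
  have f0: "f x = 0" if "x \<notin> K" for x
    using that closure_subset[of "{x. f x \<noteq> 0}"] unfolding K_def by blast
  have g0: "gradient f x = 0" if "x \<notin> K" for x
    using that gradient_zero_outside[of x f] unfolding K_def by blast
  have "(LINT x|lborel. (f x *\<^sub>R gradient \<phi> x + \<phi> x *\<^sub>R gradient f x) \<bullet> b) = 0"
  proof (rule integral_partial_zero[where F = "\<lambda>x. f x * \<phi> x" and K = K])
    show "((\<lambda>x. f x * \<phi> x) has_derivative (\<lambda>h. (f x *\<^sub>R gradient \<phi> x + \<phi> x *\<^sub>R gradient f x) \<bullet> h)) (at x)" for x
      by (rule has_derivative_eq_rhs[OF has_derivative_mult[OF
            has_derivative_gradient[OF smooth_differentiable[OF sm(1)]]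
            has_derivative_gradient[OF smooth_differentiable[OF sm(2)]]]])
         (auto simp: inner_add_left)
    show "continuous_on UNIV (\<lambda>x. f x *\<^sub>R gradient \<phi> x + \<phi> x *\<^sub>R gradient f x)"
      by (intro continuous_intros)
  qed (use K f0 g0 in \<open>auto simp: compact_imp_bounded\<close>)
  moreover have "integrable lborel (\<lambda>x. f x * (gradient \<phi> x \<bullet> b))" "integrable lborel (\<lambda>x. (gradient f x \<bullet> b) * \<phi> x)"
    by (intro integrable_compact_support[OF K] continuous_intros; simp add: f0 g0)+
  ultimately show ?thesis
    by (simp add: inner_add_left mult.commute[of "\<phi> _"])
qed

text \<open>With weights \<open>4 ^ k\<close> the squared increments still have a summable sequence
  of integrals, of ratio \<open>1/2\<close>. Almost everywhere the weighted squares therefore tend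
  to 0, and the increments are eventually at most \<open>(1/2) ^ k\<close>.\<close>

lemma AE_convergent_of_square_integrals:
  fixes f :: "nat \<Rightarrow> 'a \<Rightarrow> 'b::euclidean_space"
  assumes [measurable]: "\<And>k. f k \<in> borel_measurable M"
    and bound: "\<And>k. (\<integral>\<^sup>+x. ennreal ((norm (f (Suc k) x - f k x))\<^sup>2) \<partial>M) \<le> ennreal ((1/8) ^ k)"
  shows "AE x in M. convergent (\<lambda>k. f k x)"
proof -
  let ?a = "\<lambda>k x. 4 ^ k * (norm (f (Suc k) x - f k x))\<^sup>2"
  have "(\<integral>\<^sup>+x. (\<Sum>k. ennreal (?a k x)) \<partial>M) = (\<Sum>k. \<integral>\<^sup>+x. ennreal (?a k x) \<partial>M)"
    by (rule nn_integral_suminf) measurable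
  also have "\<dots> \<le> (\<Sum>k. ennreal ((1/2) ^ k))"
  proof (rule suminf_le)
    fix k
    have "(\<integral>\<^sup>+x. ennreal (?a k x) \<partial>M) = ennreal (4 ^ k) * (\<integral>\<^sup>+x. ennreal ((norm (f (Suc k) x - f k x))\<^sup>2) \<partial>M)"
      by (simp add: ennreal_mult nn_integral_cmult)
    also have "\<dots> \<le> ennreal (4 ^ k) * ennreal ((1/8) ^ k)"
      by (intro mult_left_mono bound) auto
    also have "\<dots> = ennreal ((1/2) ^ k)"
      by (simp add: ennreal_mult[symmetric] power_mult_distrib[symmetric])
    finally show "(\<integral>\<^sup>+x. ennreal (?a k x) \<partial>M) \<le> ennreal ((1/2) ^ k)" .
  qed auto
  also have "\<dots> = ennreal (\<Sum>k. (1/2) ^ k)"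
    by (intro suminf_ennreal2 summable_geometric) auto
  also have "\<dots> < \<infinity>" by simp
  finally have "AE x in M. (\<Sum>k. ennreal (?a k x)) \<noteq> \<infinity>"
    by (intro nn_integral_noteq_infinite) (auto simp: less_top)
  then show ?thesis
  proof eventually_elim
    case (elim x)
    have "summable (\<lambda>k. ?a k x)"
      using elim by (intro summable_suminf_not_top) auto
    then have "(\<lambda>k. ?a k x) \<longlonglongrightarrow> 0" by (rule summable_LIMSEQ_zero)
    then have "\<forall>\<^sub>F k in sequentially. ?a k x < 1" by (rule order_tendstoD) simp
    then have "\<forall>\<^sub>F k in sequentially. norm (f (Suc k) x - f k x) \<le> (1/2) ^ k"
    proof eventually_elim
      case (elim k)
      have "(2 ^ k * norm (f (Suc k) x - f k x))\<^sup>2 \<le> 1\<^sup>2"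
        using elim by (simp add: power_mult_distrib power_even_eq[symmetric] power_mult[symmetric] mult.commute[of k 2] power_mult)
      then have "2 ^ k * norm (f (Suc k) x - f k x) \<le> 1"
        by (rule power2_le_imp_le) simp
      then show ?case by (simp add: field_simps)
    qed
    then have "summable (\<lambda>k. f (Suc k) x - f k x)"
      by (rule summable_comparison_test_ev) (simp add: summable_geometric)
    then have "convergent (\<lambda>n. \<Sum>k<n. f (Suc k) x - f k x)"
      by (simp add: summable_iff_convergent)
    then have "convergent (\<lambda>n. f n x - f 0 x)" by (simp only: sum_lessThan_telescope[of "\<lambda>k. f k x"])
    then have "convergent (\<lambda>n. (f n x - f 0 x) + f 0 x)"
      by (intro convergent_add convergent_const)
    then show ?case by simp
  qed
qed

lemma integrable_inner_gradients:
  assumes f: "f \<in> test_functions \<Omega>" and g: "g \<in> test_functions \<Omega>"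
  shows "integrable lborel (\<lambda>x. gradient f x \<bullet> gradient g x)"
proof -
  define K where "K = closure {x. f x \<noteq> 0}"
  have K: "compact K" using f by (simp add: test_functions_def K_def)
  have g0: "gradient f x = 0" if "x \<notin> K" for x
    using that gradient_zero_outside[of x f] unfolding K_def by blast
  have "continuous_on UNIV (\<lambda>x. gradient f x \<bullet> gradient g x)"
    by (intro continuous_intros smooth_gradient_continuous_on
        test_function_smooth[OF f] test_function_smooth[OF g])
  then show ?thesis by (rule integrable_compact_support[OF K]) (simp add: g0)
qed

text \<open>The near-minimizers of the Dirichlet energy among the smooth approximations at
  uniform distance \<open>1 / (m + 1)\<close> have gradients that are Cauchy in \<open>L\<^sup>2\<close>, by the parallelogram
  identity. This replaces the almost everywhere differentiability of Lipschitz functions.\<close>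

lemma lipschitz_approx_converging_gradients:
  fixes u :: "'a::euclidean_space \<Rightarrow> real"
  assumes \<Omega>: "bounded \<Omega>" "open \<Omega>" and u: "L-lipschitz_on UNIV u" and zero: "\<And>x. x \<notin> \<Omega> \<Longrightarrow> u x = 0"
  obtains h g where "\<And>k. h k \<in> test_functions \<Omega>" "\<And>k x. \<bar>h k x - u x\<bar> \<le> 1 / Suc k"
    "\<And>k x. norm (gradient (h k) x) \<le> L" "g \<in> borel_measurable borel"
    "AE x in lborel. (\<lambda>k. gradient (h k) x) \<longlonglongrightarrow> g x"
proof -
  have L: "L \<ge> 0" using u by (rule lipschitz_on_nonneg)
  \<comment> \<open>The classes \<open>C m\<close> are convex, since the gradient is linear, and
    shrink as \<open>m\<close> grows. Midpoints of functions from later classes hence still compete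
    in \<open>C m\<close>, and the infima \<open>d m\<close> increase to a finite limit.\<close>
  define C where "C m = {f \<in> test_functions \<Omega>. (\<forall>x. \<bar>f x - u x\<bar> \<le> 1 / real (Suc m)) \<and>
    (\<forall>x. norm (gradient f x) \<le> L)}" for m
  define E where "E f = (LINT x|lborel. gradient f x \<bullet> gradient f x)" for f :: "'a \<Rightarrow> real"
  have Cne: "E ` C m \<noteq> {}" for m
  proof -
    have "1 / real (Suc m) > 0" by simp
    from lipschitz_test_function_approx[OF \<Omega> u zero this] obtain f where
      "f \<in> test_functions \<Omega>" "\<And>x. \<bar>f x - u x\<bar> \<le> 1 / real (Suc m)" "\<And>x. norm (gradient f x) \<le> L"
      by metis
    then have "f \<in> C m" by (simp add: C_def)
    then show ?thesis by blast
  qed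
  have E0: "0 \<le> E f" for f unfolding E_def by (rule integral_nonneg_AE) simp
  have bdd: "bdd_below (E ` C m)" for m using E0 by (intro bdd_belowI2)
  have \<Omega>fin: "emeasure lborel \<Omega> < \<infinity>" using \<Omega>(1) by (rule emeasure_bounded_finite)
  have EC: "E f \<le> L\<^sup>2 * measure lborel \<Omega>" if "f \<in> C m" for f m
  proof -
    have f: "f \<in> test_functions \<Omega>" "\<And>x. norm (gradient f x) \<le> L" using that by (auto simp: C_def)
    have "E f \<le> (LINT x|lborel. indicator \<Omega> x * L\<^sup>2)"
      unfolding E_def
    proof (rule integral_mono[OF integrable_inner_gradients[OF f(1) f(1)]])
      show "integrable lborel (\<lambda>x. indicator \<Omega> x * L\<^sup>2)"
        using \<Omega>fin \<Omega>(2) by (intro integrable_mult_left integrable_real_indicator) auto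
      show "gradient f x \<bullet> gradient f x \<le> indicator \<Omega> x * L\<^sup>2" for x
        using f(2)[of x] test_function_gradient_zero[OF f(1), of x]
        by (cases "x \<in> \<Omega>") (simp_all add: dot_square_norm power_mono)
    qed
    also have "\<dots> = L\<^sup>2 * measure lborel \<Omega>" by simp
    finally show ?thesis .
  qed
  define d where "d m = Inf (E ` C m)" for m
  have mono: "C j \<subseteq> C m" if "m \<le> j" for m j
  proof -
    have "1 / real (Suc j) \<le> 1 / real (Suc m)" using that by (simp add: frac_le)
    then show ?thesis unfolding C_def by (auto intro: order_trans)
  qed
  have d_mono: "d m \<le> d j" if "m \<le> j" for m j
    unfolding d_def by (intro cInf_superset_mono Cne bdd image_mono mono that)
  have d_le: "d m \<le> E f" if "f \<in> C m" for f m
    unfolding d_def using that by (intro cInf_lower bdd) auto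
  have d_ub: "d m \<le> L\<^sup>2 * measure lborel \<Omega>" for m
    using Cne[of m] d_le EC by (metis equals0I image_empty order_trans)
  obtain D where D: "d \<longlonglongrightarrow> D" "\<And>m. d m \<le> D"
    using incseq_convergent[of d "L\<^sup>2 * measure lborel \<Omega>"] d_mono d_ub by (auto simp: incseq_def)
  have "\<exists>f\<in>C m. E f < d m + 1 / real (Suc m)" for m
    using cInf_lessD[OF Cne[of m], of "d m + 1 / real (Suc m)"] by (auto simp: d_def)
  then obtain h0 where h0: "\<And>m. h0 m \<in> C m" "\<And>m. E (h0 m) < d m + 1 / real (Suc m)" by metis
  have ht: "h0 m \<in> test_functions \<Omega>" for m using h0(1)[of m] by (simp add: C_def)
  \<comment> \<open>The parallelogram identity gives \<open>2 * E ?f + 2 * E ?g - 4 * E ?a\<close>.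
    Inserting the near-minimality of both functions, \<open>E ?a \<ge> d m\<close> for the midpoint,
    and \<open>d j \<le> D\<close> leaves this number, which depends on the smaller index
    only.\<close>
  define q where "q m = 2 * (D - d m) + 4 * (1 / real (Suc m))" for m
  have Q: "(\<integral>\<^sup>+x. ennreal ((norm (gradient (h0 j) x - gradient (h0 m) x))\<^sup>2) \<partial>lborel) \<le> ennreal (q m)"
    if "m \<le> j" for m j
  proof -
    let ?f = "h0 m" and ?g = "h0 j"
    let ?a = "\<lambda>x. (1/2) * ?f x + (1/2) * ?g x"
    note diff = smooth_differentiable[OF test_function_smooth[OF ht]]
    have "?a \<in> C m"
    proof -
      have g: "?g \<in> C m" using h0(1)[of j] mono[OF that] by blast
      have "\<bar>?a x - u x\<bar> \<le> 1 / real (Suc m)" for x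
      proof -
        have "\<bar>?f x - u x\<bar> \<le> 1 / real (Suc m)" "\<bar>?g x - u x\<bar> \<le> 1 / real (Suc m)"
          using g h0(1)[of m] by (auto simp: C_def)
        then show ?thesis by (simp only: abs_le_iff) (auto simp: algebra_simps)
      qed
      moreover have "norm (gradient ?a x) \<le> L" for x
      proof -
        have "norm (gradient ?f x) \<le> L" "norm (gradient ?g x) \<le> L"
          using g h0(1)[of m] by (auto simp: C_def)
        moreover have "norm (gradient ?a x) \<le> (1/2) * norm (gradient ?f x) + (1/2) * norm (gradient ?g x)"
          unfolding gradient_lincomb[OF diff diff] by (rule norm_triangle_le) simp
        ultimately show ?thesis by linarith
      qed
      ultimately show ?thesis
        unfolding C_def using test_functions_lincomb[OF ht ht] by blast
    qed
    then have low: "d m \<le> E ?a" by (rule d_le)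
    note int = integrable_inner_gradients[OF ht ht]
    define A where "A = (LINT x|lborel. gradient ?f x \<bullet> gradient ?g x)"
    have Ea: "E ?a = (1/4) * E ?f + (1/4) * E ?g + (1/2) * A"
    proof -
      have "E ?a = (LINT x|lborel. (1/4) * (gradient ?f x \<bullet> gradient ?f x) + (1/4) * (gradient ?g x \<bullet> gradient ?g x)
          + (1/2) * (gradient ?f x \<bullet> gradient ?g x))"
        unfolding E_def gradient_lincomb[OF diff diff]
        by (intro Bochner_Integration.integral_cong refl)
           (simp add: inner_add_left inner_add_right inner_commute[of "gradient ?g _" "gradient ?f _"] add_divide_distrib)
      then show ?thesis using int by (simp add: E_def A_def)
    qed
    let ?D = "\<lambda>x. (norm (gradient ?g x - gradient ?f x))\<^sup>2"
    have Deq: "?D x = gradient ?f x \<bullet> gradient ?f x + gradient ?g x \<bullet> gradient ?g x - 2 * (gradient ?f x \<bullet> gradient ?g x)" for x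
      by (simp add: power2_norm_eq_inner inner_diff_left inner_diff_right inner_commute[of "gradient ?g _" "gradient ?f _"])
    have Dint: "integrable lborel ?D" unfolding Deq using int by simp
    have "(LINT x|lborel. ?D x) = E ?f + E ?g - 2 * A"
      unfolding Deq using int by (simp add: E_def A_def)
    also have "\<dots> = 2 * E ?f + 2 * E ?g - 4 * E ?a" unfolding Ea by simp
    also have "\<dots> \<le> q m"
    proof -
      have "1 / real (Suc j) \<le> 1 / real (Suc m)" using that by (simp add: frac_le)
      moreover have "2 * x + 2 * y - 4 * z \<le> 2 * (D - d m) + 4 * a"
        if "b \<le> a" "d m \<le> z" "x < d m + a" "y < d j + b" "d j \<le> D" for x y z a b
        using that by argo
      ultimately show ?thesis
        unfolding q_def using low h0(2)[of m] h0(2)[of j] D(2)[of j] by blast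
    qed
    finally have "(LINT x|lborel. ?D x) \<le> q m" .
    then show ?thesis using Dint by (simp add: nn_integral_eq_integral ennreal_leI)
  qed
  have "q \<longlonglongrightarrow> 2 * (D - D) + 4 * 0"
    unfolding q_def by (intro tendsto_intros D LIMSEQ_Suc[OF lim_1_over_n])
  then have "\<forall>\<^sub>F m in sequentially. q m < (1/8) ^ k" for k
    by (intro order_tendstoD(2)[of q 0]) auto
  then have "\<exists>N. \<forall>m\<ge>N. q m < (1/8) ^ k" for k by (simp add: eventually_sequentially)
  then obtain N where N: "\<And>k m. m \<ge> N k \<Longrightarrow> q m < (1/8) ^ k" by metis
  \<comment> \<open>Summing all \<open>N i\<close> up to \<open>k\<close> makes the index monotone
    while keeping it above both \<open>k\<close> and \<open>N k\<close>.\<close>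
  define \<tau> where "\<tau> k = k + (\<Sum>i\<le>k. N i)" for k
  have \<tau>: "N k \<le> \<tau> k" "k \<le> \<tau> k" "\<tau> k \<le> \<tau> (Suc k)" for k
    by (auto simp: \<tau>_def intro: trans_le_add2 member_le_sum)
  define h where "h k = h0 (\<tau> k)" for k
  have hC: "h k \<in> C k" for k
    unfolding h_def using h0(1)[of "\<tau> k"] mono[OF \<tau>(2)[of k]] by blast
  have ht': "h k \<in> test_functions \<Omega>" for k by (simp add: h_def ht)
  have meas: "gradient (h k) \<in> borel_measurable borel" for k
    by (intro borel_measurable_continuous_onI smooth_gradient_continuous_on test_function_smooth[OF ht'])
  have "AE x in lborel. convergent (\<lambda>k. gradient (h k) x)"
  proof (rule AE_convergent_of_square_integrals)
    show "gradient (h k) \<in> borel_measurable lborel" for k using meas by simp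
    fix k
    have "(\<integral>\<^sup>+x. ennreal ((norm (gradient (h (Suc k)) x - gradient (h k) x))\<^sup>2) \<partial>lborel) \<le> ennreal (q (\<tau> k))"
      unfolding h_def by (rule Q[OF \<tau>(3)])
    also have "\<dots> \<le> ennreal ((1/8) ^ k)" using N[OF \<tau>(1), of k] by (intro ennreal_leI) simp
    finally show "(\<integral>\<^sup>+x. ennreal ((norm (gradient (h (Suc k)) x - gradient (h k) x))\<^sup>2) \<partial>lborel) \<le> ennreal ((1/8) ^ k)" .
  qed
  then have "AE x in lborel. (\<lambda>k. gradient (h k) x) \<longlonglongrightarrow> lim (\<lambda>k. gradient (h k) x)"
    by eventually_elim (simp add: convergent_LIMSEQ_iff)
  moreover have "(\<lambda>x. lim (\<lambda>k. gradient (h k) x)) \<in> borel_measurable borel"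
    using meas by (rule borel_measurable_lim_metric)
  ultimately show ?thesis
    using that[of h "\<lambda>x. lim (\<lambda>k. gradient (h k) x)"] ht' hC unfolding C_def by blast
qed

section \<open>Weak gradients and Sobolev membership of Lipschitz functions\<close>

lemma lebesgue_on_measurable_if_borel:
  "f \<in> borel_measurable borel \<Longrightarrow> f \<in> borel_measurable (lebesgue_on S)"
  by (intro measurable_restrict_space1 borel_imp_lebesgue_measurable)

lemma AE_lborel_imp_lebesgue_on:
  assumes "AE x in lborel. P x" "S \<in> sets lebesgue"
  shows "AE x in lebesgue_on S. P x"
proof -
  have "AE x in lebesgue. P x" using assms(1) by (rule AE_completion)
  then have "AE x in lebesgue. x \<in> S \<longrightarrow> P x" by eventually_elim simp
  then show ?thesis using assms(2) by (subst AE_restrict_space_iff) auto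
qed

lemma emeasure_lebesgue_on_bounded:
  assumes "bounded S" "S \<in> sets lebesgue"
  shows "emeasure (lebesgue_on S) (space (lebesgue_on S)) < \<infinity>"
proof -
  have "emeasure (lebesgue_on S) (space (lebesgue_on S)) = emeasure lebesgue S"
    using assms by (subst emeasure_restrict_space) auto
  then show ?thesis
    using fmeasurableD2[OF bounded_set_imp_lmeasurable[OF assms]] by (simp only: less_top infinity_ennreal_def)
qed

lemma nn_integral_lebesgue_on_const_le:
  assumes "AE x in lebesgue_on S. f x \<le> c"
  shows "(\<integral>\<^sup>+x. f x \<partial>lebesgue_on S) \<le> c * emeasure (lebesgue_on S) S"
proof -
  have "(\<integral>\<^sup>+x. f x \<partial>lebesgue_on S) \<le> (\<integral>\<^sup>+x. c \<partial>lebesgue_on S)"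
    by (rule nn_integral_mono_AE) (rule assms)
  then show ?thesis by simp
qed

lemma integrable_lebesgue_on_bounded:
  fixes f :: "'a::euclidean_space \<Rightarrow> 'b::euclidean_space"
  assumes "bounded S" "S \<in> sets lebesgue" "f \<in> borel_measurable (lebesgue_on S)"
    and "AE x in lebesgue_on S. norm (f x) \<le> B"
  shows "integrable (lebesgue_on S) f"
  using emeasure_lebesgue_on_bounded[OF assms(1,2)] assms(3,4)
  by (intro integrableI_bounded_set[where A = "space (lebesgue_on S)" and B = B]) auto

lemma locally_integrable_bounded:
  fixes f :: "'a::euclidean_space \<Rightarrow> 'b::euclidean_space"
  assumes f: "f \<in> borel_measurable borel" and b: "AE x in lborel. norm (f x) \<le> B"
  shows "locally_integrable \<Omega> f"
  unfolding locally_integrable_def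
proof (intro conjI allI impI)
  show "f \<in> borel_measurable (lebesgue_on \<Omega>)" by (rule lebesgue_on_measurable_if_borel[OF f])
  fix K assume "compact K \<and> K \<subseteq> \<Omega>"
  then have K: "bounded K" "K \<in> sets lebesgue" by (auto intro: compact_imp_bounded fmeasurableD lmeasurable_compact)
  show "integrable (lebesgue_on K) f"
    by (rule integrable_lebesgue_on_bounded[OF K lebesgue_on_measurable_if_borel[OF f]
          AE_lborel_imp_lebesgue_on[OF b K(2)]])
qed

text \<open>The approximations satisfy integration by parts exactly. Their values and gradients are
  bounded uniformly and converge almost everywhere, so dominated convergence carries both sides to
  the limit and makes the pointwise limit of the gradients a weak gradient.\<close>

lemma lipschitz_weak_gradient:
  fixes u :: "'a::euclidean_space \<Rightarrow> real"
  assumes \<Omega>: "bounded \<Omega>" "open \<Omega>" and u: "L-lipschitz_on UNIV u" and zero: "\<And>x. x \<notin> \<Omega> \<Longrightarrow> u x = 0"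
  obtains h g where "\<And>k. h k \<in> test_functions \<Omega>" "\<And>k x. \<bar>h k x - u x\<bar> \<le> 1 / Suc k"
    "\<And>k x. norm (gradient (h k) x) \<le> L" "g \<in> borel_measurable borel"
    "AE x in lborel. (\<lambda>k. gradient (h k) x) \<longlonglongrightarrow> g x" "AE x in lborel. norm (g x) \<le> L"
    "has_weak_gradient \<Omega> u g"
proof -
  obtain h g where h: "\<And>k. h k \<in> test_functions \<Omega>" "\<And>k x. \<bar>h k x - u x\<bar> \<le> 1 / Suc k"
    "\<And>k x. norm (gradient (h k) x) \<le> L" and g: "g \<in> borel_measurable borel"
    and lim: "AE x in lborel. (\<lambda>k. gradient (h k) x) \<longlonglongrightarrow> g x"
    by (rule lipschitz_approx_converging_gradients[OF \<Omega> u zero], assumption) (rule that; simp)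
  have gL: "AE x in lborel. norm (g x) \<le> L"
    using lim
  proof eventually_elim
    case (elim x)
    show ?case by (rule tendsto_upperbound[OF tendsto_norm[OF elim]]) (use h(3) in auto)
  qed
  have cu: "continuous_on UNIV u" using u by (rule lipschitz_on_continuous_on)
  have um: "u \<in> borel_measurable borel" by (rule borel_measurable_continuous_onI[OF cu])
  obtain B where B: "\<And>x. \<bar>u x\<bar> \<le> B"
  proof -
    obtain B0 where B0: "\<And>x. \<bar>h 0 x\<bar> \<le> B0" using test_function_bounded[OF h(1)] by metis
    have "\<bar>u x\<bar> \<le> B0 + 1" for x using h(2)[of 0 x] B0[of x] by simp
    then show ?thesis by (rule that)
  qed
  have hlim: "(\<lambda>k. h k x) \<longlonglongrightarrow> u x" for x
    by (rule Lim_transform_bound[where g = "\<lambda>k. 1 / real (Suc k)" and f = "\<lambda>k. h k x - u x", THEN LIM_zero_cancel])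
       (use h(2) LIMSEQ_Suc[OF lim_1_over_n] in auto)
  have "has_weak_gradient \<Omega> u g"
    unfolding has_weak_gradient_def
  proof (intro conjI ballI)
    show "locally_integrable \<Omega> u" using B by (intro locally_integrable_bounded[OF um, of B]) auto
    show "locally_integrable \<Omega> g" by (rule locally_integrable_bounded[OF g gL])
    fix \<phi> :: "'a \<Rightarrow> real" and b :: 'a assume \<phi>: "\<phi> \<in> test_functions \<Omega>" and b: "b \<in> Basis"
    note sm = test_function_smooth[OF \<phi>]
    have gi: "frechet_derivative \<phi> (at x) b = gradient \<phi> x \<bullet> b" for x
      by (simp add: gradient_inner smooth_differentiable[OF sm])
    have \<phi>m: "\<phi> \<in> borel_measurable borel" "gradient \<phi> \<in> borel_measurable borel"
      by (intro borel_measurable_continuous_onI smooth_continuous_on smooth_gradient_continuous_on sm)+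
    have hm: "h k \<in> borel_measurable borel" "gradient (h k) \<in> borel_measurable borel" for k
      by (intro borel_measurable_continuous_onI smooth_continuous_on smooth_gradient_continuous_on
          test_function_smooth[OF h(1)])+
    have \<Omega>fin: "emeasure lborel \<Omega> < \<infinity>" using \<Omega>(1) by (rule emeasure_bounded_finite)
    obtain M where M: "\<And>x. \<bar>\<phi> x\<bar> \<le> M" "\<And>x. norm (gradient \<phi> x) \<le> M"
      using test_function_bounded[OF \<phi>] by metis
    have M0: "M \<ge> 0" using M(1)[of 0] by linarith
    have out: "\<phi> x = 0" "gradient \<phi> x = 0" if "x \<notin> \<Omega>" for x
      using test_function_zero[OF \<phi> that] test_function_gradient_zero[OF \<phi> that] by auto
    have wint: "integrable lborel (\<lambda>x. indicator \<Omega> x * c)" for c :: real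
      using \<Omega>fin \<Omega>(2) by (intro integrable_mult_left integrable_real_indicator) auto
    have 1: "(\<lambda>k. LINT x|lborel. h k x * (gradient \<phi> x \<bullet> b)) \<longlonglongrightarrow> (LINT x|lborel. u x * (gradient \<phi> x \<bullet> b))"
    proof (rule integral_dominated_convergence)
      show "integrable lborel (\<lambda>x. indicator \<Omega> x * ((B + 1) * M))" by (rule wint)
      show "AE x in lborel. (\<lambda>k. h k x * (gradient \<phi> x \<bullet> b)) \<longlonglongrightarrow> u x * (gradient \<phi> x \<bullet> b)"
        by (intro always_eventually allI tendsto_intros hlim)
      show "AE x in lborel. norm (h k x * (gradient \<phi> x \<bullet> b)) \<le> indicator \<Omega> x * ((B + 1) * M)" for k
      proof (rule always_eventually, rule allI)
        fix x
        have "1 / real (Suc k) \<le> 1" by simp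
        then have 1: "\<bar>h k x\<bar> \<le> B + 1" using h(2)[of k x] B[of x] by linarith
        have "\<bar>gradient \<phi> x \<bullet> b\<bar> \<le> norm (gradient \<phi> x)" using Basis_le_norm[OF b] by simp
        then have 2: "\<bar>gradient \<phi> x \<bullet> b\<bar> \<le> M" using M(2)[of x] by linarith
        have "\<bar>h k x\<bar> * \<bar>gradient \<phi> x \<bullet> b\<bar> \<le> (B + 1) * M"
          using 1 2 by (intro mult_mono) auto
        then show "norm (h k x * (gradient \<phi> x \<bullet> b)) \<le> indicator \<Omega> x * ((B + 1) * M)"
          using out[of x] by (cases "x \<in> \<Omega>") (simp_all add: abs_mult)
      qed
    qed (use hm \<phi>m um in simp_all)
    have 2: "(\<lambda>k. LINT x|lborel. (gradient (h k) x \<bullet> b) * \<phi> x) \<longlonglongrightarrow> (LINT x|lborel. (g x \<bullet> b) * \<phi> x)"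
    proof (rule integral_dominated_convergence)
      show "integrable lborel (\<lambda>x. indicator \<Omega> x * (L * M))" by (rule wint)
      show "AE x in lborel. (\<lambda>k. (gradient (h k) x \<bullet> b) * \<phi> x) \<longlonglongrightarrow> (g x \<bullet> b) * \<phi> x"
        using lim by eventually_elim (intro tendsto_intros)
      show "AE x in lborel. norm ((gradient (h k) x \<bullet> b) * \<phi> x) \<le> indicator \<Omega> x * (L * M)" for k
      proof (rule always_eventually, rule allI)
        fix x
        have "\<bar>gradient (h k) x \<bullet> b\<bar> \<le> norm (gradient (h k) x)" using Basis_le_norm[OF b] by simp
        then have "\<bar>gradient (h k) x \<bullet> b\<bar> \<le> L" using h(3)[of k x] by linarith
        then have "\<bar>gradient (h k) x \<bullet> b\<bar> * \<bar>\<phi> x\<bar> \<le> L * M"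
          using M(1)[of x] by (intro mult_mono) auto
        then show "norm ((gradient (h k) x \<bullet> b) * \<phi> x) \<le> indicator \<Omega> x * (L * M)"
          using out[of x] by (cases "x \<in> \<Omega>") (simp_all add: abs_mult)
      qed
    qed (use hm \<phi>m g in simp_all)
    have "(LINT x|lborel. u x * (gradient \<phi> x \<bullet> b)) = - (LINT x|lborel. (g x \<bullet> b) * \<phi> x)"
      by (rule LIMSEQ_unique[OF 1]) (use tendsto_minus[OF 2] in
          \<open>simp add: test_functions_integration_by_parts[OF h(1) \<phi>]\<close>)
    then show "(LINT x|lebesgue_on \<Omega>. u x * frechet_derivative \<phi> (at x) b)
        = - (LINT x|lebesgue_on \<Omega>. (g x \<bullet> b) * \<phi> x)"
      unfolding gi using um g \<phi>m out
      by (subst (1 2) integral_lebesgue_on_eq_lborel[OF \<Omega>(2)]) simp_all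
  qed
  then show ?thesis using that[OF h(1,2,3) g lim gL] by blast
qed

lemma Linf_norm_le:
  assumes "f \<in> borel_measurable (lebesgue_on \<Omega>)" "AE x in lebesgue_on \<Omega>. norm (f x) \<le> c"
  shows "Linf_norm \<Omega> f \<le> ennreal c"
  unfolding Linf_norm_def using assms
  by (intro esssup_I) (auto elim!: eventually_mono intro: ennreal_leI)

lemma AE_norm_le_of_Linf_norm:
  assumes "Linf_norm \<Omega> f \<le> ennreal c" "c \<ge> 0"
  shows "AE x in lebesgue_on \<Omega>. norm (f x) \<le> c"
  using esssup_AE[of "\<lambda>x. ennreal (norm (f x))" "lebesgue_on \<Omega>"]
proof eventually_elim
  case (elim x)
  then have "ennreal (norm (f x)) \<le> ennreal c"
    using assms(1) unfolding Linf_norm_def by (rule order_trans)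
  then show ?case using assms(2) by simp
qed

lemma Lp_pow_le_of_AE_bound:
  assumes "AE x in lebesgue_on \<Omega>. norm (f x) \<le> c" "p \<ge> 0"
  shows "Lp_pow \<Omega> p f \<le> ennreal (c powr p) * emeasure (lebesgue_on \<Omega>) \<Omega>"
  unfolding Lp_pow_def
  by (rule nn_integral_lebesgue_on_const_le)
     (use assms in \<open>auto elim!: eventually_mono intro!: ennreal_leI powr_mono2\<close>)

text \<open>One approximating sequence serves all exponents: values converge uniformly, gradients
  converge almost everywhere and stay bounded by \<open>L\<close>, and \<open>\<Omega>\<close> has
  finite measure. Dominated convergence then gives convergence of both in every
  \<open>L\<^sup>q\<close>.\<close>

lemma lipschitz_imp_W01inf:
  fixes u :: "'a::euclidean_space \<Rightarrow> real"
  assumes \<Omega>: "bounded \<Omega>" "open \<Omega>" and u: "L-lipschitz_on UNIV u" and zero: "\<And>x. x \<notin> \<Omega> \<Longrightarrow> u x = 0"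
  shows "u \<in> W01inf \<Omega>" and "AE x in lebesgue_on \<Omega>. norm (weak_gradient \<Omega> u x) \<le> L"
    and "weak_gradient \<Omega> u \<in> borel_measurable (lebesgue_on \<Omega>)"
    and "q \<ge> 1 \<Longrightarrow> u \<in> W01p \<Omega> q"
proof -
  obtain h g where h: "\<And>k. h k \<in> test_functions \<Omega>" "\<And>k x. \<bar>h k x - u x\<bar> \<le> 1 / Suc k"
    "\<And>k x. norm (gradient (h k) x) \<le> L" and g: "g \<in> borel_measurable borel"
    and lim: "AE x in lborel. (\<lambda>k. gradient (h k) x) \<longlonglongrightarrow> g x" and gL: "AE x in lborel. norm (g x) \<le> L"
    and wg: "has_weak_gradient \<Omega> u g"
    by (rule lipschitz_weak_gradient[OF \<Omega> u zero], assumption) (rule that; simp)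
  have \<Omega>s: "\<Omega> \<in> sets lebesgue" using \<Omega>(2) by simp
  note lim' = AE_lborel_imp_lebesgue_on[OF lim \<Omega>s] and gL' = AE_lborel_imp_lebesgue_on[OF gL \<Omega>s]
  note gm = lebesgue_on_measurable_if_borel[OF g, of \<Omega>]
  have L: "L \<ge> 0" using u by (rule lipschitz_on_nonneg)
  have \<Omega>fin: "emeasure (lebesgue_on \<Omega>) \<Omega> < \<infinity>" using emeasure_lebesgue_on_bounded[OF \<Omega>(1) \<Omega>s] by simp
  have eq: "AE x in lebesgue_on \<Omega>. weak_gradient \<Omega> u x = g x" by (rule AE_weak_gradient_eq[OF \<Omega>(2) wg])
  have "AE x in lebesgue_on \<Omega>. norm (weak_gradient \<Omega> u x) \<le> L"
    using eq gL' by eventually_elim simp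
  then show "AE x in lebesgue_on \<Omega>. norm (weak_gradient \<Omega> u x) \<le> L" .
  show wm: "weak_gradient \<Omega> u \<in> borel_measurable (lebesgue_on \<Omega>)"
    using has_weak_gradient_weak_gradient[OF wg] by (simp add: has_weak_gradient_def locally_integrable_def)
  have cu: "continuous_on UNIV u" using u by (rule lipschitz_on_continuous_on)
  have um: "u \<in> borel_measurable (lebesgue_on \<Omega>)"
    by (rule lebesgue_on_measurable_if_borel[OF borel_measurable_continuous_onI[OF cu]])
  obtain B where B: "\<And>x. norm (u x) \<le> B"
  proof -
    obtain B0 where B0: "\<And>x. \<bar>h 0 x\<bar> \<le> B0" using test_function_bounded[OF h(1)] by metis
    have "norm (u x) \<le> B0 + 1" for x using h(2)[of 0 x] B0[of x] by simp
    then show ?thesis by (rule that)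
  qed
  have hm: "h k \<in> borel_measurable (lebesgue_on \<Omega>)" "gradient (h k) \<in> borel_measurable (lebesgue_on \<Omega>)" for k
    by (intro lebesgue_on_measurable_if_borel borel_measurable_continuous_onI smooth_continuous_on
        smooth_gradient_continuous_on test_function_smooth[OF h(1)])+
  have Lp: "u \<in> Lp_space \<Omega> q" "g \<in> Lp_space \<Omega> q" if "q \<ge> 1" for q
  proof -
    have "Lp_pow \<Omega> q u \<le> ennreal (B powr q) * emeasure (lebesgue_on \<Omega>) \<Omega>"
      using B that by (intro Lp_pow_le_of_AE_bound) auto
    also have "\<dots> < \<infinity>" using \<Omega>fin by (simp add: ennreal_mult_less_top)
    finally show "u \<in> Lp_space \<Omega> q" using um by (simp add: Lp_space_def)
    have "Lp_pow \<Omega> q g \<le> ennreal (L powr q) * emeasure (lebesgue_on \<Omega>) \<Omega>"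
      using gL' that by (intro Lp_pow_le_of_AE_bound) auto
    also have "\<dots> < \<infinity>" using \<Omega>fin by (simp add: ennreal_mult_less_top)
    finally show "g \<in> Lp_space \<Omega> q" using gm by (simp add: Lp_space_def)
  qed
  show W: "u \<in> W01p \<Omega> q" if q: "q \<ge> 1" for q
    unfolding W01p_def
  proof (intro CollectI conjI exI[of _ h] allI h(1))
    show "u \<in> W1p \<Omega> q" using Lp[OF q] wg by (auto simp: W1p_def)
    show "(\<lambda>k. Lp_pow \<Omega> q (\<lambda>x. u x - h k x)) \<longlonglongrightarrow> 0"
    proof -
      have "(\<lambda>k. \<integral>\<^sup>+x. ennreal (norm (u x - h k x) powr q) \<partial>lebesgue_on \<Omega>)
          \<longlonglongrightarrow> (\<integral>\<^sup>+x. 0 \<partial>lebesgue_on \<Omega>)"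
      proof (rule nn_integral_dominated_convergence[where w = "\<lambda>_. 1"])
        show "AE x in lebesgue_on \<Omega>. ennreal (norm (u x - h k x) powr q) \<le> 1" for k
        proof (rule always_eventually, rule allI)
          fix x
          have "1 / real (Suc k) \<le> 1" by simp
          then have "\<bar>u x - h k x\<bar> \<le> 1" using h(2)[of k x] by linarith
          then have "norm (u x - h k x) powr q \<le> 1 powr q" using q by (intro powr_mono2) auto
          then show "ennreal (norm (u x - h k x) powr q) \<le> 1" by simp
        qed
        show "AE x in lebesgue_on \<Omega>. (\<lambda>k. ennreal (norm (u x - h k x) powr q)) \<longlonglongrightarrow> 0"
        proof (rule always_eventually, rule allI)
          fix x
          have "(\<lambda>k. norm (u x - h k x)) \<longlonglongrightarrow> 0"
            by (rule Lim_null_comparison[OF _ LIMSEQ_Suc[OF lim_1_over_n]])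
               (use h(2) in \<open>auto simp: abs_minus_commute\<close>)
          then have "(\<lambda>k. norm (u x - h k x) powr q) \<longlonglongrightarrow> 0 powr q"
            using q by (intro tendsto_powr') (auto intro: tendsto_const)
          then have "(\<lambda>k. ennreal (norm (u x - h k x) powr q)) \<longlonglongrightarrow> ennreal (0 powr q)"
            by (rule tendsto_ennrealI)
          then show "(\<lambda>k. ennreal (norm (u x - h k x) powr q)) \<longlonglongrightarrow> 0" by simp
        qed
      qed (use um hm \<Omega>fin in simp_all)
      then show ?thesis by (simp add: Lp_pow_def)
    qed
    show "(\<lambda>k. Lp_pow \<Omega> q (\<lambda>x. weak_gradient \<Omega> u x - gradient (h k) x)) \<longlonglongrightarrow> 0"
    proof -
      have "(\<lambda>k. \<integral>\<^sup>+x. ennreal (norm (weak_gradient \<Omega> u x - gradient (h k) x) powr q) \<partial>lebesgue_on \<Omega>)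
          \<longlonglongrightarrow> (\<integral>\<^sup>+x. 0 \<partial>lebesgue_on \<Omega>)"
      proof (rule nn_integral_dominated_convergence[where w = "\<lambda>_. ennreal ((2 * L) powr q)"])
        show "AE x in lebesgue_on \<Omega>. ennreal (norm (weak_gradient \<Omega> u x - gradient (h k) x) powr q) \<le> ennreal ((2 * L) powr q)" for k
          using eq gL'
        proof eventually_elim
          case (elim x)
          have "norm (g x - gradient (h k) x) \<le> 2 * L"
            using norm_triangle_ineq4[of "g x" "gradient (h k) x"] elim h(3)[of k x] by linarith
          then show ?case using elim q by (auto intro!: ennreal_leI powr_mono2)
        qed
        show "AE x in lebesgue_on \<Omega>. (\<lambda>k. ennreal (norm (weak_gradient \<Omega> u x - gradient (h k) x) powr q)) \<longlonglongrightarrow> 0"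
          using eq lim'
        proof eventually_elim
          case (elim x)
          have "(\<lambda>k. norm (g x - gradient (h k) x)) \<longlonglongrightarrow> norm (g x - g x)"
            by (intro tendsto_intros elim)
          then have "(\<lambda>k. norm (g x - gradient (h k) x) powr q) \<longlonglongrightarrow> 0 powr q"
            using q by (intro tendsto_powr') (auto intro: tendsto_const)
          then have "(\<lambda>k. ennreal (norm (g x - gradient (h k) x) powr q)) \<longlonglongrightarrow> ennreal (0 powr q)"
            by (rule tendsto_ennrealI)
          then show ?case using elim by simp
        qed
        show "(\<integral>\<^sup>+x. ennreal ((2 * L) powr q) \<partial>lebesgue_on \<Omega>) < \<infinity>"
          using \<Omega>fin by (simp add: ennreal_mult_less_top)
      qed (use wm hm in simp_all)
      then show ?thesis by (simp add: Lp_pow_def)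
    qed
  qed
  have "Linf_norm \<Omega> u \<le> ennreal B" using B by (intro Linf_norm_le um) auto
  then have "u \<in> Linf_space \<Omega>" using um by (auto simp: Linf_space_def intro: le_less_trans)
  moreover have "Linf_norm \<Omega> g \<le> ennreal L" by (intro Linf_norm_le gm gL')
  then have "g \<in> Linf_space \<Omega>" using gm by (auto simp: Linf_space_def intro: le_less_trans)
  ultimately have "u \<in> W1inf \<Omega>" using wg by (auto simp: W1inf_def)
  then show "u \<in> W01inf \<Omega>"
    using W continuous_on_subset[OF cu] by (auto simp: W01inf_def)
qed

section \<open>Morrey's inequality\<close>

text \<open>Below \<open>M\<close> the first term suffices. Above it, write
  \<open>t = t powr (1 - p) * t powr p\<close> and use that the exponent \<open>1 - p\<close> is not
  positive.\<close>

lemma le_threshold_powr: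
  fixes t M p :: real
  assumes "t \<ge> 0" "M > 0" "p \<ge> 1"
  shows "t \<le> M + M powr (1 - p) * t powr p"
proof (cases "t \<le> M")
  case True
  have "0 \<le> M powr (1 - p) * t powr p" by simp
  then show ?thesis using True by linarith
next
  case False
  then have t: "t > 0" using assms by linarith
  have "t = t powr (1 - p) * t powr p" using t by (simp add: powr_add[symmetric])
  also have "\<dots> \<le> M powr (1 - p) * t powr p"
    using False assms by (intro mult_right_mono powr_mono2') auto
  finally show ?thesis using assms(2) by linarith
qed

lemma segment_estimate:
  assumes f: "smooth f"
  shows "ennreal \<bar>f (x + z) - f x\<bar>
    \<le> (\<integral>\<^sup>+t. indicator {0..1::real} t * ennreal (norm (gradient f (x + t *\<^sub>R z)) * norm z) \<partial>lborel)"
proof -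
  let ?F = "\<lambda>t. f (x + t *\<^sub>R z)" and ?G = "\<lambda>t. gradient f (x + t *\<^sub>R z) \<bullet> z"
  have d: "(?F has_real_derivative ?G t) (at t)" for t
  proof -
    have "((\<lambda>t. x + t *\<^sub>R z) has_derivative (\<lambda>t. t *\<^sub>R z)) (at t)"
      by (auto intro!: derivative_eq_intros)
    from has_derivative_compose[OF this has_derivative_gradient[OF smooth_differentiable[OF f]]]
    have "(?F has_derivative (\<lambda>s. gradient f (x + t *\<^sub>R z) \<bullet> (s *\<^sub>R z))) (at t)" .
    then show ?thesis
      by (rule has_derivative_imp_has_field_derivative) (simp add: mult.commute)
  qed
  have c: "continuous_on UNIV ?G"
    by (intro continuous_intros continuous_on_compose2[OF smooth_gradient_continuous_on[OF f, of UNIV]]) auto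
  have eq: "(LINT t|lborel. ?G t * indicator {0..1::real} t) = f (x + z) - f x"
    using integral_FTC_Icc_real[of 0 1 ?F ?G] d c
    by (simp add: continuous_on_eq_continuous_at)
  have int: "integrable lborel (\<lambda>t. ?G t * indicator {0..1::real} t)"
    using borel_integrable_compact[OF compact_Icc continuous_on_subset[OF c], of 0 1]
    by (simp add: mult.commute)
  have "ennreal \<bar>f (x + z) - f x\<bar> \<le> (\<integral>\<^sup>+t. ennreal (norm (?G t * indicator {0..1::real} t)) \<partial>lborel)"
    using integral_norm_bound_ennreal[OF int] unfolding eq by simp
  also have "\<dots> \<le> (\<integral>\<^sup>+t. indicator {0..1::real} t * ennreal (norm (gradient f (x + t *\<^sub>R z)) * norm z) \<partial>lborel)"
  proof (rule nn_integral_mono)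
    fix t :: real
    have "\<bar>?G t\<bar> \<le> norm (gradient f (x + t *\<^sub>R z)) * norm z" by (rule Cauchy_Schwarz_ineq2)
    then show "ennreal (norm (?G t * indicator {0..1::real} t))
        \<le> indicator {0..1::real} t * ennreal (norm (gradient f (x + t *\<^sub>R z)) * norm z)"
      by (cases "t \<in> {0..1}") (simp_all add: ennreal_leI)
  qed
  finally show ?thesis .
qed

lemma nn_integral_lborel_affine:
  fixes F :: "'a::euclidean_space \<Rightarrow> ennreal"
  assumes [measurable]: "F \<in> borel_measurable borel" and t: "t > 0"
  shows "(\<integral>\<^sup>+z. F (x + t *\<^sub>R z) \<partial>lborel) = ennreal (1 / t ^ DIM('a)) * (\<integral>\<^sup>+z. F z \<partial>lborel)"
proof -
  have "(\<integral>\<^sup>+z. F z \<partial>lborel) =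
      (\<integral>\<^sup>+z. F z \<partial>density (distr lborel borel (\<lambda>z. x + t *\<^sub>R z)) (\<lambda>_. ennreal (\<bar>t\<bar> ^ DIM('a))))"
    using lborel_affine[of t x] t by simp
  also have "\<dots> = (\<integral>\<^sup>+z. ennreal (\<bar>t\<bar> ^ DIM('a)) * F (x + t *\<^sub>R z) \<partial>lborel)"
    by (subst nn_integral_density, simp, simp, subst nn_integral_distr) simp_all
  also have "\<dots> = ennreal (t ^ DIM('a)) * (\<integral>\<^sup>+z. F (x + t *\<^sub>R z) \<partial>lborel)"
    using t by (subst nn_integral_cmult) simp_all
  finally have "ennreal (1 / t ^ DIM('a)) * (\<integral>\<^sup>+z. F z \<partial>lborel)
      = (ennreal (1 / t ^ DIM('a)) * ennreal (t ^ DIM('a))) * (\<integral>\<^sup>+z. F (x + t *\<^sub>R z) \<partial>lborel)"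
    by (simp only: mult.assoc)
  also have "ennreal (1 / t ^ DIM('a)) * ennreal (t ^ DIM('a)) = 1"
    using t by (simp add: ennreal_mult[symmetric] del: ennreal_1)
  finally show ?thesis by simp
qed

text \<open>The factor \<open>1 / t ^ DIM('a)\<close> is the Jacobian of the substitution
  \<open>x + t *\<^sub>R z\<close>. It is harmless for translations, where \<open>t = 1\<close>, and
  is the obstacle on rays, where \<open>t\<close> runs down to 0.\<close>

lemma nn_integral_threshold:
  fixes G :: "'a::euclidean_space \<Rightarrow> 'a"
  assumes G [measurable]: "G \<in> borel_measurable borel" and B [measurable]: "B \<in> sets borel"
    and t: "t > 0" and M: "M > 0" and p: "p \<ge> 1"
  shows "(\<integral>\<^sup>+z. indicator B z * ennreal (norm (G (x + t *\<^sub>R z))) \<partial>lborel)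
    \<le> ennreal M * emeasure lborel B
      + ennreal (M powr (1 - p) / t ^ DIM('a)) * (\<integral>\<^sup>+z. ennreal (norm (G z) powr p) \<partial>lborel)"
proof -
  have "(\<integral>\<^sup>+z. indicator B z * ennreal (norm (G (x + t *\<^sub>R z))) \<partial>lborel)
      \<le> (\<integral>\<^sup>+z. ennreal M * indicator B z + ennreal (M powr (1 - p)) * ennreal (norm (G (x + t *\<^sub>R z)) powr p) \<partial>lborel)"
  proof (rule nn_integral_mono)
    fix z
    let ?n = "norm (G (x + t *\<^sub>R z))"
    have "ennreal ?n \<le> ennreal (M + M powr (1 - p) * ?n powr p)"
      by (intro ennreal_leI le_threshold_powr M p) simp
    also have "\<dots> = ennreal M + ennreal (M powr (1 - p)) * ennreal (?n powr p)"
      using M by (simp add: ennreal_plus ennreal_mult)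
    finally show "indicator B z * ennreal ?n \<le> ennreal M * indicator B z + ennreal (M powr (1 - p)) * ennreal (?n powr p)"
      by (cases "z \<in> B") simp_all
  qed
  also have "\<dots> = ennreal M * emeasure lborel B
      + ennreal (M powr (1 - p)) * (\<integral>\<^sup>+z. ennreal (norm (G (x + t *\<^sub>R z)) powr p) \<partial>lborel)"
    by (subst nn_integral_add) (simp_all add: nn_integral_cmult)
  also have "(\<integral>\<^sup>+z. ennreal (norm (G (x + t *\<^sub>R z)) powr p) \<partial>lborel)
      = ennreal (1 / t ^ DIM('a)) * (\<integral>\<^sup>+z. ennreal (norm (G z) powr p) \<partial>lborel)"
    by (rule nn_integral_lborel_affine[OF _ t, of "\<lambda>z. ennreal (norm (G z) powr p)"]) measurable
  also have "ennreal (M powr (1 - p)) * (ennreal (1 / t ^ DIM('a)) * (\<integral>\<^sup>+z. ennreal (norm (G z) powr p) \<partial>lborel))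
      = ennreal (M powr (1 - p) / t ^ DIM('a)) * (\<integral>\<^sup>+z. ennreal (norm (G z) powr p) \<partial>lborel)"
    using t by (simp add: mult.assoc[symmetric] ennreal_mult[symmetric])
  finally show ?thesis .
qed

lemma nn_integral_swap_lborel:
  fixes F :: "'a::euclidean_space \<Rightarrow> real \<Rightarrow> ennreal"
  assumes "(\<lambda>(x, t). F x t) \<in> borel_measurable (lborel \<Otimes>\<^sub>M lborel)"
  shows "(\<integral>\<^sup>+x. (\<integral>\<^sup>+t. F x t \<partial>lborel) \<partial>lborel) = (\<integral>\<^sup>+t. (\<integral>\<^sup>+x. F x t \<partial>lborel) \<partial>lborel)"
  using lborel_pair.Fubini'[OF assms] by simp

text \<open>With a fixed increment \<open>h\<close> and a moving base point, the points of the
  segment are translates, so no Jacobian appears after swapping the integrals and \<open>M\<close>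
  enters with factor exactly one. The sharp Lipschitz constant of limit functions comes from
  here.\<close>

lemma translation_estimate:
  fixes f :: "'a::euclidean_space \<Rightarrow> real"
  assumes f: "smooth f" and M: "M > 0" and p: "p \<ge> 1" and B [measurable]: "B \<in> sets borel"
  shows "(\<integral>\<^sup>+x. indicator B x * ennreal \<bar>f (x + h) - f x\<bar> \<partial>lborel)
    \<le> ennreal (norm h) * (ennreal M * emeasure lborel B
        + ennreal (M powr (1 - p)) * (\<integral>\<^sup>+x. ennreal (norm (gradient f x) powr p) \<partial>lborel))"
proof -
  have [measurable]: "gradient f \<in> borel_measurable borel"
    by (intro borel_measurable_continuous_onI smooth_gradient_continuous_on f)
  let ?S = "ennreal M * emeasure lborel B
        + ennreal (M powr (1 - p)) * (\<integral>\<^sup>+x. ennreal (norm (gradient f x) powr p) \<partial>lborel)"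
  have "(\<integral>\<^sup>+x. indicator B x * ennreal \<bar>f (x + h) - f x\<bar> \<partial>lborel)
      \<le> (\<integral>\<^sup>+x. (\<integral>\<^sup>+t. indicator B x * (indicator {0..1::real} t * ennreal (norm (gradient f (x + t *\<^sub>R h)) * norm h)) \<partial>lborel) \<partial>lborel)"
    by (intro nn_integral_mono) (simp add: nn_integral_cmult mult_left_mono[OF segment_estimate[OF f]])
  also have "\<dots> = (\<integral>\<^sup>+t. (\<integral>\<^sup>+x. indicator B x * (indicator {0..1::real} t * ennreal (norm (gradient f (x + t *\<^sub>R h)) * norm h)) \<partial>lborel) \<partial>lborel)"
    by (rule nn_integral_swap_lborel) measurable
  also have "\<dots> \<le> (\<integral>\<^sup>+t. indicator {0..1::real} t * (ennreal (norm h) * ?S) \<partial>lborel)"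
  proof (rule nn_integral_mono)
    fix t :: real
    have "(\<integral>\<^sup>+x. indicator B x * (indicator {0..1::real} t * ennreal (norm (gradient f (x + t *\<^sub>R h)) * norm h)) \<partial>lborel)
        = (\<integral>\<^sup>+x. (indicator {0..1::real} t * ennreal (norm h)) * (indicator B x * ennreal (norm (gradient f (t *\<^sub>R h + 1 *\<^sub>R x)))) \<partial>lborel)"
      by (intro nn_integral_cong) (simp add: ennreal_mult add.commute mult_ac)
    also have "\<dots> = (indicator {0..1::real} t * ennreal (norm h)) * (\<integral>\<^sup>+x. indicator B x * ennreal (norm (gradient f (t *\<^sub>R h + 1 *\<^sub>R x))) \<partial>lborel)"
      by (rule nn_integral_cmult) measurable
    also have "\<dots> \<le> (indicator {0..1::real} t * ennreal (norm h)) * ?S"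
      using nn_integral_threshold[of "gradient f" B 1 M p "t *\<^sub>R h"] M p
      by (intro mult_left_mono) simp_all
    finally show "(\<integral>\<^sup>+x. indicator B x * (indicator {0..1::real} t * ennreal (norm (gradient f (x + t *\<^sub>R h)) * norm h)) \<partial>lborel)
        \<le> indicator {0..1::real} t * (ennreal (norm h) * ?S)" by (simp add: mult.assoc)
  qed
  also have "\<dots> = ennreal (norm h) * ?S"
    by (simp add: nn_integral_multc)
  finally show ?thesis .
qed

lemma nn_integral_inverse_sqrt:
  "(\<integral>\<^sup>+t. indicator {0..1::real} t * ennreal (t powr (-1/2)) \<partial>lborel) = 2"
proof -
  have "((\<lambda>t. t powr (-1/2)) has_integral (1 powr (-1/2 + 1) / (-1/2 + 1))) {0..(1::real)}"
    by (rule has_integral_powr_from_0) auto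
  then have "((\<lambda>t. t powr (-1/2)) has_integral 2) {0..(1::real)}" by simp
  then have "(\<integral>\<^sup>+t. ennreal (t powr (-1/2)) * indicator {0..1} t \<partial>lborel) = ennreal 2"
    by (rule nn_integral_has_integral_lebesgue'[rotated]) simp
  then show ?thesis by (simp add: mult.commute)
qed

text \<open>On rays from \<open>x\<close> the Jacobian \<open>1 / t ^ DIM('a)\<close> cannot be
  integrated down to 0. Letting the threshold grow like \<open>K * t powr (-1/2)\<close>
  compensates: the power of \<open>t\<close> left in the energy term is
  \<open>(p - 1) / 2 - DIM('a)\<close>, at least \<open>-1/2\<close> because
  \<open>p \<ge> 2 * DIM('a)\<close>. The integral of \<open>t powr (-1/2)\<close> over the unit
  interval is the leading factor 2.\<close>

lemma ball_average_estimate: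
  fixes f :: "'a::euclidean_space \<Rightarrow> real"
  assumes f: "smooth f" and p: "p \<ge> 2 * real DIM('a)" and K: "K > 0" and \<rho>: "\<rho> > 0"
  shows "(\<integral>\<^sup>+z. indicator (ball 0 \<rho>) z * ennreal \<bar>f (x + z) - f x\<bar> \<partial>lborel)
    \<le> 2 * (ennreal \<rho> * (ennreal K * emeasure lborel (ball (0::'a) \<rho>)
        + ennreal (K powr (1 - p)) * (\<integral>\<^sup>+x. ennreal (norm (gradient f x) powr p) \<partial>lborel)))"
proof -
  have [measurable]: "gradient f \<in> borel_measurable borel"
    by (intro borel_measurable_continuous_onI smooth_gradient_continuous_on f)
  define B where "B = ball (0::'a) \<rho>"
  have B [measurable]: "B \<in> sets borel" by (simp add: B_def)
  define A where "A = (\<integral>\<^sup>+x. ennreal (norm (gradient f x) powr p) \<partial>lborel)"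
  define S where "S = ennreal \<rho> * (ennreal K * emeasure lborel B + ennreal (K powr (1 - p)) * A)"
  have p1: "p \<ge> 1" using p DIM_positive[where 'a='a] by linarith
  have inner: "(\<integral>\<^sup>+z. indicator B z * ennreal (norm (gradient f (x + t *\<^sub>R z)) * norm z) \<partial>lborel)
      \<le> ennreal (t powr (-1/2)) * S" if t: "0 < t" "t \<le> 1" for t
  proof -
    define M where "M = K * t powr (-1/2)"
    have M: "M > 0" using K t by (simp add: M_def)
    have "M powr (1 - p) = K powr (1 - p) * t powr ((-1/2) * (1 - p))"
      using K t by (simp only: M_def powr_mult powr_powr)
    moreover have "inverse (t ^ DIM('a)) = t powr (- real DIM('a))"
      using t by (simp only: powr_minus powr_realpow)
    ultimately have "M powr (1 - p) / t ^ DIM('a) = K powr (1 - p) * (t powr ((-1/2) * (1 - p)) * t powr (- real DIM('a)))"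
      by (simp only: divide_inverse mult.assoc)
    also have "\<dots> = K powr (1 - p) * t powr ((p - 1) / 2 - real DIM('a))"
      by (simp add: powr_add[symmetric] algebra_simps diff_divide_distrib)
    also have "\<dots> \<le> K powr (1 - p) * t powr (-1/2)"
    proof -
      have "-1/2 \<le> (p - 1) / 2 - real DIM('a)" using p by (simp add: field_simps)
      then show ?thesis using t by (intro mult_left_mono powr_mono') auto
    qed
    finally have Mt: "M powr (1 - p) / t ^ DIM('a) \<le> K powr (1 - p) * t powr (-1/2)" .
    have "(\<integral>\<^sup>+z. indicator B z * ennreal (norm (gradient f (x + t *\<^sub>R z)) * norm z) \<partial>lborel)
        \<le> (\<integral>\<^sup>+z. ennreal \<rho> * (indicator B z * ennreal (norm (gradient f (x + t *\<^sub>R z)))) \<partial>lborel)"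
    proof (rule nn_integral_mono)
      fix z
      show "indicator B z * ennreal (norm (gradient f (x + t *\<^sub>R z)) * norm z)
          \<le> ennreal \<rho> * (indicator B z * ennreal (norm (gradient f (x + t *\<^sub>R z))))"
      proof (cases "z \<in> B")
        case True
        then have "norm (gradient f (x + t *\<^sub>R z)) * norm z \<le> \<rho> * norm (gradient f (x + t *\<^sub>R z))"
          using mult_right_mono[of "norm z" \<rho> "norm (gradient f (x + t *\<^sub>R z))"] by (simp add: B_def mult.commute)
        then show ?thesis using True \<rho> by (simp add: ennreal_leI ennreal_mult[symmetric])
      qed simp
    qed
    also have "\<dots> = ennreal \<rho> * (\<integral>\<^sup>+z. indicator B z * ennreal (norm (gradient f (x + t *\<^sub>R z))) \<partial>lborel)"
      by (rule nn_integral_cmult) measurable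
    also have "\<dots> \<le> ennreal \<rho> * (ennreal M * emeasure lborel B + ennreal (M powr (1 - p) / t ^ DIM('a)) * A)"
      unfolding A_def using t M p1 by (intro mult_left_mono nn_integral_threshold) auto
    also have "\<dots> \<le> ennreal \<rho> * (ennreal (K * t powr (-1/2)) * emeasure lborel B + ennreal (K powr (1 - p) * t powr (-1/2)) * A)"
      unfolding M_def[symmetric] by (intro mult_left_mono add_left_mono mult_right_mono ennreal_leI Mt) auto
    also have "\<dots> = ennreal (t powr (-1/2)) * S"
      unfolding S_def using K by (simp add: ennreal_mult distrib_left mult_ac)
    finally show ?thesis .
  qed
  have "(\<integral>\<^sup>+z. indicator B z * ennreal \<bar>f (x + z) - f x\<bar> \<partial>lborel)
      \<le> (\<integral>\<^sup>+z. (\<integral>\<^sup>+t. indicator B z * (indicator {0..1::real} t * ennreal (norm (gradient f (x + t *\<^sub>R z)) * norm z)) \<partial>lborel) \<partial>lborel)"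
    by (intro nn_integral_mono) (simp add: nn_integral_cmult mult_left_mono[OF segment_estimate[OF f]])
  also have "\<dots> = (\<integral>\<^sup>+t. (\<integral>\<^sup>+z. indicator B z * (indicator {0..1::real} t * ennreal (norm (gradient f (x + t *\<^sub>R z)) * norm z)) \<partial>lborel) \<partial>lborel)"
    by (rule nn_integral_swap_lborel) measurable
  also have "\<dots> \<le> (\<integral>\<^sup>+t. (indicator {0..1::real} t * ennreal (t powr (-1/2))) * S \<partial>lborel)"
  proof (rule nn_integral_mono_AE)
    have "AE t in lborel. t \<noteq> (0::real)" by (rule AE_lborel_singleton)
    then show "AE t in lborel. (\<integral>\<^sup>+z. indicator B z * (indicator {0..1::real} t * ennreal (norm (gradient f (x + t *\<^sub>R z)) * norm z)) \<partial>lborel)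
        \<le> (indicator {0..1::real} t * ennreal (t powr (-1/2))) * S"
    proof eventually_elim
      case (elim t)
      show ?case using inner[of t] elim by (cases "t \<in> {0..1}") simp_all
    qed
  qed
  also have "\<dots> = (\<integral>\<^sup>+t. indicator {0..1::real} t * ennreal (t powr (-1/2)) \<partial>lborel) * S"
    by (rule nn_integral_multc) measurable
  also have "\<dots> = 2 * S" by (simp only: nn_integral_inverse_sqrt)
  finally show ?thesis by (simp only: S_def A_def B_def)
qed

text \<open>Both \<open>f z - f x\<close> and \<open>f z - f y\<close> are averaged over the ball
  about the midpoint with half the distance as radius, which lies in the balls of full radius about
  \<open>x\<close> and \<open>y\<close>. Of the constant, one factor 2 comes from the ray integral,
  another from the two endpoints, and \<open>2 ^ DIM('a)\<close> from the ratio of the ball volumes.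
  The threshold \<open>K\<close> stays free because later uses choose it differently.\<close>

lemma morrey:
  fixes f :: "'a::euclidean_space \<Rightarrow> real"
  assumes f: "smooth f" and p: "p \<ge> 2 * real DIM('a)" and K: "K > 0"
    and A: "(\<integral>\<^sup>+x. ennreal (norm (gradient f x) powr p) \<partial>lborel) \<le> ennreal A" "A \<ge> 0"
    and xy: "x \<noteq> y"
  shows "\<bar>f x - f y\<bar> \<le> 4 * 2 ^ DIM('a) * dist x y *
    (K + K powr (1 - p) * A / (unit_ball_vol (real DIM('a)) * dist x y ^ DIM('a)))"
proof -
  define \<rho> where "\<rho> = dist x y"
  have \<rho>: "\<rho> > 0" using xy by (simp add: \<rho>_def)
  define \<omega> where "\<omega> = unit_ball_vol (real DIM('a))"
  have \<omega>: "\<omega> > 0" by (simp add: \<omega>_def)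
  have vol: "emeasure lborel (ball c r) = ennreal (\<omega> * r ^ DIM('a))" if "r > 0" for c :: 'a and r
    using that by (simp add: emeasure_ball \<omega>_def)
  have fm [measurable]: "f \<in> borel_measurable borel"
    by (intro borel_measurable_continuous_onI smooth_continuous_on f)
  define E where "E = 2 * (\<rho> * (K * (\<omega> * \<rho> ^ DIM('a)) + K powr (1 - p) * A))"
  have E0: "E \<ge> 0" using K \<omega> \<rho> A by (simp add: E_def)
  define m where "m = midpoint x y"
  have [measurable]: "ball m (\<rho> / 2) \<in> sets borel" by simp
  have av: "(\<integral>\<^sup>+z. indicator (ball m (\<rho> / 2)) z * ennreal \<bar>f z - f c\<bar> \<partial>lborel) \<le> ennreal E"
    if c: "dist c m = \<rho> / 2" for c
  proof -
    have sub: "ball m (\<rho> / 2) \<subseteq> ball c \<rho>"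
    proof
      fix z assume "z \<in> ball m (\<rho> / 2)"
      then show "z \<in> ball c \<rho>" using c dist_triangle[of c z m] by (simp add: dist_commute)
    qed
    have "(\<integral>\<^sup>+z. indicator (ball m (\<rho> / 2)) z * ennreal \<bar>f z - f c\<bar> \<partial>lborel)
        \<le> (\<integral>\<^sup>+z. indicator (ball c \<rho>) z * ennreal \<bar>f z - f c\<bar> \<partial>lborel)"
      using sub by (intro nn_integral_mono mult_right_mono) (auto split: split_indicator)
    also have "\<dots> = (\<integral>\<^sup>+z. indicator (ball c \<rho>) (c + 1 *\<^sub>R z) * ennreal \<bar>f (c + 1 *\<^sub>R z) - f c\<bar> \<partial>lborel)"
      by (subst nn_integral_lborel_affine[of "\<lambda>z. indicator (ball c \<rho>) z * ennreal \<bar>f z - f c\<bar>" 1 c]) (measurable, simp_all)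
    also have "\<dots> = (\<integral>\<^sup>+z. indicator (ball 0 \<rho>) z * ennreal \<bar>f (c + z) - f c\<bar> \<partial>lborel)"
      by (intro nn_integral_cong) (simp add: indicator_def dist_norm)
    also have "\<dots> \<le> 2 * (ennreal \<rho> * (ennreal K * emeasure lborel (ball (0::'a) \<rho>)
        + ennreal (K powr (1 - p)) * (\<integral>\<^sup>+x. ennreal (norm (gradient f x) powr p) \<partial>lborel)))"
      by (rule ball_average_estimate[OF f p K \<rho>])
    also have "\<dots> \<le> 2 * (ennreal \<rho> * (ennreal K * ennreal (\<omega> * \<rho> ^ DIM('a)) + ennreal (K powr (1 - p)) * ennreal A))"
      unfolding vol[OF \<rho>] using A by (intro mult_left_mono add_left_mono) auto
    also have "\<dots> = ennreal E"
      unfolding E_def using \<rho> K \<omega> A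
      by (simp add: ennreal_mult[symmetric] ennreal_plus[symmetric] ennreal_numeral[symmetric] del: ennreal_plus ennreal_numeral)
    finally show ?thesis .
  qed
  have "ennreal (\<bar>f x - f y\<bar> * (\<omega> * (\<rho> / 2) ^ DIM('a)))
      = (\<integral>\<^sup>+z. indicator (ball m (\<rho> / 2)) z * ennreal \<bar>f x - f y\<bar> \<partial>lborel)"
  proof -
    have "(\<integral>\<^sup>+z. ennreal \<bar>f x - f y\<bar> * indicator (ball m (\<rho> / 2)) z \<partial>lborel)
        = ennreal \<bar>f x - f y\<bar> * ennreal (\<omega> * (\<rho> / 2) ^ DIM('a))"
      using vol[of "\<rho> / 2" m] \<rho> by (subst nn_integral_cmult_indicator) simp_all
    then show ?thesis using \<rho> \<omega> by (simp add: ennreal_mult mult.commute)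
  qed
  also have "\<dots> \<le> (\<integral>\<^sup>+z. indicator (ball m (\<rho> / 2)) z * ennreal \<bar>f z - f x\<bar>
      + indicator (ball m (\<rho> / 2)) z * ennreal \<bar>f z - f y\<bar> \<partial>lborel)"
  proof (rule nn_integral_mono)
    fix z
    have "ennreal \<bar>f x - f y\<bar> \<le> ennreal (\<bar>f z - f x\<bar> + \<bar>f z - f y\<bar>)" by (intro ennreal_leI) linarith
    then show "indicator (ball m (\<rho> / 2)) z * ennreal \<bar>f x - f y\<bar>
        \<le> indicator (ball m (\<rho> / 2)) z * ennreal \<bar>f z - f x\<bar> + indicator (ball m (\<rho> / 2)) z * ennreal \<bar>f z - f y\<bar>"
      by (cases "z \<in> ball m (\<rho> / 2)") simp_all
  qed
  also have "\<dots> = (\<integral>\<^sup>+z. indicator (ball m (\<rho> / 2)) z * ennreal \<bar>f z - f x\<bar> \<partial>lborel)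
      + (\<integral>\<^sup>+z. indicator (ball m (\<rho> / 2)) z * ennreal \<bar>f z - f y\<bar> \<partial>lborel)"
    by (rule nn_integral_add) measurable
  also have "\<dots> \<le> ennreal E + ennreal E"
    by (intro add_mono av) (simp_all add: m_def \<rho>_def dist_midpoint)
  also have "\<dots> = ennreal (2 * E)" using E0 by (simp add: ennreal_plus[symmetric] del: ennreal_plus)
  finally have "\<bar>f x - f y\<bar> * (\<omega> * (\<rho> / 2) ^ DIM('a)) \<le> 2 * E"
    using E0 by (subst (asm) ennreal_le_iff) auto
  then have "\<bar>f x - f y\<bar> \<le> 2 * E / (\<omega> * (\<rho> / 2) ^ DIM('a))"
    using \<omega> \<rho> by (simp add: pos_le_divide_eq)
  also have "\<dots> = 4 * 2 ^ DIM('a) * \<rho> * (K + K powr (1 - p) * A / (\<omega> * \<rho> ^ DIM('a)))"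
    using \<omega> \<rho> by (simp add: E_def field_simps power_divide)
  finally show ?thesis by (simp only: \<rho>_def \<omega>_def)
qed

section \<open>From test functions to continuous representatives in \<open>W01p\<close>\<close>

lemma powr_add_le:
  fixes a b \<delta> p :: real
  assumes a: "a \<ge> 0" and b: "b \<ge> 0" and \<delta>: "\<delta> > 0" and p: "p \<ge> 0"
  shows "(a + b) powr p \<le> (1 + \<delta>) powr p * a powr p + (1 + 1 / \<delta>) powr p * b powr p"
proof (cases "b \<le> \<delta> * a")
  case True
  have "(a + b) powr p \<le> ((1 + \<delta>) * a) powr p"
    using True a b p by (intro powr_mono2) (auto simp: algebra_simps)
  also have "\<dots> = (1 + \<delta>) powr p * a powr p" by (rule powr_mult)
  finally show ?thesis by (intro add_increasing2) simp_all
next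
  case False
  then have "a \<le> b / \<delta>" using \<delta> by (simp add: pos_le_divide_eq mult.commute)
  then have "(a + b) powr p \<le> ((1 + 1 / \<delta>) * b) powr p"
    using a b p by (intro powr_mono2) (auto simp: algebra_simps)
  also have "\<dots> = (1 + 1 / \<delta>) powr p * b powr p" by (rule powr_mult)
  finally show ?thesis by (intro add_increasing) simp_all
qed

text \<open>A substitute for Minkowski's inequality on the level of \<open>p\<close>-th powers: the
  factor of the first term tends to 1 with \<open>\<delta>\<close>, unlike in the convexity bound,
  at the price of a large factor on the second term, which is used for errors tending to 0.\<close>

lemma Lp_pow_add_le:
  fixes f g :: "'a::euclidean_space \<Rightarrow> 'b::euclidean_space"
  assumes [measurable]: "f \<in> borel_measurable (lebesgue_on \<Omega>)" "g \<in> borel_measurable (lebesgue_on \<Omega>)"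
    and \<delta>: "\<delta> > 0" and p: "p \<ge> 0"
  shows "Lp_pow \<Omega> p (\<lambda>x. f x + g x)
    \<le> ennreal ((1 + \<delta>) powr p) * Lp_pow \<Omega> p f + ennreal ((1 + 1 / \<delta>) powr p) * Lp_pow \<Omega> p g"
proof -
  have "Lp_pow \<Omega> p (\<lambda>x. f x + g x) \<le> (\<integral>\<^sup>+x. ennreal ((1 + \<delta>) powr p) * ennreal (norm (f x) powr p)
      + ennreal ((1 + 1 / \<delta>) powr p) * ennreal (norm (g x) powr p) \<partial>lebesgue_on \<Omega>)"
    unfolding Lp_pow_def
  proof (rule nn_integral_mono)
    fix x
    have "norm (f x + g x) powr p \<le> (norm (f x) + norm (g x)) powr p"
      using p by (intro powr_mono2 norm_triangle_ineq) auto
    also have "\<dots> \<le> (1 + \<delta>) powr p * norm (f x) powr p + (1 + 1 / \<delta>) powr p * norm (g x) powr p"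
      using \<delta> p by (intro powr_add_le) auto
    finally have "ennreal (norm (f x + g x) powr p) \<le> ennreal ((1 + \<delta>) powr p * norm (f x) powr p
        + (1 + 1 / \<delta>) powr p * norm (g x) powr p)" by (rule ennreal_leI)
    also have "\<dots> = ennreal ((1 + \<delta>) powr p) * ennreal (norm (f x) powr p)
      + ennreal ((1 + 1 / \<delta>) powr p) * ennreal (norm (g x) powr p)"
      by (simp add: ennreal_plus ennreal_mult)
    finally show "ennreal (norm (f x + g x) powr p) \<le> ennreal ((1 + \<delta>) powr p) * ennreal (norm (f x) powr p)
      + ennreal ((1 + 1 / \<delta>) powr p) * ennreal (norm (g x) powr p)" .
  qed
  also have "\<dots> = ennreal ((1 + \<delta>) powr p) * Lp_pow \<Omega> p f + ennreal ((1 + 1 / \<delta>) powr p) * Lp_pow \<Omega> p g"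
    unfolding Lp_pow_def by (subst nn_integral_add) (simp_all add: nn_integral_cmult)
  finally show ?thesis .
qed

lemma Lp_pow_minus: "Lp_pow \<Omega> p (\<lambda>x. f x - g x) = Lp_pow \<Omega> p (\<lambda>x. g x - f x)"
  by (simp add: Lp_pow_def norm_minus_commute)

lemma Lp_pow_gradient_test_function:
  assumes "open \<Omega>" "f \<in> test_functions \<Omega>" "p > 0"
  shows "Lp_pow \<Omega> p (gradient f) = (\<integral>\<^sup>+x. ennreal (norm (gradient f x) powr p) \<partial>lborel)"
  unfolding Lp_pow_def
  by (rule nn_integral_lebesgue_on_eq_lborel[OF assms(1)])
     (simp add: test_function_gradient_zero[OF assms(2)])

lemma test_function_measurable:
  assumes "f \<in> test_functions \<Omega>"
  shows "f \<in> borel_measurable borel" "gradient f \<in> borel_measurable borel"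
  by (intro borel_measurable_continuous_onI smooth_continuous_on smooth_gradient_continuous_on
      test_function_smooth[OF assms])+

text \<open>The gap between the energy of \<open>g\<close> and \<open>A\<close> is spent twice: a
  small \<open>\<delta>\<close> inflates the energy of \<open>g\<close> to a value still below
  \<open>A\<close>, and what remains pays for the approximation error with its large factor.\<close>

lemma eventually_Lp_pow_less:
  fixes g :: "'a::euclidean_space \<Rightarrow> 'b::euclidean_space"
  assumes g [measurable]: "g \<in> borel_measurable (lebesgue_on \<Omega>)"
    and h [measurable]: "\<And>k. h k \<in> borel_measurable (lebesgue_on \<Omega>)" and p: "p > 0"
    and lim: "(\<lambda>k. Lp_pow \<Omega> p (\<lambda>x. g x - h k x)) \<longlonglongrightarrow> 0" and A: "Lp_pow \<Omega> p g < ennreal A"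
  shows "\<forall>\<^sub>F k in sequentially. Lp_pow \<Omega> p (h k) \<le> ennreal A"
proof -
  define a where "a = enn2real (Lp_pow \<Omega> p g)"
  have "Lp_pow \<Omega> p g < top" using A by (rule less_trans) simp
  then have a: "Lp_pow \<Omega> p g = ennreal a" by (simp add: a_def)
  have a0: "a \<ge> 0" by (simp add: a_def)
  have aA: "a < A" using A a0 unfolding a by (simp add: ennreal_less_iff)
  have "((\<lambda>\<delta>. (1 + \<delta>) powr p * a) \<longlongrightarrow> (1 + 0) powr p * a) (at_right 0)"
    by (intro tendsto_intros) auto
  then have "\<forall>\<^sub>F \<delta> in at_right 0. (1 + \<delta>) powr p * a < A"
    by (rule order_tendstoD) (use aA in simp)
  moreover have "\<forall>\<^sub>F \<delta> in at_right 0. \<delta> > (0::real)" by (rule eventually_at_right_less)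
  ultimately have "\<forall>\<^sub>F \<delta> in at_right 0. \<delta> > 0 \<and> (1 + \<delta>) powr p * a < A"
    by eventually_elim simp
  then obtain \<delta> where \<delta>: "\<delta> > 0" "(1 + \<delta>) powr p * a < A"
    using eventually_happens'[OF trivial_limit_at_right_real] by blast
  define c where "c = (1 + 1 / \<delta>) powr p"
  have "1 / \<delta> > 0" using \<delta> by simp
  then have "1 + 1 / \<delta> \<noteq> 0" by linarith
  then have c: "c > 0" by (simp add: c_def)
  define \<eta> where "\<eta> = (A - (1 + \<delta>) powr p * a) / c"
  have \<eta>: "\<eta> > 0" using \<delta> c by (simp add: \<eta>_def)
  have "\<forall>\<^sub>F k in sequentially. Lp_pow \<Omega> p (\<lambda>x. g x - h k x) < ennreal \<eta>"
    using lim by (rule order_tendstoD) (use \<eta> in simp)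
  then show ?thesis
  proof eventually_elim
    case (elim k)
    have "Lp_pow \<Omega> p (h k) = Lp_pow \<Omega> p (\<lambda>x. g x + (h k x - g x))" by simp
    also have "\<dots> \<le> ennreal ((1 + \<delta>) powr p) * Lp_pow \<Omega> p g + ennreal c * Lp_pow \<Omega> p (\<lambda>x. h k x - g x)"
      unfolding c_def by (rule Lp_pow_add_le) (use \<delta> p in simp_all)
    also have "\<dots> \<le> ennreal ((1 + \<delta>) powr p) * ennreal a + ennreal c * ennreal \<eta>"
      using elim unfolding a by (intro add_left_mono mult_left_mono) (simp_all add: Lp_pow_minus[of \<Omega> p "h k"] less_imp_le)
    also have "\<dots> = ennreal ((1 + \<delta>) powr p * a + c * \<eta>)"
      using a0 c \<eta> by (simp add: ennreal_plus ennreal_mult)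
    also have "(1 + \<delta>) powr p * a + c * \<eta> = A" using c by (simp add: \<eta>_def)
    finally show ?case .
  qed
qed

lemma exists_point_outside:
  fixes x :: "'a::euclidean_space"
  assumes "\<Omega> \<subseteq> cball 0 r" "x \<in> \<Omega>" "D > 2 * r" "D > 0"
  obtains y where "y \<notin> \<Omega>" "dist x y = D"
proof -
  obtain e :: 'a where e: "norm e = 1" using vector_choose_size[of 1] by auto
  define y where "y = x + D *\<^sub>R e"
  have d: "dist x y = D" using e assms(4) by (simp add: y_def dist_norm)
  have "y \<notin> \<Omega>"
  proof
    assume "y \<in> \<Omega>"
    then have "norm x \<le> r" "norm y \<le> r" using assms by auto
    then have "dist x y \<le> 2 * r" using norm_triangle_ineq4[of x y] by (simp add: dist_norm)
    then show False using d assms(3) by simp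
  qed
  then show ?thesis using that d by blast
qed

text \<open>Morrey's inequality between \<open>x\<close> and a point outside
  \<open>\<Omega>\<close>, where \<open>f\<close> vanishes. Taking that point at one fixed distance
  \<open>D\<close> beyond the diameter makes the bound uniform in \<open>x\<close>.\<close>

lemma test_function_sup_bound:
  fixes f :: "'a::euclidean_space \<Rightarrow> real"
  assumes f: "f \<in> test_functions \<Omega>" and r: "\<Omega> \<subseteq> cball 0 r" and D: "D > 2 * r" "D > 0"
    and p: "p \<ge> 2 * real DIM('a)" and K: "K > 0"
    and A: "(\<integral>\<^sup>+x. ennreal (norm (gradient f x) powr p) \<partial>lborel) \<le> ennreal A" "A \<ge> 0"
  shows "\<bar>f x\<bar> \<le> 4 * 2 ^ DIM('a) * D *
    (K + K powr (1 - p) * A / (unit_ball_vol (real DIM('a)) * D ^ DIM('a)))"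
proof (cases "x \<in> \<Omega>")
  case True
  obtain y where y: "y \<notin> \<Omega>" and d: "dist x y = D" by (rule exists_point_outside[OF r True D])
  have "f y = 0" by (rule test_function_zero[OF f y])
  moreover have "x \<noteq> y" using d D by auto
  ultimately show ?thesis using morrey[OF test_function_smooth[OF f] p K A, of x y] d by simp
next
  case False
  then have "f x = 0" by (rule test_function_zero[OF f])
  then show ?thesis using D K A by (simp add: add_nonneg_nonneg)
qed

text \<open>The supremum bound applied to differences turns gradient convergence of the
  approximating test functions into uniform convergence; the limit is the continuous version,
  extended by zero. Both inherited estimates ask for an \<open>A\<close> strictly above the energy,
  because the approximations have energy at most \<open>A\<close> only eventually and with that
  slack.\<close>

lemma W01p_representative:
  fixes w :: "'a::euclidean_space \<Rightarrow> real"
  assumes \<Omega>: "bounded \<Omega>" "open \<Omega>" and w: "w \<in> W01p \<Omega> p" and p: "p \<ge> 2 * real DIM('a)"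
  obtains W where "continuous_on UNIV W" "\<And>x. x \<notin> \<Omega> \<Longrightarrow> W x = 0" "AE x in lebesgue_on \<Omega>. W x = w x"
    "\<And>A K x y. Lp_pow \<Omega> p (weak_gradient \<Omega> w) < ennreal A \<Longrightarrow> K > 0 \<Longrightarrow> x \<noteq> y \<Longrightarrow>
      \<bar>W x - W y\<bar> \<le> 4 * 2 ^ DIM('a) * dist x y *
        (K + K powr (1 - p) * A / (unit_ball_vol (real DIM('a)) * dist x y ^ DIM('a)))"
    "\<And>A M h B. Lp_pow \<Omega> p (weak_gradient \<Omega> w) < ennreal A \<Longrightarrow> M > 0 \<Longrightarrow> B \<in> sets borel \<Longrightarrow>
      (\<integral>\<^sup>+x. indicator B x * ennreal \<bar>W (x + h) - W x\<bar> \<partial>lborel)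
        \<le> ennreal (norm h) * (ennreal M * emeasure lborel B + ennreal (M powr (1 - p)) * ennreal A)"
proof -
  have p1: "p \<ge> 1" using p DIM_positive[where 'a='a] by linarith
  let ?N = "real DIM('a)" and ?g = "weak_gradient \<Omega> w"
  have wm [measurable]: "w \<in> borel_measurable (lebesgue_on \<Omega>)" using w by (simp add: W01p_def W1p_def Lp_space_def)
  have "\<exists>g. has_weak_gradient \<Omega> w g" using w by (auto simp: W01p_def W1p_def)
  then have "has_weak_gradient \<Omega> w ?g" using has_weak_gradient_weak_gradient by blast
  then have gm: "?g \<in> borel_measurable (lebesgue_on \<Omega>)"
    by (simp add: has_weak_gradient_def locally_integrable_def)
  obtain \<phi> where \<phi>: "\<And>k. \<phi> k \<in> test_functions \<Omega>"
    and lim: "(\<lambda>k. Lp_pow \<Omega> p (\<lambda>x. w x - \<phi> k x)) \<longlonglongrightarrow> 0"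
    and glim: "(\<lambda>k. Lp_pow \<Omega> p (\<lambda>x. ?g x - gradient (\<phi> k) x)) \<longlonglongrightarrow> 0"
    using w unfolding W01p_def by blast
  note sm = test_function_smooth[OF \<phi>]
  have \<phi>m: "\<phi> k \<in> borel_measurable (lebesgue_on \<Omega>)" "gradient (\<phi> k) \<in> borel_measurable (lebesgue_on \<Omega>)" for k
    by (intro lebesgue_on_measurable_if_borel test_function_measurable[OF \<phi>])+
  define r where "r = (SOME r. \<Omega> \<subseteq> cball 0 r)"
  have "\<exists>r. \<Omega> \<subseteq> cball 0 r" using \<Omega>(1) by (auto simp: bounded_iff subset_iff)
  then have r: "\<Omega> \<subseteq> cball 0 r" unfolding r_def by (rule someI_ex)
  define D where "D = 2 * \<bar>r\<bar> + 1"
  have D: "D > 2 * r" "D > 0" by (auto simp: D_def)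
  define \<omega> where "\<omega> = unit_ball_vol ?N"
  have \<omega>: "\<omega> > 0" by (simp add: \<omega>_def)
  have "uniformly_Cauchy_on UNIV \<phi>"
  proof (rule uniformly_Cauchy_onI)
    fix e :: real assume e: "e > 0"
    define C where "C = 4 * 2 ^ DIM('a) * D"
    have C: "C > 0" using D by (simp add: C_def)
    \<comment> \<open>\<open>K\<close> and \<open>A\<close> are chosen so that each of the two terms
      of the supremum bound equals \<open>e / 4\<close>.\<close>
    define K where "K = e / (4 * C)"
    have K: "K > 0" using e C by (simp add: K_def)
    define A where "A = e / (4 * C) * (\<omega> * D ^ DIM('a)) / K powr (1 - p)"
    have A: "A > 0" using e C \<omega> D K by (simp add: A_def)
    have CA: "C * (K + K powr (1 - p) * A / (\<omega> * D ^ DIM('a))) = e / 2"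
      using C K \<omega> D by (simp add: A_def K_def field_simps)
    \<comment> \<open>Two error terms, each multiplied by the factor \<open>2 powr p\<close> that
      \<open>Lp_pow_add_le\<close> has for \<open>\<delta> = 1\<close>, then add up to exactly
      \<open>A\<close>.\<close>
    define \<eta> where "\<eta> = A / 2 / (1 + 1) powr p"
    have \<eta>: "\<eta> > 0" using A by (simp add: \<eta>_def)
    have "\<forall>\<^sub>F k in sequentially. Lp_pow \<Omega> p (\<lambda>x. ?g x - gradient (\<phi> k) x) < ennreal \<eta>"
      using glim by (rule order_tendstoD) (use \<eta> in simp)
    then obtain M where M: "\<And>k. k \<ge> M \<Longrightarrow> Lp_pow \<Omega> p (\<lambda>x. ?g x - gradient (\<phi> k) x) < ennreal \<eta>"
      by (auto simp: eventually_sequentially)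
    have "dist (\<phi> m x) (\<phi> n x) < e" if mn: "m \<ge> M" "n \<ge> M" for m n x
    proof -
      let ?f = "\<lambda>x. 1 * \<phi> m x + (-1) * \<phi> n x"
      have f: "?f \<in> test_functions \<Omega>" by (rule test_functions_lincomb[OF \<phi> \<phi>])
      have gf: "gradient ?f = (\<lambda>x. (gradient (\<phi> m) x - ?g x) + (?g x - gradient (\<phi> n) x))"
        using gradient_lincomb[OF smooth_differentiable[OF sm[of m]] smooth_differentiable[OF sm[of n]], of 1 "-1"]
        by (simp add: fun_eq_iff)
      have "Lp_pow \<Omega> p (gradient ?f)
          \<le> ennreal ((1 + 1) powr p) * Lp_pow \<Omega> p (\<lambda>x. gradient (\<phi> m) x - ?g x)
            + ennreal ((1 + 1 / 1) powr p) * Lp_pow \<Omega> p (\<lambda>x. ?g x - gradient (\<phi> n) x)"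
        unfolding gf using gm \<phi>m p1 by (intro Lp_pow_add_le) simp_all
      also have "\<dots> \<le> ennreal ((1 + 1) powr p) * ennreal \<eta> + ennreal ((1 + 1) powr p) * ennreal \<eta>"
        using M[OF mn(1)] M[OF mn(2)] Lp_pow_minus[of \<Omega> p "gradient (\<phi> m)" ?g]
        by (intro add_mono mult_left_mono) (simp_all add: less_imp_le mult_left_mono)
      also have "\<dots> = ennreal (2 * ((1 + 1) powr p * \<eta>))"
        using \<eta> by (simp add: ennreal_mult[symmetric] ennreal_plus[symmetric] del: ennreal_plus)
      also have "2 * ((1 + 1) powr p * \<eta>) = A" by (simp add: \<eta>_def)
      finally have "(\<integral>\<^sup>+x. ennreal (norm (gradient ?f x) powr p) \<partial>lborel) \<le> ennreal A"
        using Lp_pow_gradient_test_function[OF \<Omega>(2) f, of p] p1 by simp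
      from test_function_sup_bound[OF f r D p K this less_imp_le[OF A], of x]
      have "\<bar>?f x\<bar> \<le> e / 2" using CA by (simp only: C_def \<omega>_def)
      then show ?thesis using e by (simp add: dist_real_def)
    qed
    then show "\<exists>M. \<forall>x\<in>UNIV. \<forall>m\<ge>M. \<forall>n\<ge>M. dist (\<phi> m x) (\<phi> n x) < e" by blast
  qed
  then obtain W where W: "uniform_limit UNIV \<phi> W sequentially"
    using Cauchy_uniformly_convergent by (auto simp: uniformly_convergent_on_def)
  have Wlim: "(\<lambda>k. \<phi> k x) \<longlonglongrightarrow> W x" for x
    by (rule tendsto_uniform_limitI[OF W]) simp
  have cW: "continuous_on UNIV W"
    by (rule uniform_limit_theorem[OF _ W]) (simp_all add: smooth_continuous_on[OF sm])
  have W0: "W x = 0" if "x \<notin> \<Omega>" for x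
    using Wlim[of x] test_function_zero[OF \<phi> that] by (simp add: LIMSEQ_const_iff)
  have Wm: "W \<in> borel_measurable (lebesgue_on \<Omega>)"
    by (intro lebesgue_on_measurable_if_borel borel_measurable_continuous_onI cW)
  have AE: "AE x in lebesgue_on \<Omega>. W x = w x"
  proof -
    let ?I = "\<lambda>k x. ennreal (norm (w x - \<phi> k x) powr p)"
    have pw: "liminf (\<lambda>k. ?I k x) = ennreal (norm (w x - W x) powr p)" for x
    proof (rule lim_imp_Liminf)
      have "(\<lambda>k. norm (w x - \<phi> k x)) \<longlonglongrightarrow> norm (w x - W x)" by (intro tendsto_intros Wlim)
      then have "(\<lambda>k. norm (w x - \<phi> k x) powr p) \<longlonglongrightarrow> norm (w x - W x) powr p"
        using p1 by (intro tendsto_powr') auto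
      then show "(\<lambda>k. ?I k x) \<longlonglongrightarrow> ennreal (norm (w x - W x) powr p)" by (rule tendsto_ennrealI)
    qed simp
    \<comment> \<open>Fatou's lemma identifies the uniform limit with the limit in
      \<open>L\<^sup>p\<close>.\<close>
    have "(\<integral>\<^sup>+x. ennreal (norm (w x - W x) powr p) \<partial>lebesgue_on \<Omega>)
        = (\<integral>\<^sup>+x. liminf (\<lambda>k. ?I k x) \<partial>lebesgue_on \<Omega>)"
      by (simp only: pw)
    also have "\<dots> \<le> liminf (\<lambda>k. \<integral>\<^sup>+x. ?I k x \<partial>lebesgue_on \<Omega>)"
      using \<phi>m wm by (intro nn_integral_liminf) simp
    also have "\<dots> = 0" using lim unfolding Lp_pow_def by (intro lim_imp_Liminf) simp_all
    finally have "(\<integral>\<^sup>+x. ennreal (norm (w x - W x) powr p) \<partial>lebesgue_on \<Omega>) = 0" by simp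
    then have "AE x in lebesgue_on \<Omega>. ennreal (norm (w x - W x) powr p) = 0"
      using Wm wm by (subst (asm) nn_integral_0_iff_AE) simp_all
    then show ?thesis by eventually_elim (simp add: ennreal_eq_0_iff)
  qed
  have energy: "\<forall>\<^sub>F k in sequentially. (\<integral>\<^sup>+x. ennreal (norm (gradient (\<phi> k) x) powr p) \<partial>lborel) \<le> ennreal A"
    if "Lp_pow \<Omega> p ?g < ennreal A" for A
    using eventually_Lp_pow_less[OF gm \<phi>m(2) _ glim that] p1
    by (simp add: Lp_pow_gradient_test_function[OF \<Omega>(2) \<phi>])
  have pos: "A \<ge> 0" if "Lp_pow \<Omega> p ?g < ennreal A" for A
    using that by (cases "A \<ge> 0") (simp_all add: ennreal_neg)
  have mor: "\<bar>W x - W y\<bar> \<le> 4 * 2 ^ DIM('a) * dist x y *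
        (K + K powr (1 - p) * A / (unit_ball_vol ?N * dist x y ^ DIM('a)))" (is "_ \<le> ?R")
    if A: "Lp_pow \<Omega> p ?g < ennreal A" and K: "K > 0" and xy: "x \<noteq> y" for A K x y
  proof (rule tendsto_upperbound)
    show "(\<lambda>k. \<bar>\<phi> k x - \<phi> k y\<bar>) \<longlonglongrightarrow> \<bar>W x - W y\<bar>" by (intro tendsto_intros Wlim)
    show "\<forall>\<^sub>F k in sequentially. \<bar>\<phi> k x - \<phi> k y\<bar> \<le> ?R"
      using energy[OF A] by eventually_elim (rule morrey[OF sm p K _ pos[OF A] xy])
  qed simp
  have tr: "(\<integral>\<^sup>+x. indicator B x * ennreal \<bar>W (x + h) - W x\<bar> \<partial>lborel)
        \<le> ennreal (norm h) * (ennreal M * emeasure lborel B + ennreal (M powr (1 - p)) * ennreal A)" (is "_ \<le> ?R")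
    if A: "Lp_pow \<Omega> p ?g < ennreal A" and M: "M > 0" and B [measurable]: "B \<in> sets borel" for A M h B
  proof -
    let ?I = "\<lambda>k x. indicator B x * ennreal \<bar>\<phi> k (x + h) - \<phi> k x\<bar>"
    have pw: "liminf (\<lambda>k. ?I k x) = indicator B x * ennreal \<bar>W (x + h) - W x\<bar>" for x
    proof (rule lim_imp_Liminf)
      have "(\<lambda>k. ennreal \<bar>\<phi> k (x + h) - \<phi> k x\<bar>) \<longlonglongrightarrow> ennreal \<bar>W (x + h) - W x\<bar>"
        by (intro tendsto_intros tendsto_ennrealI Wlim)
      then show "(\<lambda>k. ?I k x) \<longlonglongrightarrow> indicator B x * ennreal \<bar>W (x + h) - W x\<bar>"
        by (cases "x \<in> B") simp_all
    qed simp
    have [measurable]: "\<phi> k \<in> borel_measurable borel" for k by (rule test_function_measurable[OF \<phi>])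
    have "(\<integral>\<^sup>+x. indicator B x * ennreal \<bar>W (x + h) - W x\<bar> \<partial>lborel) = (\<integral>\<^sup>+x. liminf (\<lambda>k. ?I k x) \<partial>lborel)"
      by (simp only: pw)
    also have "\<dots> \<le> liminf (\<lambda>k. \<integral>\<^sup>+x. ?I k x \<partial>lborel)" by (rule nn_integral_liminf) measurable
    also have "\<dots> \<le> liminf (\<lambda>k::nat. ?R)"
    proof (rule Liminf_mono)
      show "\<forall>\<^sub>F k in sequentially. (\<integral>\<^sup>+x. ?I k x \<partial>lborel) \<le> ?R"
        using energy[OF A]
      proof eventually_elim
        case (elim k)
        show ?case
          by (rule order_trans[OF translation_estimate[OF sm M p1 B]])
             (intro mult_left_mono add_left_mono elim zero_le)
      qed
    qed
    also have "\<dots> = ?R" by (rule Liminf_const) simp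
    finally show ?thesis .
  qed
  show ?thesis using that[OF cW W0 AE mor tr] by blast
qed

section \<open>Compactness of sequences with growing exponents\<close>

lemma powr_ratio_tendsto_0:
  fixes p :: "'b \<Rightarrow> real"
  assumes "0 < q" "q < 1" "filterlim p at_top F"
  shows "((\<lambda>n. q powr p n) \<longlongrightarrow> 0) F"
proof -
  have "ln q < 0" using assms by simp
  then have "filterlim (\<lambda>n. ln q * p n) at_bot F"
    using assms(3) by (intro filterlim_tendsto_neg_mult_at_bot[OF tendsto_const])
  then have "((\<lambda>n. exp (ln q * p n)) \<longlongrightarrow> 0) F"
    by (rule filterlim_compose[OF exp_at_bot])
  then show ?thesis using assms(1) by (simp add: powr_def mult.commute)
qed

text \<open>The expression equals \<open>M * C * (M' / M) powr p n\<close>: an energy of size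
  \<open>M'\<close> to the power \<open>p\<close>, measured against a strictly larger threshold,
  decays geometrically in \<open>p\<close>.\<close>

lemma threshold_tendsto_0:
  fixes p :: "'b \<Rightarrow> real"
  assumes "0 < M'" "M' < M" "filterlim p at_top F"
  shows "((\<lambda>n. M powr (1 - p n) * (C * M' powr p n)) \<longlongrightarrow> 0) F"
proof -
  have "((\<lambda>n. (M * C) * (M' / M) powr p n) \<longlongrightarrow> (M * C) * 0) F"
    using assms by (intro tendsto_mult tendsto_const powr_ratio_tendsto_0) auto
  moreover have "(M * C) * (M' / M) powr q = M powr (1 - q) * (C * M' powr q)" for q
    using assms by (simp add: powr_divide powr_diff)
  ultimately show ?thesis by simp
qed

lemma le_of_forall_greater_mult:
  fixes d \<Lambda> c :: real
  assumes "c \<ge> 0" "\<And>M. M > \<Lambda> \<Longrightarrow> d \<le> M * c"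
  shows "d \<le> \<Lambda> * c"
proof (rule field_le_epsilon)
  fix e :: real assume e: "e > 0"
  have "d \<le> (\<Lambda> + e / (c + 1)) * c" using assms e by (intro assms(2)) (simp add: add_nonneg_pos)
  also have "\<dots> = \<Lambda> * c + e * (c / (c + 1))" by (simp add: distrib_right)
  also have "\<dots> \<le> \<Lambda> * c + e * 1" using assms(1) e by (intro add_left_mono mult_left_mono) auto
  finally show "d \<le> \<Lambda> * c + e" by simp
qed

text \<open>If the increment by \<open>h\<close> exceeded \<open>M * norm h\<close> at one point,
  continuity would give the same with a margin \<open>c\<close> on a whole ball. Integrating over
  this ball and applying Fatou's lemma contradicts the averaged bound, from which the volume of the
  ball cancels. The error \<open>e n\<close> does not scale with that volume, hence the ball is
  fixed before \<open>n\<close> tends to infinity.\<close>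

lemma lipschitz_of_translation_bounds:
  fixes W :: "nat \<Rightarrow> 'a::euclidean_space \<Rightarrow> real"
  assumes \<Lambda>: "\<Lambda> \<ge> 0" and cW: "\<And>n. continuous_on UNIV (W n)" and cX: "continuous_on UNIV X"
    and lim: "\<And>x. (\<lambda>n. W n x) \<longlonglongrightarrow> X x"
    and bound: "\<And>M. M > \<Lambda> \<Longrightarrow> \<exists>e. e \<longlonglongrightarrow> 0 \<and> (\<forall>\<^sub>F n in sequentially. \<forall>B h. B \<in> sets borel \<longrightarrow>
      (\<integral>\<^sup>+x. indicator B x * ennreal \<bar>W n (x + h) - W n x\<bar> \<partial>lborel)
        \<le> ennreal (norm h) * (ennreal M * emeasure lborel B + ennreal (e n)))"
  shows "\<Lambda>-lipschitz_on UNIV X"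
proof (rule lipschitz_onI[OF _ \<Lambda>])
  fix y x :: 'a
  define h where "h = y - x"
  have "\<bar>X (x + h) - X x\<bar> \<le> \<Lambda> * norm h"
  proof (rule le_of_forall_greater_mult)
    fix M assume M: "M > \<Lambda>"
    then have M0: "M > 0" using \<Lambda> by linarith
    show "\<bar>X (x + h) - X x\<bar> \<le> M * norm h"
    proof (rule ccontr)
      assume "\<not> \<bar>X (x + h) - X x\<bar> \<le> M * norm h"
      then have "M * norm h < \<bar>X (x + h) - X x\<bar>" by simp
      then obtain c where c: "M * norm h < c" "c < \<bar>X (x + h) - X x\<bar>" using dense by blast
      have c0: "c > 0" using c(1) M0 by (meson le_less_trans less_imp_le mult_nonneg_nonneg norm_ge_zero)
      let ?D = "\<lambda>z. \<bar>X (z + h) - X z\<bar>"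
      have cD: "continuous_on UNIV ?D"
        by (intro continuous_intros continuous_on_compose2[OF cX]) auto
      have "open {z. c < ?D z}" by (intro open_Collect_less continuous_intros cD)
      moreover have "x \<in> {z. c < ?D z}" using c(2) by simp
      ultimately obtain \<delta> where \<delta>: "\<delta> > 0" "ball x \<delta> \<subseteq> {z. c < ?D z}"
        unfolding open_contains_ball by blast
      let ?B = "ball x \<delta>"
      define b where "b = unit_ball_vol (real DIM('a)) * \<delta> ^ DIM('a)"
      have b: "b > 0" "emeasure lborel ?B = ennreal b" using \<delta> by (simp_all add: b_def emeasure_ball)
      obtain e where e: "e \<longlonglongrightarrow> 0" and ev: "\<forall>\<^sub>F n in sequentially. \<forall>B h. B \<in> sets borel \<longrightarrow>
        (\<integral>\<^sup>+x. indicator B x * ennreal \<bar>W n (x + h) - W n x\<bar> \<partial>lborel)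
        \<le> ennreal (norm h) * (ennreal M * emeasure lborel B + ennreal (e n))"
        using bound[OF M] by blast
      have Wm [measurable]: "W n \<in> borel_measurable borel" for n
        by (rule borel_measurable_continuous_onI[OF cW])
      have [measurable]: "?B \<in> sets borel" by simp
      let ?I = "\<lambda>n z. indicator ?B z * ennreal \<bar>W n (z + h) - W n z\<bar>"
      have pw: "liminf (\<lambda>n. ?I n z) = indicator ?B z * ennreal (?D z)" for z
      proof (rule lim_imp_Liminf)
        have "(\<lambda>n. ennreal \<bar>W n (z + h) - W n z\<bar>) \<longlonglongrightarrow> ennreal (?D z)"
          by (intro tendsto_intros tendsto_ennrealI lim)
        then show "(\<lambda>n. ?I n z) \<longlonglongrightarrow> indicator ?B z * ennreal (?D z)"
          by (cases "z \<in> ?B") simp_all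
      qed simp
      have "ennreal (c * b) = (\<integral>\<^sup>+z. ennreal c * indicator ?B z \<partial>lborel)"
        using b c0 by (subst nn_integral_cmult_indicator) (simp_all add: ennreal_mult)
      also have "\<dots> \<le> (\<integral>\<^sup>+z. liminf (\<lambda>n. ?I n z) \<partial>lborel)"
        unfolding pw
      proof (rule nn_integral_mono)
        fix z
        show "ennreal c * indicator ?B z \<le> indicator ?B z * ennreal (?D z)"
        proof (cases "z \<in> ?B")
          case True
          then have "c < ?D z" using \<delta>(2) by blast
          then show ?thesis using True by (simp add: ennreal_leI)
        qed simp
      qed
      also have "\<dots> \<le> liminf (\<lambda>n. \<integral>\<^sup>+z. ?I n z \<partial>lborel)" by (rule nn_integral_liminf) measurable
      also have "\<dots> \<le> liminf (\<lambda>n. ennreal (norm h * (M * b + \<bar>e n\<bar>)))"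
      proof (rule Liminf_mono)
        show "\<forall>\<^sub>F n in sequentially. (\<integral>\<^sup>+z. ?I n z \<partial>lborel) \<le> ennreal (norm h * (M * b + \<bar>e n\<bar>))"
          using ev
        proof eventually_elim
          case (elim n)
          have "(\<integral>\<^sup>+z. ?I n z \<partial>lborel) \<le> ennreal (norm h) * (ennreal M * ennreal b + ennreal (e n))"
            using elim[rule_format, of ?B h] by (simp add: b)
          also have "\<dots> \<le> ennreal (norm h) * (ennreal M * ennreal b + ennreal \<bar>e n\<bar>)"
            by (intro mult_left_mono add_left_mono ennreal_leI) auto
          also have "\<dots> = ennreal (norm h * (M * b + \<bar>e n\<bar>))"
            using M0 b(1) by (simp add: ennreal_mult)
          finally show ?case .
        qed
      qed
      also have "\<dots> = ennreal (norm h * (M * b + \<bar>0\<bar>))"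
        by (intro lim_imp_Liminf tendsto_ennrealI tendsto_intros e) simp
      finally have "c * b \<le> norm h * (M * b + \<bar>0\<bar>)"
        by (subst (asm) ennreal_le_iff) (use M0 b in auto)
      then have "c * b \<le> (M * norm h) * b" by (simp add: mult_ac)
      then show False using c(1) b(1) by simp
    qed
  qed simp
  then show "dist (X y) (X x) \<le> \<Lambda> * dist y x" by (simp add: h_def dist_norm)
qed

text \<open>The assumption on the energies says that the upper limit of their \<open>p\<close>-th
  roots is at most \<open>\<Lambda>\<close>, phrased without roots and with room for a factor
  \<open>C\<close>. Equicontinuity uses only the crude level \<open>\<Lambda> + 1\<close>; the
  constant \<open>\<Lambda>\<close> is recovered afterwards from levels decreasing to it.\<close>

lemma W01p_compactness:
  fixes w :: "nat \<Rightarrow> 'a::euclidean_space \<Rightarrow> real" and p :: "nat \<Rightarrow> real"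
  assumes \<Omega>: "bounded \<Omega>" "open \<Omega>" and w: "\<And>n. w n \<in> W01p \<Omega> (p n)"
    and p: "filterlim p at_top sequentially" and \<Lambda>: "\<Lambda> \<ge> 0" and C: "C > 0"
    and energy: "\<And>M. M > \<Lambda> \<Longrightarrow> \<forall>\<^sub>F n in sequentially. Lp_pow \<Omega> (p n) (weak_gradient \<Omega> (w n)) \<le> ennreal (C * M powr p n)"
  obtains \<sigma> W X where "strict_mono (\<sigma> :: nat \<Rightarrow> nat)" "\<And>k. continuous_on UNIV (W k)"
    "\<And>k. AE x in lebesgue_on \<Omega>. W k x = w (\<sigma> k) x" "uniform_limit UNIV W X sequentially"
    "\<Lambda>-lipschitz_on UNIV X" "\<And>x. x \<notin> \<Omega> \<Longrightarrow> X x = 0"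
proof -
  let ?N = "real DIM('a)"
  define \<omega> where "\<omega> = unit_ball_vol ?N"
  have \<omega>: "\<omega> > 0" by (simp add: \<omega>_def)
  \<comment> \<open>The estimates of \<open>W01p_representative\<close> require a strict bound on
    the energy; one more unit in the factor provides it.\<close>
  define C' where "C' = C + 1"
  have C': "C' > 0" using C by (simp add: C'_def)
  have energy': "\<forall>\<^sub>F n in sequentially. Lp_pow \<Omega> (p n) (weak_gradient \<Omega> (w n)) < ennreal (C' * M powr p n)"
    if M: "M > \<Lambda>" for M
    using energy[OF M]
  proof eventually_elim
    case (elim n)
    have "C * M powr p n < C' * M powr p n" using M \<Lambda> by (simp add: C'_def)
    then have "ennreal (C * M powr p n) < ennreal (C' * M powr p n)"
      using C by (intro ennreal_lessI) (auto intro: le_less_trans[OF _ \<open>C * M powr p n < C' * M powr p n\<close>])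
    then show ?case using elim by (rule le_less_trans[rotated])
  qed
  define M1 where "M1 = \<Lambda> + 1"
  have M1: "M1 > \<Lambda>" "M1 > 0" using \<Lambda> by (auto simp: M1_def)
  have "\<forall>\<^sub>F n in sequentially. 2 * ?N \<le> p n" using p by (simp add: filterlim_at_top)
  with energy'[OF M1(1)] have "\<forall>\<^sub>F n in sequentially.
      2 * ?N \<le> p n \<and> Lp_pow \<Omega> (p n) (weak_gradient \<Omega> (w n)) < ennreal (C' * M1 powr p n)"
    by eventually_elim simp
  then obtain n0 where n0: "\<And>n. n \<ge> n0 \<Longrightarrow> 2 * ?N \<le> p n"
    "\<And>n. n \<ge> n0 \<Longrightarrow> Lp_pow \<Omega> (p n) (weak_gradient \<Omega> (w n)) < ennreal (C' * M1 powr p n)"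
    by (auto simp: eventually_sequentially)
  define q where "q k = p (n0 + k)" for k
  define G where "G k = weak_gradient \<Omega> (w (n0 + k))" for k
  have q: "2 * ?N \<le> q k" "Lp_pow \<Omega> (q k) (G k) < ennreal (C' * M1 powr q k)" for k
    using n0[of "n0 + k"] by (simp_all add: q_def G_def)
  define P where "P k W \<longleftrightarrow> continuous_on UNIV W \<and> (\<forall>x. x \<notin> \<Omega> \<longrightarrow> W x = 0) \<and> (AE x in lebesgue_on \<Omega>. W x = w (n0 + k) x) \<and>
     (\<forall>A K x y. Lp_pow \<Omega> (q k) (G k) < ennreal A \<longrightarrow> K > 0 \<longrightarrow> x \<noteq> y \<longrightarrow>
      \<bar>W x - W y\<bar> \<le> 4 * 2 ^ DIM('a) * dist x y *
        (K + K powr (1 - q k) * A / (\<omega> * dist x y ^ DIM('a)))) \<and>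
     (\<forall>A M h B. Lp_pow \<Omega> (q k) (G k) < ennreal A \<longrightarrow> M > 0 \<longrightarrow> B \<in> sets borel \<longrightarrow>
      (\<integral>\<^sup>+x. indicator B x * ennreal \<bar>W (x + h) - W x\<bar> \<partial>lborel)
        \<le> ennreal (norm h) * (ennreal M * emeasure lborel B + ennreal (M powr (1 - q k)) * ennreal A))" for k W
  have "\<exists>W. P k W" for k
    unfolding G_def \<omega>_def P_def
    by (rule W01p_representative[OF \<Omega> w[of "n0 + k"], folded q_def, OF q(1)]) blast
  then obtain V where VP: "\<And>k. P k (V k)" by metis
  have V: "continuous_on UNIV (V k)" "x \<notin> \<Omega> \<Longrightarrow> V k x = 0"
    "AE x in lebesgue_on \<Omega>. V k x = w (n0 + k) x" for k x
    using VP[of k] unfolding P_def by blast+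
  have mor: "Lp_pow \<Omega> (q k) (G k) < ennreal A \<Longrightarrow> K > 0 \<Longrightarrow> x \<noteq> y \<Longrightarrow>
      \<bar>V k x - V k y\<bar> \<le> 4 * 2 ^ DIM('a) * dist x y *
        (K + K powr (1 - q k) * A / (\<omega> * dist x y ^ DIM('a)))" for k A K x y
    using VP[of k] unfolding P_def by blast
  have tr: "Lp_pow \<Omega> (q k) (G k) < ennreal A \<Longrightarrow> M > 0 \<Longrightarrow> B \<in> sets borel \<Longrightarrow>
      (\<integral>\<^sup>+x. indicator B x * ennreal \<bar>V k (x + h) - V k x\<bar> \<partial>lborel)
        \<le> ennreal (norm h) * (ennreal M * emeasure lborel B + ennreal (M powr (1 - q k)) * ennreal A)" for k A M h B
    using VP[of k] unfolding P_def by blast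
  have M1q: "M1 powr (1 - q k) * (C' * M1 powr q k) = M1 * C'" for k
    using M1(2) by (simp add: powr_add[symmetric] mult.left_commute)
  have equi: "\<bar>V k x - V k y\<bar> \<le> 4 * 2 ^ DIM('a) * (M1 + M1 * C' / \<omega>) * sqrt (dist x y)"
    if xy: "dist x y \<le> 1" for k x y
  proof (cases "x = y")
    case False
    define \<rho> where "\<rho> = dist x y"
    have \<rho>: "0 < \<rho>" "\<rho> \<le> 1" using False xy by (auto simp: \<rho>_def)
    \<comment> \<open>With this threshold the powers of \<open>\<rho>\<close> in Morrey's second
      term combine to at least \<open>-1/2\<close> once \<open>q k \<ge> 2 * DIM('a)\<close>. What
      remains is a modulus of continuity of order \<open>sqrt \<rho>\<close>, the same for all
      \<open>k\<close>.\<close>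
    define K where "K = M1 * \<rho> powr (-1/2)"
    have K: "K > 0" using M1 \<rho> by (simp add: K_def)
    have "K powr (1 - q k) = M1 powr (1 - q k) * \<rho> powr ((-1/2) * (1 - q k))"
      by (simp only: K_def powr_mult powr_powr)
    moreover have "inverse (\<rho> ^ DIM('a)) = \<rho> powr (- ?N)"
      using \<rho> by (simp only: powr_minus powr_realpow)
    ultimately have "K powr (1 - q k) * (C' * M1 powr q k) / (\<omega> * \<rho> ^ DIM('a))
        = (M1 powr (1 - q k) * (C' * M1 powr q k)) / \<omega> * (\<rho> powr ((-1/2) * (1 - q k)) * \<rho> powr (- ?N))"
      by (simp only: divide_inverse inverse_mult_distrib mult_ac)
    also have "\<dots> = M1 * C' / \<omega> * \<rho> powr ((q k - 1) / 2 - ?N)"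
      unfolding M1q by (simp add: powr_add[symmetric] algebra_simps diff_divide_distrib)
    also have "\<dots> \<le> M1 * C' / \<omega> * \<rho> powr (-1/2)"
    proof -
      have "-1/2 \<le> (q k - 1) / 2 - ?N" using q(1)[of k] by (simp add: field_simps)
      then show ?thesis using \<rho> M1 C' \<omega> by (intro mult_left_mono powr_mono') auto
    qed
    finally have "K + K powr (1 - q k) * (C' * M1 powr q k) / (\<omega> * \<rho> ^ DIM('a)) \<le> (M1 + M1 * C' / \<omega>) * \<rho> powr (-1/2)"
      by (simp add: K_def distrib_right)
    then have step: "4 * 2 ^ DIM('a) * \<rho> * (K + K powr (1 - q k) * (C' * M1 powr q k) / (\<omega> * \<rho> ^ DIM('a)))
        \<le> 4 * 2 ^ DIM('a) * \<rho> * ((M1 + M1 * C' / \<omega>) * \<rho> powr (-1/2))"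
      using \<rho> by (intro mult_left_mono) auto
    have sq: "\<rho> * \<rho> powr (-1/2) = sqrt \<rho>"
    proof -
      have "\<rho> * \<rho> powr (-1/2) = \<rho> powr 1 * \<rho> powr (-1/2)" using \<rho> by simp
      also have "\<dots> = \<rho> powr (1/2)" by (simp only: powr_add[symmetric]) simp
      finally show ?thesis using \<rho> by (simp add: powr_half_sqrt)
    qed
    have "\<bar>V k x - V k y\<bar> \<le> 4 * 2 ^ DIM('a) * \<rho> * (K + K powr (1 - q k) * (C' * M1 powr q k) / (\<omega> * \<rho> ^ DIM('a)))"
      using mor[OF q(2) K False, of k] unfolding \<rho>_def[symmetric] .
    also note step
    also have "4 * 2 ^ DIM('a) * \<rho> * ((M1 + M1 * C' / \<omega>) * \<rho> powr (-1/2))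
        = 4 * 2 ^ DIM('a) * (M1 + M1 * C' / \<omega>) * (\<rho> * \<rho> powr (-1/2))"
      by (simp only: mult_ac)
    finally show ?thesis unfolding sq unfolding \<rho>_def .
  qed simp
  define S where "S = closure \<Omega>"
  have S: "compact S" using \<Omega>(1) by (simp add: S_def)
  obtain r where r: "\<And>x. x \<in> \<Omega> \<Longrightarrow> norm x \<le> r" using \<Omega>(1) by (auto simp: bounded_iff)
  define D where "D = 2 * \<bar>r\<bar> + 1"
  have D: "D > 0" by (simp add: D_def)
  define H where "H = 4 * 2 ^ DIM('a) * D * (M1 + M1 * C' / (\<omega> * D ^ DIM('a)))"
  have H0: "H \<ge> 0" using D M1 C' \<omega> by (simp add: H_def add_nonneg_nonneg)
  have bd: "\<bar>V k x\<bar> \<le> H" for k x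
  proof (cases "x \<in> \<Omega>")
    case True
    obtain y where y: "y \<notin> \<Omega>" and d: "dist x y = D"
      by (rule exists_point_outside[of \<Omega> r x D]) (use r True in \<open>auto simp: D_def\<close>)
    have "V k y = 0" by (rule V(2)[OF y])
    moreover have "x \<noteq> y" using d D by auto
    ultimately show ?thesis using mor[OF q(2) M1(2), of x y k] d M1q[of k] by (simp add: H_def)
  next
    case False
    then show ?thesis using V(2)[of x k] H0 by simp
  qed
  have "\<exists>g \<kappa>. continuous_on S g \<and> strict_mono (\<kappa> :: nat \<Rightarrow> nat) \<and>
      (\<forall>e>0. \<exists>N. \<forall>n x. n \<ge> N \<and> x \<in> S \<longrightarrow> norm (V (\<kappa> n) x - g x) < e)"
  proof (rule Arzela_Ascoli[OF S])
    show "norm (V n x) \<le> H" for n x using bd by simp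
    show "\<exists>d>0. \<forall>n y. y \<in> S \<and> norm (x - y) < d \<longrightarrow> norm (V n x - V n y) < e" if "e > 0" for x e
    proof -
      define L where "L = 4 * 2 ^ DIM('a) * (M1 + M1 * C' / \<omega>)"
      have L: "L > 0" using M1 C' \<omega> by (simp add: L_def add_pos_pos)
      define d where "d = min 1 ((e / (2 * L))\<^sup>2)"
      have "d > 0" using L that by (simp add: d_def)
      moreover have "norm (V n x - V n y) < e" if y: "norm (x - y) < d" for n y
      proof -
        have "sqrt (dist x y) \<le> sqrt ((e / (2 * L))\<^sup>2)"
          using y by (simp add: d_def dist_norm del: real_sqrt_abs)
        also have "\<dots> = e / (2 * L)" using L \<open>e > 0\<close> by simp
        finally have "L * sqrt (dist x y) \<le> L * (e / (2 * L))" using L by (intro mult_left_mono) auto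
        also have "\<dots> = e / 2" using L by simp
        also have "\<dots> < e" using \<open>e > 0\<close> by simp
        finally have "L * sqrt (dist x y) < e" .
        moreover have "\<bar>V n x - V n y\<bar> \<le> L * sqrt (dist x y)"
          unfolding L_def using y by (intro equi) (simp add: d_def dist_norm)
        ultimately show ?thesis by simp
      qed
      ultimately show ?thesis by blast
    qed
  qed blast
  then obtain g \<kappa> where \<kappa>: "strict_mono (\<kappa> :: nat \<Rightarrow> nat)"
    and g: "\<And>e. e > 0 \<Longrightarrow> \<exists>N. \<forall>n x. n \<ge> N \<and> x \<in> S \<longrightarrow> norm (V (\<kappa> n) x - g x) < e" by blast
  \<comment> \<open>All \<open>V k\<close> vanish outside \<open>\<Omega>\<close>, so convergence on
    the closure extends to uniform convergence on the whole space after this redefinition.\<close>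
  define X where "X x = (if x \<in> \<Omega> then g x else 0)" for x
  have ul: "uniform_limit UNIV (\<lambda>k. V (\<kappa> k)) X sequentially"
  proof (rule uniform_limitI)
    fix e :: real assume "e > 0"
    then obtain N where N: "\<And>n x. n \<ge> N \<Longrightarrow> x \<in> S \<Longrightarrow> norm (V (\<kappa> n) x - g x) < e" using g by blast
    have "dist (V (\<kappa> n) x) (X x) < e" if "n \<ge> N" for n x
      using N[OF that, of x] V(2)[of x] \<open>e > 0\<close> closure_subset[of \<Omega>]
      by (cases "x \<in> \<Omega>") (auto simp: X_def S_def dist_norm)
    then show "\<forall>\<^sub>F n in sequentially. \<forall>x\<in>UNIV. dist (V (\<kappa> n) x) (X x) < e"
      unfolding eventually_sequentially by blast
  qed
  have cX: "continuous_on UNIV X"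
    by (rule uniform_limit_theorem[OF _ ul]) (simp_all add: V(1))
  have "\<Lambda>-lipschitz_on UNIV X"
  proof (rule lipschitz_of_translation_bounds[OF \<Lambda> _ cX])
    show "continuous_on UNIV (V (\<kappa> n))" for n by (rule V(1))
    show "(\<lambda>n. V (\<kappa> n) x) \<longlonglongrightarrow> X x" for x by (rule tendsto_uniform_limitI[OF ul]) simp
    fix M assume M: "M > \<Lambda>"
    \<comment> \<open>The energies are controlled at level \<open>M'\<close> while the threshold is
      \<open>M\<close>; the strict gap between them makes the error term disappear.\<close>
    then obtain M' where M': "\<Lambda> < M'" "M' < M" using dense by blast
    have pos: "M' > 0" "M > 0" using M' \<Lambda> by linarith+
    define \<tau> where "\<tau> n = n0 + \<kappa> n" for n
    have \<tau>: "filterlim \<tau> at_top sequentially"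
      unfolding \<tau>_def using filterlim_subseq[OF \<kappa>] by (simp add: filterlim_at_top_add_at_top filterlim_tendsto_add_at_top
          filterlim_at_top_mono[of \<kappa>])
    have qlim: "filterlim (\<lambda>n. q (\<kappa> n)) at_top sequentially"
      unfolding q_def using filterlim_compose[OF p \<tau>] by (simp add: \<tau>_def)
    let ?e = "\<lambda>n. M powr (1 - q (\<kappa> n)) * (C' * M' powr q (\<kappa> n))"
    have "?e \<longlonglongrightarrow> 0" by (rule threshold_tendsto_0[OF pos(1) M'(2) qlim])
    moreover have "\<forall>\<^sub>F n in sequentially. \<forall>B h. B \<in> sets borel \<longrightarrow>
      (\<integral>\<^sup>+x. indicator B x * ennreal \<bar>V (\<kappa> n) (x + h) - V (\<kappa> n) x\<bar> \<partial>lborel)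
        \<le> ennreal (norm h) * (ennreal M * emeasure lborel B + ennreal (?e n))"
      using eventually_compose_filterlim[OF energy'[OF M'(1)] \<tau>]
    proof eventually_elim
      case (elim n)
      then have "Lp_pow \<Omega> (q (\<kappa> n)) (G (\<kappa> n)) < ennreal (C' * M' powr q (\<kappa> n))"
        by (simp add: q_def G_def \<tau>_def)
      from tr[OF this pos(2)] show ?case using C' by (simp add: ennreal_mult)
    qed
    ultimately show "\<exists>e. e \<longlonglongrightarrow> 0 \<and> (\<forall>\<^sub>F n in sequentially. \<forall>B h. B \<in> sets borel \<longrightarrow>
      (\<integral>\<^sup>+x. indicator B x * ennreal \<bar>V (\<kappa> n) (x + h) - V (\<kappa> n) x\<bar> \<partial>lborel)
        \<le> ennreal (norm h) * (ennreal M * emeasure lborel B + ennreal (e n)))"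
      by (intro exI[of _ ?e]) simp
  qed
  moreover have "strict_mono (\<lambda>k. n0 + \<kappa> k)" using \<kappa> by (simp add: strict_mono_def)
  ultimately show ?thesis
    using that[of "\<lambda>k. n0 + \<kappa> k" "\<lambda>k. V (\<kappa> k)" X] V(1,3) ul by (simp add: X_def)
qed

section \<open>Hoelder bounds from the Gagliardo energy\<close>

lemma gagliardo_pow_ge:
  fixes w W :: "'a::euclidean_space \<Rightarrow> real"
  assumes \<Omega>: "open \<Omega>" and AE: "AE x in lebesgue_on \<Omega>. W x = w x"
    and B: "B1 \<subseteq> \<Omega>" "B2 \<subseteq> \<Omega>" "B1 \<in> sets borel" "B2 \<in> sets borel"
    and c: "\<And>x y. x \<in> B1 \<Longrightarrow> y \<in> B2 \<Longrightarrow>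
      c \<le> \<bar>W x - W y\<bar> powr p / norm (x - y) powr (real DIM('a) + t * p)"
  shows "ennreal c * emeasure lborel B2 * emeasure lborel B1 \<le> gagliardo_pow \<Omega> p t w"
proof -
  have AE': "AE x in lebesgue. x \<in> \<Omega> \<longrightarrow> W x = w x"
    using AE \<Omega> by (subst (asm) AE_restrict_space_iff) auto
  have e: "emeasure lebesgue B1 = emeasure lborel B1" "emeasure lebesgue B2 = emeasure lborel B2"
    using B by simp_all
  have "ennreal c * emeasure lborel B2 * emeasure lborel B1
      = (\<integral>\<^sup>+x. (ennreal c * emeasure lborel B2) * indicator B1 x \<partial>lebesgue)"
    using B by (subst nn_integral_cmult_indicator) (simp_all add: e)
  also have "\<dots> \<le> gagliardo_pow \<Omega> p t w"
    unfolding gagliardo_pow_def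
  \<comment> \<open>The null set where \<open>W\<close> and \<open>w\<close> differ is discarded in
    one variable at a time, first for \<open>x\<close> and then for \<open>y\<close> inside, so no
    null set of the product space has to be discussed.\<close>
  proof (rule nn_integral_mono_AE)
    show "AE x in lebesgue. (ennreal c * emeasure lborel B2) * indicator B1 x
      \<le> (\<integral>\<^sup>+y. ennreal (\<bar>indicator \<Omega> x * w x - indicator \<Omega> y * w y\<bar> powr p
                        / norm (x - y) powr (real DIM('a) + t * p)) \<partial>lebesgue)"
      using AE'
    proof eventually_elim
      case (elim x)
      show ?case
      proof (cases "x \<in> B1")
        case True
        then have x: "x \<in> \<Omega>" "w x = W x" using B(1) elim by auto
        have "ennreal c * emeasure lborel B2 = (\<integral>\<^sup>+y. ennreal c * indicator B2 y \<partial>lebesgue)"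
          using B by (subst nn_integral_cmult_indicator) (simp_all add: e)
        also have "\<dots> \<le> (\<integral>\<^sup>+y. ennreal (\<bar>indicator \<Omega> x * w x - indicator \<Omega> y * w y\<bar> powr p
                        / norm (x - y) powr (real DIM('a) + t * p)) \<partial>lebesgue)"
        proof (rule nn_integral_mono_AE)
          show "AE y in lebesgue. ennreal c * indicator B2 y
            \<le> ennreal (\<bar>indicator \<Omega> x * w x - indicator \<Omega> y * w y\<bar> powr p
                        / norm (x - y) powr (real DIM('a) + t * p))"
            using AE'
          proof eventually_elim
            case (elim y)
            show ?case
            proof (cases "y \<in> B2")
              case y2: True
              then have y: "y \<in> \<Omega>" "w y = W y" using B(2) elim by auto
              show ?thesis using c[OF True y2] x y y2 by (simp add: ennreal_leI)
            qed simp
          qed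
        qed
        finally show ?thesis using True by simp
      qed simp
    qed
  qed
  finally show ?thesis .
qed

text \<open>A violation at one pair of points persists, by continuity and uniform convergence, on a
  product of two small balls. There the integrand is at least \<open>M powr p n\<close> up to a
  factor independent of \<open>n\<close>, since the dimensional part of the kernel does not involve
  \<open>p\<close>; this outgrows \<open>C * M' powr p n\<close>.\<close>

lemma holder_of_gagliardo_bounds:
  fixes w W :: "nat \<Rightarrow> 'a::euclidean_space \<Rightarrow> real"
  assumes \<Omega>: "open \<Omega>" and cX: "continuous_on UNIV X" and ul: "uniform_limit UNIV W X sequentially"
    and AE: "\<And>n. AE x in lebesgue_on \<Omega>. W n x = w n x"
    and p: "filterlim p at_top sequentially" and \<Lambda>: "\<Lambda> \<ge> 0" and t: "t > 0"
    and energy: "\<And>M. M > \<Lambda> \<Longrightarrow> \<forall>\<^sub>F n in sequentially. gagliardo_pow \<Omega> (p n) t (w n) \<le> ennreal (C * M powr p n)"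
    and xy: "x \<in> \<Omega>" "y \<in> \<Omega>" "x \<noteq> y"
  shows "\<bar>X x - X y\<bar> \<le> \<Lambda> * norm (x - y) powr t"
proof (rule le_of_forall_greater_mult)
  fix M assume "M > \<Lambda>"
  then obtain M' where M': "\<Lambda> < M'" "M' < M" using dense by blast
  have pos: "M' > 0" "M > 0" using M' \<Lambda> by linarith+
  show "\<bar>X x - X y\<bar> \<le> M * norm (x - y) powr t"
  proof (rule ccontr)
    assume neg: "\<not> \<bar>X x - X y\<bar> \<le> M * norm (x - y) powr t"
    define F where "F z = \<bar>X (fst z) - X (snd z)\<bar> - M * norm (fst z - snd z) powr t" for z :: "'a \<times> 'a"
    have cF: "continuous_on UNIV F"
      unfolding F_def [abs_def] using t
      by (intro continuous_intros continuous_on_compose2[OF cX] continuous_on_powr') auto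
    \<comment> \<open>A quarter of the excess: half of the excess survives on a neighbourhood, and
      passing from \<open>X\<close> to \<open>W n\<close> costs \<open>\<epsilon>\<close> at each of
      the two points.\<close>
    define \<epsilon> where "\<epsilon> = F (x, y) / 4"
    have \<epsilon>: "\<epsilon> > 0" using neg by (simp add: \<epsilon>_def F_def)
    have "open ({z. 2 * \<epsilon> < F z} \<inter> \<Omega> \<times> \<Omega>)"
      by (intro open_Int open_Collect_less continuous_intros cF open_Times \<Omega>)
    moreover have "(x, y) \<in> {z. 2 * \<epsilon> < F z} \<inter> \<Omega> \<times> \<Omega>" using \<epsilon> xy by (simp add: \<epsilon>_def)
    ultimately obtain A B where AB: "open A" "open B" "x \<in> A" "y \<in> B" "A \<times> B \<subseteq> {z. 2 * \<epsilon> < F z} \<inter> \<Omega> \<times> \<Omega>"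
      using open_prod_elim by (metis mem_Sigma_iff)
    obtain \<delta>1 \<delta>2 where \<delta>12: "\<delta>1 > 0" "ball x \<delta>1 \<subseteq> A" "\<delta>2 > 0" "ball y \<delta>2 \<subseteq> B"
      using AB openE by metis
    define \<delta> where "\<delta> = min \<delta>1 \<delta>2"
    have \<delta>: "\<delta> > 0" "ball x \<delta> \<subseteq> A" "ball y \<delta> \<subseteq> B"
      using \<delta>12 by (auto simp: \<delta>_def)
    define D where "D = norm (x - y) + 2 * \<delta>"
    have D: "D > 0" using \<delta> norm_ge_zero[of "x - y"] by (simp add: D_def add_nonneg_pos)
    define b where "b = unit_ball_vol (real DIM('a)) * \<delta> ^ DIM('a)"
    have b: "b > 0" "emeasure lborel (ball c \<delta>) = ennreal b" for c :: 'a
      using \<delta> by (simp_all add: b_def emeasure_ball)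
    \<comment> \<open>The measure of the product of the balls times the least value of the
      dimensional factor of the kernel on it, as \<open>D\<close> bounds all distances between the
      two balls.\<close>
    define \<kappa> where "\<kappa> = b * b / D powr real DIM('a)"
    have \<kappa>: "\<kappa> > 0" using b D by (simp add: \<kappa>_def)
    have "((\<lambda>n. C * (M' / M) powr p n) \<longlongrightarrow> C * 0) sequentially"
      using pos M' by (intro tendsto_mult tendsto_const powr_ratio_tendsto_0 p) auto
    then have "\<forall>\<^sub>F n in sequentially. C * (M' / M) powr p n < \<kappa>"
      by (rule order_tendstoD) (use \<kappa> in simp)
    moreover have "\<forall>\<^sub>F n in sequentially. \<forall>z\<in>UNIV. dist (W n z) (X z) < \<epsilon>"
      using uniform_limitD[OF ul \<epsilon>] .
    moreover have "\<forall>\<^sub>F n in sequentially. p n \<ge> 1" using p by (simp add: filterlim_at_top)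
    ultimately have "\<forall>\<^sub>F n in sequentially. False"
      using energy[OF M'(1)]
    proof eventually_elim
      case (elim n)
      have "ennreal (M powr p n / D powr real DIM('a)) * emeasure lborel (ball y \<delta>) * emeasure lborel (ball x \<delta>)
          \<le> gagliardo_pow \<Omega> (p n) t (w n)"
      proof (rule gagliardo_pow_ge[OF \<Omega> AE])
        fix x' y' assume "x' \<in> ball x \<delta>" "y' \<in> ball y \<delta>"
        then have in': "x' \<in> ball x \<delta>" "y' \<in> ball y \<delta>" and "(x', y') \<in> A \<times> B" using \<delta> by auto
        then have F: "2 * \<epsilon> < F (x', y')" using AB(5) by blast
        define d where "d = norm (x' - y')"
        have "x' \<noteq> y'" using F \<epsilon> by (auto simp: F_def)
        then have d: "d > 0" by (simp add: d_def)
        have "dist x' y' \<le> dist x' x + dist x y + dist y y'"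
          using dist_triangle[of x' y' x] dist_triangle[of x y' y] by linarith
        then have dD: "d \<le> D" using in' by (simp add: d_def D_def dist_norm norm_minus_commute)
        have "dist (W n x') (X x') < \<epsilon>" "dist (W n y') (X y') < \<epsilon>" using elim by auto
        then have "M * d powr t \<le> \<bar>W n x' - W n y'\<bar>"
          using F unfolding F_def dist_real_def d_def by (simp only: fst_conv snd_conv)
        then have "(M * d powr t) powr p n \<le> \<bar>W n x' - W n y'\<bar> powr p n"
          using elim pos by (intro powr_mono2) auto
        then have "(M * d powr t) powr p n / d powr (real DIM('a) + t * p n)
            \<le> \<bar>W n x' - W n y'\<bar> powr p n / d powr (real DIM('a) + t * p n)"
          by (rule divide_right_mono) simp
        moreover have "(M * d powr t) powr p n / d powr (real DIM('a) + t * p n) = M powr p n / d powr real DIM('a)"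
          using d by (simp add: powr_mult powr_powr powr_add)
        moreover have "M powr p n / D powr real DIM('a) \<le> M powr p n / d powr real DIM('a)"
          using d dD by (intro divide_left_mono powr_mono2) auto
        ultimately show "M powr p n / D powr real DIM('a)
            \<le> \<bar>W n x' - W n y'\<bar> powr p n / norm (x' - y') powr (real DIM('a) + t * p n)"
          unfolding d_def by linarith
      next
        have "A \<times> B \<subseteq> \<Omega> \<times> \<Omega>" using AB by blast
        then show "ball x \<delta> \<subseteq> \<Omega>" "ball y \<delta> \<subseteq> \<Omega>" using \<delta> AB(3,4) by blast+
      qed auto
      also have "\<dots> \<le> ennreal (C * M' powr p n)" by (rule elim)
      finally have "ennreal (M powr p n * \<kappa>) \<le> ennreal (C * M' powr p n)"
        using b D by (simp add: \<kappa>_def ennreal_mult[symmetric] mult_ac)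
      then have "M powr p n * \<kappa> \<le> C * M' powr p n"
        using \<kappa> pos by (metis ennreal_le_iff2 mult_pos_pos not_less powr_gt_zero less_imp_neq)
      then have "\<kappa> \<le> C * (M' / M) powr p n"
        using pos by (simp add: powr_divide field_simps)
      then show ?case using elim by linarith
    qed
    then show False by simp
  qed
qed simp

section \<open>Elements of \<open>W01inf\<close> as global Lipschitz functions\<close>

lemma continuous_AE_eq_imp_eq:
  fixes f g :: "'a::euclidean_space \<Rightarrow> real"
  assumes \<Omega>: "open \<Omega>" and c: "continuous_on \<Omega> f" "continuous_on \<Omega> g"
    and AE: "AE x in lebesgue_on \<Omega>. f x = g x" and x: "x \<in> \<Omega>"
  shows "f x = g x"
proof (rule ccontr)
  assume ne: "f x \<noteq> g x"
  define U where "U = \<Omega> \<inter> (\<lambda>x. f x - g x) -` (- {0})"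
  have U: "open U" unfolding U_def
    by (intro continuous_open_preimage continuous_intros c \<Omega>)
  have "AE x in lebesgue. x \<in> \<Omega> \<longrightarrow> f x = g x"
    using AE \<Omega> by (subst (asm) AE_restrict_space_iff) auto
  then have "AE x in lebesgue. x \<notin> U" by eventually_elim (simp add: U_def)
  then have "U \<in> null_sets lebesgue" using U by (subst (asm) AE_iff_null_sets[symmetric]) auto
  then have "negligible U" by (simp add: negligible_iff_null_sets)
  moreover have "x \<in> U" using x ne by (simp add: U_def)
  ultimately show False using open_not_negligible[OF U] by blast
qed

text \<open>A gradient bound alone controls \<open>w\<close> only along paths inside
  \<open>\<Omega>\<close>. Membership in the closures of the test functions makes
  \<open>W01p_compactness\<close> applicable to the constant sequence \<open>w\<close>; the limit is
  Lipschitz on all of space with constant \<open>L\<close>, and continuity identifies it with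
  \<open>w\<close> on \<open>\<Omega>\<close>.\<close>

lemma W01inf_lipschitz_extension:
  fixes w :: "'a::euclidean_space \<Rightarrow> real"
  assumes \<Omega>: "bounded \<Omega>" "open \<Omega>" and w: "w \<in> W01inf \<Omega>"
    and L: "Linf_norm \<Omega> (weak_gradient \<Omega> w) \<le> ennreal L" "L \<ge> 0"
  obtains W where "L-lipschitz_on UNIV W" "\<And>x. x \<notin> \<Omega> \<Longrightarrow> W x = 0" "\<And>x. x \<in> \<Omega> \<Longrightarrow> W x = w x"
proof -
  have \<Omega>s: "\<Omega> \<in> sets lebesgue" using \<Omega> by simp
  have \<Omega>fin: "emeasure (lebesgue_on \<Omega>) \<Omega> < \<infinity>" using emeasure_lebesgue_on_bounded[OF \<Omega>(1) \<Omega>s] by simp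
  define C where "C = enn2real (emeasure (lebesgue_on \<Omega>) \<Omega>) + 1"
  have C: "C > 0" "emeasure (lebesgue_on \<Omega>) \<Omega> \<le> ennreal C"
  proof -
    have "emeasure (lebesgue_on \<Omega>) \<Omega> = ennreal (enn2real (emeasure (lebesgue_on \<Omega>) \<Omega>))" using \<Omega>fin by simp
    also have "\<dots> \<le> ennreal C" by (intro ennreal_leI) (simp add: C_def)
    finally show "emeasure (lebesgue_on \<Omega>) \<Omega> \<le> ennreal C" .
  qed (simp add: C_def add_nonneg_pos)
  define p where "p n = real n + 1" for n :: nat
  have grad: "AE x in lebesgue_on \<Omega>. norm (weak_gradient \<Omega> w x) \<le> L"
    using L by (rule AE_norm_le_of_Linf_norm)
  have "\<exists>\<sigma> W X. strict_mono (\<sigma> :: nat \<Rightarrow> nat) \<and> (\<forall>k. continuous_on UNIV (W k)) \<and>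
    (\<forall>k::nat. AE x in lebesgue_on \<Omega>. W k x = w x) \<and> uniform_limit UNIV W X sequentially \<and>
    L-lipschitz_on UNIV X \<and> (\<forall>x. x \<notin> \<Omega> \<longrightarrow> X x = 0)"
  proof (rule W01p_compactness[OF \<Omega>, of "\<lambda>n. w" p L C])
    show "w \<in> W01p \<Omega> (p n)" for n using w by (simp add: W01inf_def p_def)
    show "filterlim p at_top sequentially"
      unfolding p_def by (intro filterlim_tendsto_add_at_top filterlim_real_sequentially
          filterlim_at_top_mono[OF filterlim_real_sequentially] always_eventually) auto
    show "\<forall>\<^sub>F n in sequentially. Lp_pow \<Omega> (p n) (weak_gradient \<Omega> w) \<le> ennreal (C * M powr p n)"
      if M: "M > L" for M
    proof (rule always_eventually, rule allI)
      fix n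
      have "Lp_pow \<Omega> (p n) (weak_gradient \<Omega> w) \<le> ennreal (L powr p n) * emeasure (lebesgue_on \<Omega>) \<Omega>"
        by (rule Lp_pow_le_of_AE_bound[OF grad]) (simp add: p_def)
      also have "\<dots> \<le> ennreal (M powr p n) * ennreal C"
        using M L(2) C by (intro mult_mono ennreal_leI powr_mono2) (auto simp: p_def)
      finally show "Lp_pow \<Omega> (p n) (weak_gradient \<Omega> w) \<le> ennreal (C * M powr p n)"
        using C by (simp add: ennreal_mult[symmetric] mult.commute)
    qed
  qed (use L C in blast)+
  then obtain W :: "nat \<Rightarrow> 'a \<Rightarrow> real" and X where W: "\<And>k. continuous_on UNIV (W k)"
    "\<And>k. AE x in lebesgue_on \<Omega>. W k x = w x"
    and ul: "uniform_limit UNIV W X sequentially" and X: "L-lipschitz_on UNIV X" "\<And>x. x \<notin> \<Omega> \<Longrightarrow> X x = 0"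
    by blast
  have cw: "continuous_on \<Omega> w" using w by (simp add: W01inf_def)
  have "X x = w x" if x: "x \<in> \<Omega>" for x
  proof -
    have "W k x = w x" for k
      by (rule continuous_AE_eq_imp_eq[OF \<Omega>(2) continuous_on_subset[OF W(1)] cw W(2) x]) simp
    moreover have "(\<lambda>k. W k x) \<longlonglongrightarrow> X x" by (rule tendsto_uniform_limitI[OF ul]) simp
    ultimately show ?thesis by (simp add: LIMSEQ_const_iff)
  qed
  then show ?thesis using that X by blast
qed

section \<open>The lower bound for the limiting functional\<close>

lemma holder_seminorm_le_iff:
  assumes "H \<ge> 0"
  shows "holder_seminorm \<Omega> t w \<le> ennreal H \<longleftrightarrow>
    (\<forall>x\<in>\<Omega>. \<forall>y\<in>\<Omega>. x \<noteq> y \<longrightarrow> \<bar>w x - w y\<bar> \<le> H * norm (x - y) powr t)"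
proof -
  have "holder_seminorm \<Omega> t w \<le> ennreal H \<longleftrightarrow>
    (\<forall>x\<in>\<Omega>. \<forall>y\<in>\<Omega>. x \<noteq> y \<longrightarrow> ennreal (\<bar>w x - w y\<bar> / norm (x - y) powr t) \<le> ennreal H)"
    unfolding holder_seminorm_def SUP_le_iff by auto
  moreover have "ennreal (\<bar>w x - w y\<bar> / norm (x - y) powr t) \<le> ennreal H \<longleftrightarrow> \<bar>w x - w y\<bar> \<le> H * norm (x - y) powr t"
    if "x \<noteq> y" for x y
    using that assms by (simp add: ennreal_le_iff divide_le_eq)
  ultimately show ?thesis by simp
qed

text \<open>Both bounds compare \<open>x\<close> with a nearest boundary point. The Lipschitz
  extension can be evaluated there directly; the Hoelder seminorm sees only pairs inside
  \<open>\<Omega>\<close>, so the boundary point is approached by a sequence from inside and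
  continuity of the extension closes the gap.\<close>

lemma W01inf_boundary_decay:
  fixes w :: "'a::euclidean_space \<Rightarrow> real"
  assumes \<Omega>: "bounded \<Omega>" "open \<Omega>" and w: "w \<in> W01inf \<Omega>"
    and L: "Linf_norm \<Omega> (weak_gradient \<Omega> w) \<le> ennreal L" "holder_seminorm \<Omega> t w \<le> ennreal L" "L \<ge> 0"
    and t: "t > 0" and x: "x \<in> \<Omega>"
  shows "\<bar>w x\<bar> \<le> L * infdist x (frontier \<Omega>)" "\<bar>w x\<bar> \<le> L * infdist x (frontier \<Omega>) powr t"
proof -
  obtain W where W: "L-lipschitz_on UNIV W" "\<And>x. x \<notin> \<Omega> \<Longrightarrow> W x = 0" "\<And>x. x \<in> \<Omega> \<Longrightarrow> W x = w x"
    by (rule W01inf_lipschitz_extension[OF \<Omega> w L(1,3)]) (rule that, assumption, simp_all)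
  have "\<Omega> \<noteq> UNIV" using \<Omega>(1) not_bounded_UNIV by blast
  then have "frontier \<Omega> \<noteq> {}" using x by (auto simp: frontier_eq_empty)
  then obtain y where y: "y \<in> frontier \<Omega>" "infdist x (frontier \<Omega>) = dist x y"
    using infdist_attains_inf[OF frontier_closed] by metis
  have "y \<notin> \<Omega>" using y(1) \<Omega>(2) by (simp add: frontier_def interior_open)
  then have Wy: "W y = 0" by (rule W(2))
  then show "\<bar>w x\<bar> \<le> L * infdist x (frontier \<Omega>)"
    using lipschitz_onD[OF W(1), of x y] W(3)[OF x] y(2) by (simp add: dist_real_def)
  have "y \<in> closure \<Omega>" using y(1) by (simp add: frontier_def)
  then obtain f where f: "\<And>n. f n \<in> \<Omega>" "f \<longlonglongrightarrow> y" unfolding closure_sequential by blast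
  have cW: "continuous_on UNIV W" using W(1) by (rule lipschitz_on_continuous_on)
  have "(\<lambda>n. W (f n)) \<longlonglongrightarrow> W y"
    using cW f(2) by (simp add: continuous_on_eq_continuous_at isCont_tendsto_compose)
  then have 1: "(\<lambda>n. \<bar>W x - W (f n)\<bar>) \<longlonglongrightarrow> \<bar>W x - W y\<bar>" by (intro tendsto_intros)
  have 2: "(\<lambda>n. L * norm (x - f n) powr t) \<longlonglongrightarrow> L * norm (x - y) powr t"
    using t by (intro tendsto_mult tendsto_const tendsto_powr' tendsto_norm tendsto_diff f(2)) auto
  have "\<bar>W x - W y\<bar> \<le> L * norm (x - y) powr t"
  proof (rule tendsto_le[OF _ 2 1])
    have "\<bar>W x - W (f n)\<bar> \<le> L * norm (x - f n) powr t" for n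
    proof (cases "f n = x")
      case False
      then show ?thesis
        using L(2) f(1)[of n] x unfolding holder_seminorm_le_iff[OF L(3)] by (simp add: W(3))
    qed simp
    then show "\<forall>\<^sub>F n in sequentially. \<bar>W x - W (f n)\<bar> \<le> L * norm (x - f n) powr t" by simp
  qed simp
  then show "\<bar>w x\<bar> \<le> L * infdist x (frontier \<Omega>) powr t"
    using Wy W(3)[OF x] y(2) by (simp add: dist_norm)
qed

lemma W01inf_measurable:
  "w \<in> W01inf \<Omega> \<Longrightarrow> w \<in> borel_measurable (lebesgue_on \<Omega>)"
  by (simp add: W01inf_def W1inf_def Linf_space_def)

lemma powr_product_measurable:
  fixes w z :: "'a::euclidean_space \<Rightarrow> real"
  assumes "w \<in> borel_measurable M" "z \<in> borel_measurable M"
  shows "(\<lambda>x. \<bar>w x\<bar> powr a * \<bar>z x\<bar> powr b) \<in> borel_measurable M"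
  using assms by measurable

text \<open>With \<open>L\<close> the numerator, the two decay rates at depth at most
  \<open>R\<close> bound the product by \<open>L * R\<close> and by
  \<open>L * R powr \<kappa>\<close>; the weights \<open>\<Gamma>\<close> and
  \<open>1 - \<Gamma>\<close> add up to one, which leaves \<open>L\<close> to the first power. Each
  bound on the denominator gives one entry of the maximum.\<close>

lemma J_inf_lower_bound:
  fixes w z :: "'a::euclidean_space \<Rightarrow> real"
  assumes \<Omega>: "bounded \<Omega>" "open \<Omega>" and w: "w \<in> W01inf \<Omega>" and z: "z \<in> W01inf \<Omega>"
    and nz: "nonzero_product \<Omega> w z" and r: "0 < r" and s: "0 < s"
    and \<Gamma>: "0 < \<Gamma>" "\<Gamma> < 1" and R: "R > 0" "\<And>x. x \<in> \<Omega> \<Longrightarrow> infdist x (frontier \<Omega>) \<le> R"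
  shows "ennreal (max (1 / R) (1 / R powr (\<Gamma> * r + (1 - \<Gamma>) * s))) \<le> J_inf \<Omega> r s \<Gamma> w z"
proof -
  define \<pi> where "\<pi> x = \<bar>w x\<bar> powr \<Gamma> * \<bar>z x\<bar> powr (1 - \<Gamma>)" for x
  define S where "S = Linf_norm \<Omega> \<pi>"
  define m where "m = max (max (Linf_norm \<Omega> (weak_gradient \<Omega> w)) (holder_seminorm \<Omega> r w))
         (max (Linf_norm \<Omega> (weak_gradient \<Omega> z)) (holder_seminorm \<Omega> s z))"
  have J: "J_inf \<Omega> r s \<Gamma> w z = m / S" by (simp add: J_inf_def m_def S_def \<pi>_def [abs_def])
  have \<pi>m: "\<pi> \<in> borel_measurable (lebesgue_on \<Omega>)"
    unfolding \<pi>_def [abs_def] by (rule powr_product_measurable) (simp_all add: W01inf_measurable w z)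
  have \<pi>0: "\<pi> x \<ge> 0" for x by (simp add: \<pi>_def)
  \<comment> \<open>The degenerate values of the denominator are excluded in advance: division by
    \<open>top\<close> in \<open>ennreal\<close> gives 0, even for an infinite numerator.\<close>
  have Sfin: "S < top"
  proof -
    define bw where "bw = enn2real (Linf_norm \<Omega> w)"
    define bz where "bz = enn2real (Linf_norm \<Omega> z)"
    have "Linf_norm \<Omega> w \<le> ennreal bw" "Linf_norm \<Omega> z \<le> ennreal bz"
      using w z by (simp_all add: bw_def bz_def W01inf_def W1inf_def Linf_space_def)
    from this[THEN AE_norm_le_of_Linf_norm]
    have "AE x in lebesgue_on \<Omega>. norm (w x) \<le> bw" "AE x in lebesgue_on \<Omega>. norm (z x) \<le> bz"
      by (simp_all add: bw_def bz_def)
    then have "AE x in lebesgue_on \<Omega>. norm (\<pi> x) \<le> bw powr \<Gamma> * bz powr (1 - \<Gamma>)"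
    proof eventually_elim
      case (elim x)
      then show ?case using \<Gamma> unfolding \<pi>_def by (simp add: abs_mult mult_mono powr_mono2)
    qed
    then have "S \<le> ennreal (bw powr \<Gamma> * bz powr (1 - \<Gamma>))" unfolding S_def by (rule Linf_norm_le[OF \<pi>m])
    then show ?thesis by (rule le_less_trans) simp
  qed
  have Spos: "S > 0"
  proof (rule ccontr)
    assume "\<not> S > 0"
    then have "Linf_norm \<Omega> \<pi> \<le> ennreal 0" by (simp add: S_def)
    then have "AE x in lebesgue_on \<Omega>. norm (\<pi> x) \<le> 0" by (rule AE_norm_le_of_Linf_norm) simp
    then have "AE x in lebesgue_on \<Omega>. w x * z x = 0"
    proof eventually_elim
      case (elim x)
      then have "\<pi> x = 0" by simp
      then show ?case by (simp add: \<pi>_def)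
    qed
    then show False using nz by (simp add: nonzero_product_def)
  qed
  show ?thesis
  proof (cases "m = top")
    case True
    then have "J_inf \<Omega> r s \<Gamma> w z = top" using Sfin by (simp add: J ennreal_top_divide)
    then show ?thesis by simp
  next
    case False
    define L where "L = enn2real m"
    have L: "m = ennreal L" "L \<ge> 0" using False by (simp_all add: L_def less_top)
    have mle: "Linf_norm \<Omega> (weak_gradient \<Omega> w) \<le> ennreal L" "holder_seminorm \<Omega> r w \<le> ennreal L"
      "Linf_norm \<Omega> (weak_gradient \<Omega> z) \<le> ennreal L" "holder_seminorm \<Omega> s z \<le> ennreal L"
      unfolding L(1)[symmetric] m_def by (simp_all add: le_max_iff_disj)
    define \<kappa> where "\<kappa> = \<Gamma> * r + (1 - \<Gamma>) * s"
    have \<kappa>: "\<kappa> > 0" using r s \<Gamma> by (simp add: \<kappa>_def add_pos_pos)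
    have LL: "L powr \<Gamma> * L powr (1 - \<Gamma>) = L" using L(2) by (cases "L = 0") (simp_all add: powr_add[symmetric])
    have \<pi>_le: "\<pi> x \<le> L * R" "\<pi> x \<le> L * R powr \<kappa>" if x: "x \<in> \<Omega>" for x
    proof -
      define d where "d = infdist x (frontier \<Omega>)"
      have d: "0 \<le> d" "d \<le> R" using R(2)[OF x] infdist_nonneg by (auto simp: d_def)
      note bw = W01inf_boundary_decay[OF \<Omega> w mle(1,2) L(2) r x, folded d_def]
      note bz = W01inf_boundary_decay[OF \<Omega> z mle(3,4) L(2) s x, folded d_def]
      have "\<pi> x \<le> (L * R) powr \<Gamma> * (L * R) powr (1 - \<Gamma>)"
      proof -
        have "L * d \<le> L * R" using d L(2) by (intro mult_left_mono)
        then have "\<bar>w x\<bar> \<le> L * R" "\<bar>z x\<bar> \<le> L * R" using bw(1) bz(1) by linarith+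
        then show ?thesis using \<Gamma> unfolding \<pi>_def by (intro mult_mono powr_mono2) auto
      qed
      also have "\<dots> = L * R" using L(2) R(1) by (cases "L = 0") (simp_all add: powr_add[symmetric])
      finally show "\<pi> x \<le> L * R" .
      have "\<pi> x \<le> (L * R powr r) powr \<Gamma> * (L * R powr s) powr (1 - \<Gamma>)"
      proof -
        have "L * d powr r \<le> L * R powr r" "L * d powr s \<le> L * R powr s"
          using d L(2) r s by (auto intro!: mult_left_mono powr_mono2)
        then have "\<bar>w x\<bar> \<le> L * R powr r" "\<bar>z x\<bar> \<le> L * R powr s" using bw(2) bz(2) by linarith+
        then show ?thesis using \<Gamma> unfolding \<pi>_def by (intro mult_mono powr_mono2) auto
      qed
      also have "\<dots> = (L powr \<Gamma> * L powr (1 - \<Gamma>)) * (R powr (r * \<Gamma>) * R powr (s * (1 - \<Gamma>)))"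
        by (simp add: powr_mult powr_powr)
      also have "\<dots> = L * R powr \<kappa>"
        unfolding LL by (simp add: powr_add[symmetric] \<kappa>_def mult.commute)
      finally show "\<pi> x \<le> L * R powr \<kappa>" .
    qed
    have main: "ennreal (1 / c) \<le> m / S" if c: "c > 0" "\<And>x. x \<in> \<Omega> \<Longrightarrow> \<pi> x \<le> L * c" for c
    proof -
      have "AE x in lebesgue_on \<Omega>. norm (\<pi> x) \<le> L * c"
        using c(2) \<pi>0 by (intro AE_I2) simp
      then have SL: "S \<le> ennreal (L * c)" unfolding S_def by (rule Linf_norm_le[OF \<pi>m])
      define \<sigma> where "\<sigma> = enn2real S"
      have \<sigma>: "S = ennreal \<sigma>" using Sfin by (simp add: \<sigma>_def less_top)
      have \<sigma>0: "\<sigma> > 0" using Spos unfolding \<sigma> by simp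
      have \<sigma>L: "\<sigma> \<le> L * c" using SL L(2) c(1) unfolding \<sigma> by (simp add: ennreal_le_iff)
      have "1 / c \<le> L / \<sigma>" using \<sigma>0 \<sigma>L c(1) by (simp add: field_simps)
      then show ?thesis unfolding \<sigma> L(1) using \<sigma>0 L(2) by (simp add: divide_ennreal ennreal_leI)
    qed
    have "ennreal (1 / R) \<le> m / S" by (rule main) (use R \<pi>_le in auto)
    moreover have "ennreal (1 / R powr \<kappa>) \<le> m / S" by (rule main) (use R \<pi>_le in auto)
    ultimately show ?thesis unfolding J \<kappa>_def[symmetric] by (simp add: max_def)
  qed
qed

section \<open>Energies of the cone over a largest inner ball\<close>

lemma exists_dyadic_shell:
  fixes h R :: real
  assumes "R > 0" "h \<ge> R"
  obtains k :: nat where "2 ^ k * R \<le> h" "h < 2 ^ Suc k * R"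
proof -
  obtain n where n: "h / R < 2 ^ n" using real_arch_pow[of 2 "h / R"] by auto
  define m where "m = (LEAST n. h < 2 ^ n * R)"
  have "h < 2 ^ n * R" using n assms by (simp add: divide_less_eq)
  then have m: "h < 2 ^ m * R" unfolding m_def by (rule LeastI)
  have "m \<noteq> 0" using m assms by (cases m) auto
  then obtain k where k: "m = Suc k" by (cases m) auto
  have "\<not> h < 2 ^ k * R" using not_less_Least[of k "\<lambda>n. h < 2 ^ n * R"] k by (simp add: m_def)
  then show ?thesis using that[of k] m k by simp
qed

text \<open>What is left of the Gagliardo kernel once the \<open>p\<close>-dependent factor is split
  off: on the dyadic shell starting at radius \<open>2 ^ k * R\<close> it decays like
  \<open>R ^ N / norm h ^ (2 * N)\<close>, with \<open>N\<close> the dimension. Summing over balls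
  instead of shells keeps the lower bound and reduces the integral to ball volumes.\<close>

definition shell_kernel :: "real \<Rightarrow> 'a::euclidean_space \<Rightarrow> ennreal" where
  "shell_kernel R h = (\<Sum>k. ennreal (1 / (R * 4 ^ k) ^ DIM('a)) * indicator (ball 0 (2 ^ Suc k * R)) h)"

lemma shell_kernel_measurable [measurable]:
  "(shell_kernel R :: 'a::euclidean_space \<Rightarrow> ennreal) \<in> borel_measurable borel"
proof -
  have [measurable]: "ball (0::'a) r \<in> sets borel" for r by simp
  show ?thesis unfolding shell_kernel_def [abs_def] by measurable
qed

lemma shell_kernel_ge: "ennreal (1 / (R * 4 ^ k) ^ DIM('a)) \<le> shell_kernel R (h :: 'a::euclidean_space)"
  if "norm h < 2 ^ Suc k * R"
proof -
  define f where "f j = ennreal (1 / (R * 4 ^ j) ^ DIM('a)) * indicator (ball 0 (2 ^ Suc j * R)) h" for j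
  have "sum f {k} \<le> suminf f" by (rule sum_le_suminf) auto
  then have "f k \<le> suminf f" by simp
  moreover have "f k = ennreal (1 / (R * 4 ^ k) ^ DIM('a))" using that by (simp add: f_def)
  moreover have "shell_kernel R h = suminf f" by (simp only: shell_kernel_def f_def [abs_def])
  ultimately show ?thesis by simp
qed

text \<open>The volumes grow like \<open>2 ^ (k * N)\<close> against weights
  \<open>4 ^ (- k * N)\<close>. The remaining ratio is at most \<open>(1/2) ^ k\<close> as
  \<open>N\<close> is at least 1, and the geometric series gives the last factor 2. The bound
  involves neither \<open>R\<close> nor any exponent.\<close>

lemma nn_integral_shell_kernel:
  assumes R: "R > 0"
  shows "(\<integral>\<^sup>+h. shell_kernel R (h :: 'a::euclidean_space) \<partial>lborel) \<le> ennreal (unit_ball_vol (real DIM('a)) * 2 ^ DIM('a) * 2)"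
proof -
  let ?N = "DIM('a)" and ?\<omega> = "unit_ball_vol (real DIM('a))"
  have "(\<integral>\<^sup>+h. shell_kernel R (h :: 'a) \<partial>lborel)
      = (\<Sum>k. \<integral>\<^sup>+h. ennreal (1 / (R * 4 ^ k) ^ ?N) * indicator (ball (0::'a) (2 ^ Suc k * R)) h \<partial>lborel)"
    unfolding shell_kernel_def
    by (rule nn_integral_suminf) (intro borel_measurable_times_ennreal borel_measurable_const borel_measurable_indicator, simp)
  also have "\<dots> \<le> (\<Sum>k. ennreal (?\<omega> * 2 ^ ?N * (1/2) ^ k))"
  proof (rule suminf_le)
    fix k :: nat
    have "(\<integral>\<^sup>+h. ennreal (1 / (R * 4 ^ k) ^ ?N) * indicator (ball (0::'a) (2 ^ Suc k * R)) h \<partial>lborel)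
        = ennreal (1 / (R * 4 ^ k) ^ ?N) * ennreal (?\<omega> * (2 ^ Suc k * R) ^ ?N)"
      using R by (subst nn_integral_cmult_indicator) (simp_all add: emeasure_ball)
    also have "\<dots> = ennreal (1 / (R * 4 ^ k) ^ ?N * (?\<omega> * (2 ^ Suc k * R) ^ ?N))"
      using R by (intro ennreal_mult[symmetric]) auto
    also have "1 / (R * 4 ^ k) ^ ?N * (?\<omega> * (2 ^ Suc k * R) ^ ?N) = ?\<omega> * ((2 ^ Suc k * R) / (R * 4 ^ k)) ^ ?N"
      by (simp only: power_divide) simp
    also have "(2 ^ Suc k * R) / (R * 4 ^ k) = 2 * (1/2) ^ k"
    proof -
      have "(4::real) ^ k = 2 ^ k * 2 ^ k" by (simp add: power_mult_distrib[symmetric])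
      then show ?thesis using R by (simp add: power_divide)
    qed
    also have "ennreal (?\<omega> * (2 * (1/2) ^ k) ^ ?N) \<le> ennreal (?\<omega> * 2 ^ ?N * (1/2) ^ k)"
    proof -
      have "((1/2::real) ^ k) ^ ?N \<le> ((1/2) ^ k) ^ 1"
        using DIM_positive[where 'a='a] by (intro power_decreasing) (simp_all add: power_le_one Suc_leI)
      then have "?\<omega> * (2 ^ ?N * ((1/2) ^ k) ^ ?N) \<le> ?\<omega> * (2 ^ ?N * (1/2) ^ k)"
        by (intro mult_left_mono) auto
      then show ?thesis by (intro ennreal_leI) (simp only: power_mult_distrib mult.assoc)
    qed
    finally show "(\<integral>\<^sup>+h. ennreal (1 / (R * 4 ^ k) ^ ?N) * indicator (ball (0::'a) (2 ^ Suc k * R)) h \<partial>lborel)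
        \<le> ennreal (?\<omega> * 2 ^ ?N * (1/2) ^ k)" .
  qed auto
  also have "\<dots> = ennreal (\<Sum>k. ?\<omega> * 2 ^ ?N * (1/2) ^ k)"
    by (intro suminf_ennreal2 summable_mult summable_geometric) auto
  also have "(\<Sum>k. ?\<omega> * 2 ^ ?N * (1/2) ^ k) = ?\<omega> * 2 ^ ?N * 2"
    by (subst suminf_mult) (simp_all add: summable_geometric suminf_geometric)
  finally show ?thesis .
qed

text \<open>Within distance \<open>R\<close> the Lipschitz bound is used, beyond it the bound by
  \<open>a\<close>. The two conditions on \<open>p\<close> make the exponents
  \<open>(1 - t) * p - N\<close> and \<open>t * p - N\<close> nonnegative, so the
  \<open>p\<close>-dependent power of the distance is extremal at \<open>R\<close> in both regimes
  and contributes the same factor \<open>(a / R powr t) powr p\<close>.\<close>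

lemma gagliardo_integrand_le:
  fixes f :: "'a::euclidean_space \<Rightarrow> real"
  assumes R: "R > 0" and a: "a \<ge> 0" and p: "real DIM('a) \<le> t * p" "real DIM('a) \<le> (1 - t) * p" "p > 0"
    and f1: "\<bar>f x - f y\<bar> \<le> a / R * norm (x - y)" and f2: "\<bar>f x - f y\<bar> \<le> a" and xy: "x \<noteq> y"
  shows "ennreal (\<bar>f x - f y\<bar> powr p / norm (x - y) powr (real DIM('a) + t * p))
    \<le> ennreal ((a / R powr t) powr p) * shell_kernel R (x - y)"
proof -
  let ?N = "real DIM('a)"
  define h where "h = norm (x - y)"
  have h: "h > 0" using xy by (simp add: h_def)
  have aR: "(a / R powr t) powr p = a powr p / R powr (t * p)" by (simp add: powr_divide powr_powr)
  have suff: ?thesis if "h < 2 ^ Suc k * R"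
    "\<bar>f x - f y\<bar> powr p / h powr (?N + t * p) \<le> (a / R powr t) powr p * (1 / (R * 4 ^ k) ^ DIM('a))" for k
  proof -
    have "ennreal (\<bar>f x - f y\<bar> powr p / h powr (?N + t * p))
        \<le> ennreal ((a / R powr t) powr p) * ennreal (1 / (R * 4 ^ k) ^ DIM('a))"
      using that(2) R by (subst ennreal_mult[symmetric]) (auto intro: ennreal_leI)
    also have "\<dots> \<le> ennreal ((a / R powr t) powr p) * shell_kernel R (x - y)"
      using that(1) by (intro mult_left_mono shell_kernel_ge) (simp_all add: h_def)
    finally show ?thesis by (simp only: h_def)
  qed
  show ?thesis
  proof (cases "h < R")
    case True
    show ?thesis
    proof (rule suff[of 0])
      show "h < 2 ^ Suc 0 * R" using True R by simp
      have "\<bar>f x - f y\<bar> powr p \<le> (a / R * h) powr p"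
        using f1 p(3) by (intro powr_mono2) (auto simp: h_def)
      also have "\<dots> = a powr p / R powr p * h powr p" by (simp add: powr_mult powr_divide)
      finally have "\<bar>f x - f y\<bar> powr p / h powr (?N + t * p) \<le> a powr p / R powr p * h powr p / h powr (?N + t * p)"
        by (intro divide_right_mono) auto
      also have "\<dots> = a powr p / R powr p * h powr ((1 - t) * p - ?N)"
        by (simp add: powr_diff powr_add left_diff_distrib)
      also have "\<dots> \<le> a powr p / R powr p * R powr ((1 - t) * p - ?N)"
        using True h p R by (intro mult_left_mono powr_mono2) auto
      also have "\<dots> = a powr p / R powr (t * p) * (1 / R powr ?N)"
        using R by (simp add: powr_diff powr_add left_diff_distrib)
      also have "\<dots> = (a / R powr t) powr p * (1 / (R * 4 ^ 0) ^ DIM('a))"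
        using R by (simp add: aR powr_realpow)
      finally show "\<bar>f x - f y\<bar> powr p / h powr (?N + t * p) \<le> (a / R powr t) powr p * (1 / (R * 4 ^ 0) ^ DIM('a))" .
    qed
  next
    case False
    then obtain k where k: "2 ^ k * R \<le> h" "h < 2 ^ Suc k * R" using exists_dyadic_shell[OF R, of h] by auto
    show ?thesis
    proof (rule suff[OF k(2)])
      have kR: "2 ^ k * R > 0" using R by simp
      have R4: "(R * 4 ^ k) ^ DIM('a) = (2 ^ k * R) powr (2 * ?N) / R powr ?N"
      proof -
        have "(2 ^ k * R) powr (2 * ?N) = ((2 ^ k * R) ^ DIM('a)) ^ 2"
          using powr_realpow[OF kR, of "2 * DIM('a)"] by (simp add: power_mult[symmetric] mult.commute)
        moreover have "R powr ?N = R ^ DIM('a)" using R by (rule powr_realpow)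
        moreover have "(4::real) ^ k = 2 ^ k * 2 ^ k" by (simp add: power_mult_distrib[symmetric])
        ultimately show ?thesis using R by (simp add: power_mult_distrib power2_eq_square)
      qed
      have "h powr (?N + t * p) = h powr (2 * ?N) * h powr (t * p - ?N)"
        by (simp add: powr_add[symmetric])
      also have "\<dots> \<ge> (2 ^ k * R) powr (2 * ?N) * R powr (t * p - ?N)"
        using k(1) kR R p False by (intro mult_mono powr_mono2) auto
      finally have hb: "(2 ^ k * R) powr (2 * ?N) * R powr (t * p - ?N) \<le> h powr (?N + t * p)" .
      have "\<bar>f x - f y\<bar> powr p / h powr (?N + t * p) \<le> a powr p / ((2 ^ k * R) powr (2 * ?N) * R powr (t * p - ?N))"
        using f2 p(3) h R hb by (intro frac_le powr_mono2) auto
      also have "\<dots> = (a / R powr t) powr p * (1 / (R * 4 ^ k) ^ DIM('a))"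
        unfolding R4 aR using R by (simp add: powr_diff)
      finally show "\<bar>f x - f y\<bar> powr p / h powr (?N + t * p) \<le> (a / R powr t) powr p * (1 / (R * 4 ^ k) ^ DIM('a))" .
    qed
  qed
qed

text \<open>The integrand vanishes unless \<open>x\<close> or \<open>y\<close> lies in the ball.
  Charging each pair to a point of the ball leaves the integral of the kernel over all of space in
  the other variable. Everything except the first factor is independent of \<open>p\<close>.\<close>

lemma gagliardo_pow_bump_le:
  fixes f :: "'a::euclidean_space \<Rightarrow> real"
  assumes R: "R > 0" and a: "a \<ge> 0" and p: "real DIM('a) \<le> t * p" "real DIM('a) \<le> (1 - t) * p" "p > 0"
    and f1: "\<And>x y. \<bar>f x - f y\<bar> \<le> a / R * norm (x - y)" and f2: "\<And>x y. \<bar>f x - f y\<bar> \<le> a"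
    and zero: "\<And>x. x \<notin> ball x0 R \<Longrightarrow> f x = 0" and sub: "ball x0 R \<subseteq> \<Omega>"
  shows "gagliardo_pow \<Omega> p t f \<le> ennreal ((a / R powr t) powr p) *
    (2 * ennreal (unit_ball_vol (real DIM('a)) * 2 ^ DIM('a) * 2) * emeasure lborel (ball x0 R))"
proof -
  let ?B = "ball x0 R" and ?c = "ennreal ((a / R powr t) powr p)"
    and ?V = "ennreal (unit_ball_vol (real DIM('a)) * 2 ^ DIM('a) * 2)"
  have [measurable]: "?B \<in> sets borel" by simp
  have ind: "indicator \<Omega> x * f x = f x" for x
  proof (cases "x \<in> \<Omega>")
    case False
    then have "x \<notin> ?B" using sub by blast
    then show ?thesis using zero by simp
  qed simp
  have kint: "(\<integral>\<^sup>+y. shell_kernel R (x - y) \<partial>lborel) \<le> ?V" for x :: 'a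
  proof -
    have "(\<integral>\<^sup>+y. shell_kernel R (x - y) \<partial>lborel) = (\<integral>\<^sup>+y. shell_kernel R y \<partial>distr lborel borel (\<lambda>y. x - y))"
      by (rule nn_integral_distr[symmetric]) measurable
    also have "\<dots> = (\<integral>\<^sup>+y. shell_kernel R (y :: 'a) \<partial>lborel)" by (simp add: lborel_distr_reflect)
    also have "\<dots> \<le> ?V" by (rule nn_integral_shell_kernel[OF R])
    finally show ?thesis .
  qed
  have kint': "(\<integral>\<^sup>+x. shell_kernel R (x - y) \<partial>lborel) \<le> ?V" for y :: 'a
  proof -
    have "(\<integral>\<^sup>+x. shell_kernel R (x - y) \<partial>lborel) = (\<integral>\<^sup>+x. shell_kernel R x \<partial>distr lborel borel (\<lambda>x. x + (- y)))"
      by (subst nn_integral_distr) simp_all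
    also have "\<dots> = (\<integral>\<^sup>+y. shell_kernel R (y :: 'a) \<partial>lborel)" by (simp only: lborel_distr_translate)
    also have "\<dots> \<le> ?V" by (rule nn_integral_shell_kernel[OF R])
    finally show ?thesis .
  qed
  have "gagliardo_pow \<Omega> p t f
      = (\<integral>\<^sup>+x. (\<integral>\<^sup>+y. ennreal (\<bar>f x - f y\<bar> powr p / norm (x - y) powr (real DIM('a) + t * p)) \<partial>lborel) \<partial>lborel)"
    by (simp only: gagliardo_pow_def ind nn_integral_completion)
  also have "\<dots> \<le> (\<integral>\<^sup>+x. (\<integral>\<^sup>+y. ?c * (indicator ?B x * shell_kernel R (x - y)) + ?c * (indicator ?B y * shell_kernel R (x - y)) \<partial>lborel) \<partial>lborel)"
  proof (intro nn_integral_mono)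
    fix x y
    show "ennreal (\<bar>f x - f y\<bar> powr p / norm (x - y) powr (real DIM('a) + t * p))
      \<le> ?c * (indicator ?B x * shell_kernel R (x - y)) + ?c * (indicator ?B y * shell_kernel R (x - y))"
    proof (cases "x = y \<or> (x \<notin> ?B \<and> y \<notin> ?B)")
      case True
      then have "f x - f y = 0" using zero by auto
      then show ?thesis by simp
    next
      case False
      then have "ennreal (\<bar>f x - f y\<bar> powr p / norm (x - y) powr (real DIM('a) + t * p)) \<le> ?c * shell_kernel R (x - y)"
        using f1 f2 by (intro gagliardo_integrand_le[OF R a p]) auto
      moreover have "?c * shell_kernel R (x - y)
        \<le> ?c * (indicator ?B x * shell_kernel R (x - y)) + ?c * (indicator ?B y * shell_kernel R (x - y))"
        using False by (cases "x \<in> ?B"; cases "y \<in> ?B") (auto intro: add_increasing2)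
      ultimately show ?thesis by (rule order_trans)
    qed
  qed
  also have "\<dots> = (\<integral>\<^sup>+x. ?c * (indicator ?B x * (\<integral>\<^sup>+y. shell_kernel R (x - y) \<partial>lborel)) \<partial>lborel)
      + (\<integral>\<^sup>+x. (\<integral>\<^sup>+y. ?c * (indicator ?B y * shell_kernel R (x - y)) \<partial>lborel) \<partial>lborel)"
    by (subst nn_integral_add[symmetric], measurable, intro nn_integral_cong,
        subst nn_integral_add, measurable, simp add: nn_integral_cmult)
  also have "(\<integral>\<^sup>+x. (\<integral>\<^sup>+y. ?c * (indicator ?B y * shell_kernel R (x - y)) \<partial>lborel) \<partial>lborel)
      = (\<integral>\<^sup>+y. (\<integral>\<^sup>+x. ?c * (indicator ?B y * shell_kernel R (x - y)) \<partial>lborel) \<partial>lborel)"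
    by (rule lborel_pair.Fubini'[symmetric]) measurable
  also have "\<dots> = (\<integral>\<^sup>+y. ?c * (indicator ?B y * (\<integral>\<^sup>+x. shell_kernel R (x - y) \<partial>lborel)) \<partial>lborel)"
    by (intro nn_integral_cong) (simp add: nn_integral_cmult)
  also have "(\<integral>\<^sup>+x. ?c * (indicator ?B x * (\<integral>\<^sup>+y. shell_kernel R (x - y) \<partial>lborel)) \<partial>lborel)
      + (\<integral>\<^sup>+y. ?c * (indicator ?B y * (\<integral>\<^sup>+x. shell_kernel R (x - y) \<partial>lborel)) \<partial>lborel)
      \<le> (\<integral>\<^sup>+x. (?c * ?V) * indicator ?B x \<partial>lborel) + (\<integral>\<^sup>+y. (?c * ?V) * indicator ?B y \<partial>lborel)"
  proof (intro add_mono nn_integral_mono)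
    fix x :: 'a
    show "?c * (indicator ?B x * (\<integral>\<^sup>+y. shell_kernel R (x - y) \<partial>lborel)) \<le> (?c * ?V) * indicator ?B x"
      using mult_left_mono[OF kint[of x], of ?c] by (cases "x \<in> ?B") simp_all
    show "?c * (indicator ?B x * (\<integral>\<^sup>+z. shell_kernel R (z - x) \<partial>lborel)) \<le> (?c * ?V) * indicator ?B x"
      using mult_left_mono[OF kint'[of x], of ?c] by (cases "x \<in> ?B") simp_all
  qed
  also have "\<dots> = 2 * ((?c * ?V) * emeasure lborel ?B)"
    by (simp only: nn_integral_cmult_indicator mult_2 sets_lborel borel_open open_ball)
  also have "\<dots> = ?c * (2 * ?V * emeasure lborel ?B)" by (simp only: mult_ac)
  finally show ?thesis .
qed

section \<open>The cone of height one: bounds, energies and coupling\<close>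

definition cone_fun :: "'a::euclidean_space \<Rightarrow> real \<Rightarrow> 'a \<Rightarrow> real" where
  "cone_fun x0 R x = max 0 (1 - dist x x0 / R)"

lemma cone_bounds:
  assumes "R > 0"
  shows "0 \<le> cone_fun x0 R x" "cone_fun x0 R x \<le> 1"
  using assms by (auto simp: cone_fun_def)

lemma cone_zero:
  assumes "R > 0" "x \<notin> ball x0 R"
  shows "cone_fun x0 R x = 0"
  using assms by (auto simp: cone_fun_def dist_commute)

lemma cone_ge:
  assumes "R > 0" "x \<in> ball x0 (R * (1 - \<theta>))"
  shows "\<theta> \<le> cone_fun x0 R x"
proof -
  have "dist x x0 / R \<le> 1 - \<theta>" using assms by (simp add: pos_divide_le_eq dist_commute mult.commute)
  then show ?thesis by (simp add: cone_fun_def)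
qed

lemma cone_lipschitz:
  assumes R: "R > 0"
  shows "\<bar>cone_fun x0 R x - cone_fun x0 R y\<bar> \<le> norm (x - y) / R"
proof -
  have "\<bar>cone_fun x0 R x - cone_fun x0 R y\<bar> \<le> \<bar>dist x x0 / R - dist y x0 / R\<bar>" by (auto simp: cone_fun_def max_def)
  also have "\<dots> = \<bar>dist x x0 - dist y x0\<bar> / R" using R by (simp add: diff_divide_distrib[symmetric])
  also have "\<dots> \<le> norm (x - y) / R"
  proof (rule divide_right_mono)
    show "\<bar>dist x x0 - dist y x0\<bar> \<le> norm (x - y)"
      using norm_triangle_ineq3[of "x - x0" "y - x0"] by (simp add: dist_norm)
  qed (use R in simp)
  finally show ?thesis .
qed

lemma scaled_cone:
  assumes R: "R > 0" and a: "a \<ge> 0"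
  shows "(a / R)-lipschitz_on UNIV (\<lambda>x. a * cone_fun x0 R x)"
    and "\<bar>a * cone_fun x0 R x - a * cone_fun x0 R y\<bar> \<le> a / R * norm (x - y)"
    and "\<bar>a * cone_fun x0 R x - a * cone_fun x0 R y\<bar> \<le> a"
proof -
  have *: "\<bar>a * cone_fun x0 R x - a * cone_fun x0 R y\<bar> \<le> a / R * norm (x - y)" for x y
    using mult_left_mono[OF cone_lipschitz[OF R, of x0 x y] a] a
    by (simp add: right_diff_distrib[symmetric] abs_mult)
  then show "\<bar>a * cone_fun x0 R x - a * cone_fun x0 R y\<bar> \<le> a / R * norm (x - y)" .
  show "(a / R)-lipschitz_on UNIV (\<lambda>x. a * cone_fun x0 R x)"
    using * R a by (intro lipschitz_onI) (simp_all add: dist_norm)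
  have "\<bar>cone_fun x0 R x - cone_fun x0 R y\<bar> \<le> 1"
    using cone_bounds[OF R, of x0 x] cone_bounds[OF R, of x0 y] by linarith
  from mult_left_mono[OF this a] show "\<bar>a * cone_fun x0 R x - a * cone_fun x0 R y\<bar> \<le> a"
    using a by (simp add: right_diff_distrib[symmetric] abs_mult)
qed

text \<open>The constant \<open>C\<close> is made of the measure of \<open>\<Omega>\<close>, the
  kernel integral and the volume of the ball. It is chosen before the height \<open>a\<close>, the
  exponents and \<open>l\<close>, so it is negligible under the \<open>p\<close>-th root.\<close>

lemma cone_energy:
  fixes \<Omega> :: "'a::euclidean_space set"
  assumes \<Omega>: "bounded \<Omega>" "open \<Omega>" and R: "R > 0" "ball x0 R \<subseteq> \<Omega>"
  obtains C where "C > 0" "\<And>a t p l. a \<ge> 0 \<Longrightarrow> p > 0 \<Longrightarrow> real DIM('a) \<le> t * p \<Longrightarrow> real DIM('a) \<le> (1 - t) * p \<Longrightarrow>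
    a / R \<le> l \<Longrightarrow> a / R powr t \<le> l \<Longrightarrow>
    Lp_pow \<Omega> p (weak_gradient \<Omega> (\<lambda>x. a * cone_fun x0 R x)) + gagliardo_pow \<Omega> p t (\<lambda>x. a * cone_fun x0 R x)
      \<le> ennreal (C * l powr p)"
proof -
  define m where "m = enn2real (emeasure (lebesgue_on \<Omega>) \<Omega>)"
  have "emeasure (lebesgue_on \<Omega>) \<Omega> < \<infinity>" using emeasure_lebesgue_on_bounded[OF \<Omega>(1)] \<Omega>(2) by simp
  then have m: "emeasure (lebesgue_on \<Omega>) \<Omega> = ennreal m" "m \<ge> 0" by (simp_all add: m_def)
  define b where "b = unit_ball_vol (real DIM('a)) * R ^ DIM('a)"
  have b: "emeasure lborel (ball x0 R) = ennreal b" "b > 0" using R by (simp_all add: b_def emeasure_ball)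
  define V where "V = unit_ball_vol (real DIM('a)) * 2 ^ DIM('a) * 2"
  have V: "V > 0" by (simp add: V_def)
  define C where "C = m + 2 * V * b"
  have C: "C > 0" using m b V by (simp add: C_def add_nonneg_pos)
  show ?thesis
  proof (rule that[OF C])
    fix a t p l :: real
    assume a: "a \<ge> 0" and p: "p > 0" "real DIM('a) \<le> t * p" "real DIM('a) \<le> (1 - t) * p"
      and l: "a / R \<le> l" "a / R powr t \<le> l"
    let ?f = "\<lambda>x. a * cone_fun x0 R x"
    have zero: "?f x = 0" if "x \<notin> ball x0 R" for x using cone_zero[OF R(1) that] by simp
    have zero': "?f x = 0" if "x \<notin> \<Omega>" for x using zero[of x] that R(2) by blast
    have "AE x in lebesgue_on \<Omega>. norm (weak_gradient \<Omega> ?f x) \<le> a / R"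
      by (rule lipschitz_imp_W01inf(2)[OF \<Omega> scaled_cone(1)[OF R(1) a] zero'])
    then have "Lp_pow \<Omega> p (weak_gradient \<Omega> ?f) \<le> ennreal ((a / R) powr p) * ennreal m"
      unfolding m(1)[symmetric] using p by (intro Lp_pow_le_of_AE_bound) auto
    also have "\<dots> \<le> ennreal (l powr p) * ennreal m"
      using l a R p by (intro mult_right_mono ennreal_leI powr_mono2) auto
    finally have 1: "Lp_pow \<Omega> p (weak_gradient \<Omega> ?f) \<le> ennreal (l powr p) * ennreal m" .
    have "gagliardo_pow \<Omega> p t ?f \<le> ennreal ((a / R powr t) powr p) * (2 * ennreal V * ennreal b)"
      unfolding V_def b(1)[symmetric]
      by (rule gagliardo_pow_bump_le[OF R(1) a p(2,3,1) scaled_cone(2,3)[OF R(1) a] zero R(2)])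
    also have "\<dots> \<le> ennreal (l powr p) * (2 * ennreal V * ennreal b)"
      using l a R p by (intro mult_right_mono ennreal_leI powr_mono2) auto
    also have "2 * ennreal V * ennreal b = ennreal (2 * V * b)"
      using V b by (simp add: ennreal_mult)
    finally have 2: "gagliardo_pow \<Omega> p t ?f \<le> ennreal (l powr p) * ennreal (2 * V * b)" .
    have "Lp_pow \<Omega> p (weak_gradient \<Omega> ?f) + gagliardo_pow \<Omega> p t ?f
        \<le> ennreal (l powr p) * ennreal m + ennreal (l powr p) * ennreal (2 * V * b)"
      using 1 2 by (rule add_mono)
    also have "\<dots> = ennreal (l powr p * m + l powr p * (2 * V * b))"
      using m V b by (simp add: ennreal_plus ennreal_mult)
    also have "l powr p * m + l powr p * (2 * V * b) = C * l powr p"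
      by (simp add: C_def algebra_simps)
    finally show "Lp_pow \<Omega> p (weak_gradient \<Omega> ?f) + gagliardo_pow \<Omega> p t ?f \<le> ennreal (C * l powr p)" .
  qed
qed

text \<open>The cone is at least \<open>\<theta>\<close> on the concentric ball of radius
  \<open>R * (1 - \<theta>)\<close>. The volume of that ball is negligible under the
  \<open>p\<close>-th root, so \<open>\<theta>\<close> close to 1 loses little.\<close>

lemma cone_coupling:
  fixes \<Omega> :: "'a::euclidean_space set"
  assumes \<Omega>: "open \<Omega>" and R: "R > 0" "ball x0 R \<subseteq> \<Omega>" and a: "a > 0" "b > 0"
    and \<theta>: "0 < \<theta>" "\<theta> < 1" and \<alpha>: "\<alpha> \<ge> 0" "\<beta> \<ge> 0"
  shows "ennreal (a powr \<alpha> * b powr \<beta> * \<theta> powr (\<alpha> + \<beta>) * (unit_ball_vol (real DIM('a)) * (R * (1 - \<theta>)) ^ DIM('a)))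
    \<le> coupling \<Omega> \<alpha> \<beta> (\<lambda>x. a * cone_fun x0 R x) (\<lambda>x. b * cone_fun x0 R x)"
proof -
  let ?B = "ball x0 (R * (1 - \<theta>))" and ?c = "a powr \<alpha> * b powr \<beta> * \<theta> powr (\<alpha> + \<beta>)"
  have R': "R * (1 - \<theta>) > 0" using R \<theta> by simp
  have "R * (1 - \<theta>) \<le> R * 1" using R \<theta> by (intro mult_left_mono) auto
  then have sub: "?B \<subseteq> \<Omega>" using R(2) subset_ball[of "R * (1 - \<theta>)" R x0] by auto
  have e: "emeasure lebesgue ?B = ennreal (unit_ball_vol (real DIM('a)) * (R * (1 - \<theta>)) ^ DIM('a))"
    using R' by (simp add: emeasure_ball)
  have "ennreal (?c * (unit_ball_vol (real DIM('a)) * (R * (1 - \<theta>)) ^ DIM('a)))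
      = ennreal ?c * emeasure lebesgue ?B"
    unfolding e using R' by (intro ennreal_mult) auto
  also have "\<dots> = (\<integral>\<^sup>+x. ennreal ?c * indicator ?B x \<partial>lebesgue)"
    by (rule nn_integral_cmult_indicator[symmetric]) simp
  also have "\<dots> \<le> (\<integral>\<^sup>+x. ennreal (\<bar>a * cone_fun x0 R x\<bar> powr \<alpha> * \<bar>b * cone_fun x0 R x\<bar> powr \<beta>) * indicator \<Omega> x \<partial>lebesgue)"
  proof (rule nn_integral_mono)
    fix x
    show "ennreal ?c * indicator ?B x \<le> ennreal (\<bar>a * cone_fun x0 R x\<bar> powr \<alpha> * \<bar>b * cone_fun x0 R x\<bar> powr \<beta>) * indicator \<Omega> x"
    proof (cases "x \<in> ?B")
      case True
      have c: "\<theta> \<le> cone_fun x0 R x" using cone_ge[OF R(1) True] .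
      then have c': "a * \<theta> \<le> \<bar>a * cone_fun x0 R x\<bar>" "b * \<theta> \<le> \<bar>b * cone_fun x0 R x\<bar>"
        using a \<theta> by (auto simp: abs_mult intro!: mult_mono)
      have "?c = (a * \<theta>) powr \<alpha> * (b * \<theta>) powr \<beta>" by (simp add: powr_mult powr_add)
      also have "\<dots> \<le> \<bar>a * cone_fun x0 R x\<bar> powr \<alpha> * \<bar>b * cone_fun x0 R x\<bar> powr \<beta>"
        using c' a \<theta> \<alpha> by (intro mult_mono powr_mono2) auto
      finally have "ennreal ?c \<le> ennreal (\<bar>a * cone_fun x0 R x\<bar> powr \<alpha> * \<bar>b * cone_fun x0 R x\<bar> powr \<beta>)"
        by (rule ennreal_leI)
      moreover have "x \<in> \<Omega>" using True sub by blast
      ultimately show ?thesis using True by simp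
    qed simp
  qed
  also have "\<dots> = coupling \<Omega> \<alpha> \<beta> (\<lambda>x. a * cone_fun x0 R x) (\<lambda>x. b * cone_fun x0 R x)"
    unfolding coupling_def using \<Omega> by (intro nn_integral_restrict_space[symmetric]) simp
  finally show ?thesis .
qed

section \<open>Upper bound for the minima\<close>

lemma ennreal_half: "(1 / 2 :: ennreal) = ennreal (1 / 2)"
  using divide_ennreal[of 1 2] by simp

lemma ennreal_quotient_le:
  fixes E K :: ennreal
  assumes "E \<le> ennreal e" "ennreal c \<le> K" "e \<ge> 0" "c > 0"
  shows "E / K \<le> ennreal (e / c)"
proof (cases "K = top")
  case False
  define k where "k = enn2real K"
  have k: "K = ennreal k" using False by (simp add: k_def less_top)
  have ck: "c \<le> k" using assms(2,4) unfolding k by (simp add: ennreal_le_iff2)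
  have "E / K \<le> ennreal e / ennreal k" unfolding k using assms(1) by (rule divide_right_mono_ennreal)
  also have "\<dots> = ennreal (e / k)" using assms ck by (intro divide_ennreal) auto
  also have "\<dots> \<le> ennreal (e / c)" using assms ck by (intro ennreal_leI divide_left_mono) auto
  finally show ?thesis .
qed simp

text \<open>Scaling the two cones by \<open>a = \<lambda> min R R\<^sup>r\<close> and \<open>b = \<lambda> min R R\<^sup>s\<close> makes the limits of the
  \<open>p\<close>-th roots of all four energy terms at most \<open>\<lambda>\<close>, with limiting coupling \<open>a\<^sup>\<Gamma> b\<^sup>1\<^sup>-\<^sup>\<Gamma> = 1\<close>.\<close>

lemma optimal_scaling:
  fixes R r s \<Gamma> :: real
  assumes R: "R > 0" and r: "0 < r" "r < 1" and s: "0 < s" "s < 1" and \<Gamma>: "0 < \<Gamma>" "\<Gamma> < 1"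
  defines "l \<equiv> max (1 / R) (1 / R powr (\<Gamma> * r + (1 - \<Gamma>) * s))"
  obtains a b where "a > 0" "b > 0" "a / R \<le> l" "a / R powr r \<le> l" "b / R \<le> l" "b / R powr s \<le> l"
    "a powr \<Gamma> * b powr (1 - \<Gamma>) = 1"
proof -
  define \<kappa> where "\<kappa> = \<Gamma> * r + (1 - \<Gamma>) * s"
  have \<kappa>1: "\<kappa> < 1"
  proof -
    have "\<Gamma> * r < \<Gamma> * 1" "(1 - \<Gamma>) * s < (1 - \<Gamma>) * 1"
      using r s \<Gamma> by (intro mult_strict_left_mono; simp)+
    then show ?thesis by (simp add: \<kappa>_def)
  qed
  have \<kappa>0: "\<kappa> > 0" using r s \<Gamma> by (simp add: \<kappa>_def add_pos_pos)
  show ?thesis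
  proof (cases "R \<le> 1")
    case True
    have ge: "R \<le> R powr t" if "t < 1" for t
      using powr_mono'[of t 1 R] True R that by simp
    have l: "l = 1 / R"
    proof -
      have "1 / R powr \<kappa> \<le> 1 / R" using ge[OF \<kappa>1] R by (intro frac_le) auto
      then show ?thesis unfolding l_def \<kappa>_def[symmetric] by (rule max_absorb1)
    qed
    \<comment> \<open>Here \<open>l = 1 / R\<close> and \<open>R \<le> R powr t\<close> for both
      orders, so the scalings \<open>l * R\<close> are 1.\<close>
    show ?thesis
      by (rule that[of 1 1]) (use R ge[OF r(2)] ge[OF s(2)] in \<open>simp_all add: l frac_le\<close>)
  next
    case False
    have le: "R powr t \<le> R" if "t < 1" for t
      using powr_mono[of t 1 R] False that by simp
    have l: "l = 1 / R powr \<kappa>"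
      unfolding l_def \<kappa>_def[symmetric] using le[OF \<kappa>1] R by (simp add: max_def frac_le)
    have l0: "l > 0" using R by (simp add: l)
    have *: "l * R powr t / R \<le> l" if "t < 1" for t
      using le[OF that] R l0 by (simp add: divide_le_eq)
    show ?thesis
    \<comment> \<open>For \<open>R > 1\<close> the smaller of \<open>R\<close> and
      \<open>R powr t\<close> is the latter; the Hoelder terms attain the level \<open>l\<close> and
      the gradient terms stay below it.\<close>
    proof (rule that[of "l * R powr r" "l * R powr s"])
      have "(l * R powr r) powr \<Gamma> * (l * R powr s) powr (1 - \<Gamma>)
          = (l powr \<Gamma> * l powr (1 - \<Gamma>)) * (R powr (r * \<Gamma>) * R powr (s * (1 - \<Gamma>)))"
        by (simp add: powr_mult powr_powr)
      also have "\<dots> = l * R powr \<kappa>"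
        using l0 by (simp add: powr_add[symmetric] \<kappa>_def mult.commute)
      also have "\<dots> = 1" using R by (simp add: l)
      finally show "(l * R powr r) powr \<Gamma> * (l * R powr s) powr (1 - \<Gamma>) = 1" .
    qed (use l0 R *[OF r(2)] *[OF s(2)] in simp_all)
  qed
qed

text \<open>Scaled cones compete in the minimum problem. The estimate is stated at every level
  strictly above the limit, so that all factors with \<open>p\<close>-th root tending to 1 can be
  absorbed.\<close>

lemma minimum_upper_bound:
  fixes \<Omega> :: "'a::euclidean_space set" and p \<alpha> \<beta> :: "nat \<Rightarrow> real"
  assumes \<Omega>: "bounded \<Omega>" "open \<Omega>" and R: "R > 0" "ball x0 R \<subseteq> \<Omega>"
    and r: "0 < r" "r < 1" and s: "0 < s" "s < 1" and \<Gamma>: "0 < \<Gamma>" "\<Gamma> < 1"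
    and p: "\<And>n. 1 < p n" "filterlim p at_top sequentially"
    and \<alpha>\<beta>: "\<And>n. 1 \<le> \<alpha> n" "\<And>n. 1 \<le> \<beta> n" "\<And>n. \<alpha> n + \<beta> n = p n"
    and lim: "(\<lambda>n. \<alpha> n / p n) \<longlonglongrightarrow> \<Gamma>" "(\<lambda>n. \<beta> n / p n) \<longlonglongrightarrow> 1 - \<Gamma>"
    and lam: "\<And>n. is_minimum (lam n) {J_fun \<Omega> r s (p n) (\<alpha> n) (\<beta> n) w z | w z.
            w \<in> W01p \<Omega> (p n) \<and> z \<in> W01p \<Omega> (p n) \<and> nonzero_product \<Omega> w z}"
    and M: "M > max (1 / R) (1 / R powr (\<Gamma> * r + (1 - \<Gamma>) * s))"
  shows "\<forall>\<^sub>F n in sequentially. lam n \<le> ennreal (M powr p n)"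
proof -
  define l where "l = max (1 / R) (1 / R powr (\<Gamma> * r + (1 - \<Gamma>) * s))"
  have l: "l > 0" using R by (simp add: l_def less_max_iff_disj)
  obtain a b where a: "a > 0" "a / R \<le> l" "a / R powr r \<le> l" and b: "b > 0" "b / R \<le> l" "b / R powr s \<le> l"
    and ab: "a powr \<Gamma> * b powr (1 - \<Gamma>) = 1"
    by (rule optimal_scaling[OF R(1) r s \<Gamma>, folded l_def]) (rule that; simp)
  obtain C where C: "C > 0" and energy: "\<And>a t p l. a \<ge> 0 \<Longrightarrow> p > 0 \<Longrightarrow> real DIM('a) \<le> t * p \<Longrightarrow> real DIM('a) \<le> (1 - t) * p \<Longrightarrow>
    a / R \<le> l \<Longrightarrow> a / R powr t \<le> l \<Longrightarrow>
    Lp_pow \<Omega> p (weak_gradient \<Omega> (\<lambda>x. a * cone_fun x0 R x)) + gagliardo_pow \<Omega> p t (\<lambda>x. a * cone_fun x0 R x)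
      \<le> ennreal (C * l powr p)"
    by (rule cone_energy[OF \<Omega> R]) (rule that; blast)
  let ?w = "\<lambda>x. a * cone_fun x0 R x" and ?z = "\<lambda>x. b * cone_fun x0 R x"
  have zero: "c * cone_fun x0 R x = 0" if "x \<notin> \<Omega>" for c x
  proof -
    have "x \<notin> ball x0 R" using that R(2) by blast
    then have "cone_fun x0 R x = 0" by (rule cone_zero[OF R(1)])
    then show ?thesis by simp
  qed
  have W: "?w \<in> W01p \<Omega> (p n)" "?z \<in> W01p \<Omega> (p n)" for n
    using lipschitz_imp_W01inf(4)[OF \<Omega> scaled_cone(1)[OF R(1)] zero] a(1) b(1) p(1)[of n] by auto
  have nz: "nonzero_product \<Omega> ?w ?z"
    unfolding nonzero_product_def
  proof
    assume AE: "AE x in lebesgue_on \<Omega>. ?w x * ?z x = 0"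
    have cont: "continuous_on \<Omega> (\<lambda>x. ?w x * ?z x)"
      unfolding cone_fun_def by (intro continuous_intros) (use R in auto)
    have "x0 \<in> \<Omega>" using R by auto
    from continuous_AE_eq_imp_eq[OF \<Omega>(2) cont continuous_on_const AE this]
    show False using a b by (simp add: cone_fun_def)
  qed
  \<comment> \<open>The distance from \<open>l\<close> to \<open>M\<close> is spent in three stages:
    \<open>M2\<close> pays for replacing the peak of the cone by the value \<open>\<theta>\<close>,
    \<open>M1\<close> for the deviation of \<open>\<alpha> n / p n\<close> and
    \<open>\<beta> n / p n\<close> from their limits, and the step from \<open>M1\<close> to
    \<open>M\<close> for the constant \<open>C / v\<close>.\<close>
  obtain M2 where M2: "l < M2" "M2 < M" using M dense unfolding l_def by blast
  obtain M1 where M1: "M2 < M1" "M1 < M" using M2 dense by blast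
  define \<theta> where "\<theta> = l / M2"
  have \<theta>: "0 < \<theta>" "\<theta> < 1" using l M2 by (auto simp: \<theta>_def)
  define v where "v = unit_ball_vol (real DIM('a)) * (R * (1 - \<theta>)) ^ DIM('a)"
  have v: "v > 0" using R \<theta> by (simp add: v_def)
  \<comment> \<open>The \<open>p n\<close>-th root of the amplitude factor in the coupling; it tends
    to \<open>a powr \<Gamma> * b powr (1 - \<Gamma>)\<close>, which is 1 by the choice of the
    scaling.\<close>
  define \<eta> where "\<eta> n = a powr (\<alpha> n / p n) * b powr (\<beta> n / p n)" for n
  have \<eta>0: "\<eta> n > 0" for n using a b by (simp add: \<eta>_def)
  have "\<eta> \<longlonglongrightarrow> a powr \<Gamma> * b powr (1 - \<Gamma>)"
    unfolding \<eta>_def using a b by (intro tendsto_mult tendsto_powr tendsto_const lim) auto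
  then have "(\<lambda>n. M2 / \<eta> n) \<longlonglongrightarrow> M2 / 1" unfolding ab by (intro tendsto_divide tendsto_const) auto
  then have e1: "\<forall>\<^sub>F n in sequentially. M2 / \<eta> n < M1" by (rule order_tendstoD) (use M1 in simp)
  have "(\<lambda>n. C / v * (M1 / M) powr p n) \<longlonglongrightarrow> C / v * 0"
    using M1 M2 l by (intro tendsto_mult tendsto_const powr_ratio_tendsto_0 p(2)) auto
  then have e2: "\<forall>\<^sub>F n in sequentially. C / v * (M1 / M) powr p n < 1" by (rule order_tendstoD) simp
  have large: "\<forall>\<^sub>F n in sequentially. real DIM('a) \<le> t * p n" if "t > 0" for t
  proof -
    have "\<forall>\<^sub>F n in sequentially. real DIM('a) / t \<le> p n" using p(2) by (simp add: filterlim_at_top)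
    then show ?thesis by eventually_elim (use that in \<open>simp add: divide_le_eq mult.commute\<close>)
  qed
  have pos: "1 - r > 0" "1 - s > 0" using r s by auto
  show ?thesis
    using e1 e2 large[OF r(1)] large[OF pos(1)] large[OF s(1)] large[OF pos(2)]
  proof eventually_elim
    case (elim n)
    have pn: "p n > 0" using p(1)[of n] by linarith
    have E1: "Lp_pow \<Omega> (p n) (weak_gradient \<Omega> ?w) + gagliardo_pow \<Omega> (p n) r ?w \<le> ennreal (C * l powr p n)"
      using a elim pn by (intro energy) auto
    have E2: "Lp_pow \<Omega> (p n) (weak_gradient \<Omega> ?z) + gagliardo_pow \<Omega> (p n) s ?z \<le> ennreal (C * l powr p n)"
      using b elim pn by (intro energy) auto
    define K where "K = coupling \<Omega> (\<alpha> n) (\<beta> n) ?w ?z"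
    have K: "ennreal (\<eta> n powr p n * \<theta> powr p n * v) \<le> K"
    proof -
      have "\<eta> n powr p n = a powr \<alpha> n * b powr \<beta> n"
        using pn by (simp add: \<eta>_def powr_mult powr_powr)
      then show ?thesis
        using cone_coupling[OF \<Omega>(2) R a(1) b(1) \<theta>, of "\<alpha> n" "\<beta> n"] \<alpha>\<beta>(1)[of n] \<alpha>\<beta>(2)[of n]
        by (simp add: \<alpha>\<beta>(3) K_def v_def)
    qed
    have "lam n \<le> J_fun \<Omega> r s (p n) (\<alpha> n) (\<beta> n) ?w ?z"
      using lam[of n] W[of n] nz unfolding is_minimum_def by blast
    also have "\<dots> = 1 / 2 * (((Lp_pow \<Omega> (p n) (weak_gradient \<Omega> ?w) + gagliardo_pow \<Omega> (p n) r ?w)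
        + (Lp_pow \<Omega> (p n) (weak_gradient \<Omega> ?z) + gagliardo_pow \<Omega> (p n) s ?z)) / K)"
      by (simp add: J_fun_def K_def add.assoc)
    also have "\<dots> \<le> 1 / 2 * ennreal ((C * l powr p n + C * l powr p n) / (\<eta> n powr p n * \<theta> powr p n * v))"
      using add_mono[OF E1 E2] C v \<eta>0[of n] \<theta>
      by (intro mult_left_mono ennreal_quotient_le[OF _ K]) (simp_all add: ennreal_plus[symmetric] del: ennreal_plus)
    also have "\<dots> = ennreal (1 / 2) * ennreal ((C * l powr p n + C * l powr p n) / (\<eta> n powr p n * \<theta> powr p n * v))"
      by (simp only: ennreal_half)
    also have "\<dots> = ennreal (1 / 2 * ((C * l powr p n + C * l powr p n) / (\<eta> n powr p n * \<theta> powr p n * v)))"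
      using C v by (intro ennreal_mult[symmetric]) auto
    \<comment> \<open>The two equal energy bounds cancel the factor one half, and
      \<open>l / \<theta> = M2\<close>.\<close>
    also have "1 / 2 * ((C * l powr p n + C * l powr p n) / (\<eta> n powr p n * \<theta> powr p n * v)) = C / v * (M2 / \<eta> n) powr p n"
      using l M2 v by (simp add: \<theta>_def powr_divide field_simps)
    also have "ennreal (C / v * (M2 / \<eta> n) powr p n) \<le> ennreal (C / v * M1 powr p n)"
      using elim C v pn M2 l \<eta>0[of n] by (intro ennreal_leI mult_left_mono powr_mono2) auto
    also have "\<dots> \<le> ennreal (M powr p n)"
    proof (rule ennreal_leI)
      have "C / v * M1 powr p n / M powr p n < 1" using elim by (simp add: powr_divide)
      moreover have "M powr p n > 0" using M1 M2 l by simp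
      ultimately have "C / v * M1 powr p n < 1 * M powr p n" by (simp only: pos_divide_less_eq)
      then show "C / v * M1 powr p n \<le> M powr p n" by simp
    qed
    finally show ?case .
  qed
qed

section \<open>Limits of minimizers\<close>

text \<open>The map \<open>(q, a, b) \<mapsto> a powr q * b powr (1 - q)\<close> is uniformly
  continuous on a compact box. The exponents are confined to a closed subinterval of the open unit
  interval because \<open>powr\<close> is continuous at base 0 only for positive exponents.\<close>

lemma uniform_limit_powr_product:
  fixes U V :: "nat \<Rightarrow> 'a \<Rightarrow> real"
  assumes U: "uniform_limit S U X sequentially" and V: "uniform_limit S V Y sequentially"
    and U0: "\<And>k x. x \<in> S \<Longrightarrow> 0 \<le> U k x" and V0: "\<And>k x. x \<in> S \<Longrightarrow> 0 \<le> V k x"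
    and B: "\<And>x. x \<in> S \<Longrightarrow> 0 \<le> X x \<and> X x \<le> B" "\<And>x. x \<in> S \<Longrightarrow> 0 \<le> Y x \<and> Y x \<le> B"
    and g: "g \<longlonglongrightarrow> \<Gamma>" "0 < \<Gamma>" "\<Gamma> < 1"
  shows "uniform_limit S (\<lambda>k x. U k x powr g k * V k x powr (1 - g k))
    (\<lambda>x. X x powr \<Gamma> * Y x powr (1 - \<Gamma>)) sequentially"
proof (rule uniform_limitI)
  fix e :: real assume e: "e > 0"
  let ?\<Phi> = "\<lambda>(q, a, b). a powr q * b powr (1 - q) :: real"
  define K where "K = {\<Gamma> / 2 .. (1 + \<Gamma>) / 2} \<times> {0 .. B + 1} \<times> {0 .. B + 1}"
  have "compact K" unfolding K_def by (intro compact_Times compact_Icc)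
  moreover have "continuous_on K ?\<Phi>"
    unfolding split_beta K_def using g
    by (intro continuous_intros continuous_on_powr') auto
  ultimately have "uniformly_continuous_on K ?\<Phi>" by (rule compact_uniformly_continuous[rotated])
  then obtain d where d: "d > 0" "\<And>x y. x \<in> K \<Longrightarrow> y \<in> K \<Longrightarrow> dist y x < d \<Longrightarrow> dist (?\<Phi> y) (?\<Phi> x) < e"
    using e unfolding uniformly_continuous_on_def by blast
  \<comment> \<open>The 1 keeps the approximating values within \<open>B + 1\<close>, and
    \<open>d / 3\<close> shares the distance among the three coordinates.\<close>
  define \<epsilon> where "\<epsilon> = min 1 (d / 3)"
  have \<epsilon>: "\<epsilon> > 0" using d by (simp add: \<epsilon>_def)
  have "\<forall>\<^sub>F k in sequentially. g k > \<Gamma> / 2" using g by (intro order_tendstoD(1)[OF g(1)]) auto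
  moreover have "\<forall>\<^sub>F k in sequentially. g k < (1 + \<Gamma>) / 2" using g by (intro order_tendstoD(2)[OF g(1)]) auto
  moreover have "\<forall>\<^sub>F k in sequentially. dist (g k) \<Gamma> < \<epsilon>" using tendstoD[OF g(1) \<epsilon>] .
  ultimately show "\<forall>\<^sub>F k in sequentially. \<forall>x\<in>S. dist (U k x powr g k * V k x powr (1 - g k)) (X x powr \<Gamma> * Y x powr (1 - \<Gamma>)) < e"
    using uniform_limitD[OF U \<epsilon>] uniform_limitD[OF V \<epsilon>]
  proof eventually_elim
    case (elim k)
    show ?case
    proof
      fix x assume x: "x \<in> S"
      have 1: "(\<Gamma>, X x, Y x) \<in> K" using B(1)[OF x] B(2)[OF x] g by (auto simp: K_def)
      have u: "dist (U k x) (X x) < \<epsilon>" "dist (V k x) (Y x) < \<epsilon>" using elim x by auto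
      then have "\<bar>U k x - X x\<bar> < 1" "\<bar>V k x - Y x\<bar> < 1" by (auto simp: dist_real_def \<epsilon>_def)
      then have 2: "(g k, U k x, V k x) \<in> K"
        using B(1)[OF x] B(2)[OF x] U0[OF x, of k] V0[OF x, of k] elim by (auto simp: K_def)
      have "dist (g k, U k x, V k x) (\<Gamma>, X x, Y x) \<le> dist (g k) \<Gamma> + dist (U k x, V k x) (X x, Y x)"
        unfolding dist_Pair_Pair[of "g k"] by (rule order_trans[OF sqrt_sum_squares_le_sum]) auto
      also have "dist (U k x, V k x) (X x, Y x) \<le> dist (U k x) (X x) + dist (V k x) (Y x)"
        unfolding dist_Pair_Pair by (rule order_trans[OF sqrt_sum_squares_le_sum]) auto
      finally have "dist (g k, U k x, V k x) (\<Gamma>, X x, Y x) \<le> dist (g k) \<Gamma> + (dist (U k x) (X x) + dist (V k x) (Y x))"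
        by simp
      moreover have "\<epsilon> \<le> d / 3" by (simp add: \<epsilon>_def)
      ultimately have "dist (g k, U k x, V k x) (\<Gamma>, X x, Y x) < d" using u elim by linarith
      from d(2)[OF 1 2 this]
      show "dist (U k x powr g k * V k x powr (1 - g k)) (X x powr \<Gamma> * Y x powr (1 - \<Gamma>)) < e" by simp
    qed
  qed
qed

lemma continuous_AE_nonneg:
  fixes f :: "'a::euclidean_space \<Rightarrow> real"
  assumes "open \<Omega>" "continuous_on \<Omega> f" "AE x in lebesgue_on \<Omega>. 0 \<le> f x" "x \<in> \<Omega>"
  shows "0 \<le> f x"
proof -
  have "AE x in lebesgue_on \<Omega>. f x = \<bar>f x\<bar>" using assms(3) by eventually_elim simp
  then have "f x = \<bar>f x\<bar>"
    by (rule continuous_AE_eq_imp_eq[OF assms(1,2) continuous_on_rabs[OF assms(2)] _ assms(4)])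
  then show ?thesis by linarith
qed

lemma coupling_cong_AE:
  assumes "AE x in lebesgue_on \<Omega>. w x = w' x" "AE x in lebesgue_on \<Omega>. z x = z' x"
  shows "coupling \<Omega> \<alpha> \<beta> w z = coupling \<Omega> \<alpha> \<beta> w' z'"
  unfolding coupling_def
proof (rule nn_integral_cong_AE)
  show "AE x in lebesgue_on \<Omega>. ennreal (\<bar>w x\<bar> powr \<alpha> * \<bar>z x\<bar> powr \<beta>) = ennreal (\<bar>w' x\<bar> powr \<alpha> * \<bar>z' x\<bar> powr \<beta>)"
    using assms by eventually_elim simp
qed

text \<open>As the coupling is normalised, \<open>lam n\<close> is half the total energy, so each of
  the four terms meets the assumptions of the compactness and Hoelder lemmas at level
  \<open>\<Lambda>\<close>. The level is left general: it is used with the claimed limit, and along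
  a subsequence with a hypothetical smaller value.\<close>

lemma minimizer_limit:
  fixes \<Omega> :: "'a::euclidean_space set" and p \<alpha> \<beta> :: "nat \<Rightarrow> real" and u v :: "nat \<Rightarrow> 'a \<Rightarrow> real"
  assumes \<Omega>: "bounded \<Omega>" "open \<Omega>" and r: "0 < r" and s: "0 < s" and \<Gamma>: "0 < \<Gamma>" "\<Gamma> < 1"
    and p: "\<And>n. 1 < p n" "filterlim p at_top sequentially" and \<alpha>\<beta>: "\<And>n. \<alpha> n + \<beta> n = p n"
    and lim: "(\<lambda>n. \<alpha> n / p n) \<longlonglongrightarrow> \<Gamma>"
    and uv: "\<And>n. u n \<in> W01p \<Omega> (p n)" "\<And>n. v n \<in> W01p \<Omega> (p n)"
    and J: "\<And>n. J_fun \<Omega> r s (p n) (\<alpha> n) (\<beta> n) (u n) (v n) = lam n"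
    and pos: "\<And>n. AE x in lebesgue_on \<Omega>. 0 < u n x" "\<And>n. AE x in lebesgue_on \<Omega>. 0 < v n x"
    and coup: "\<And>n. coupling \<Omega> (\<alpha> n) (\<beta> n) (u n) (v n) = 1"
    and \<Lambda>: "\<Lambda> \<ge> 0" "\<And>M. M > \<Lambda> \<Longrightarrow> \<forall>\<^sub>F n in sequentially. lam n \<le> ennreal (M powr p n)"
  obtains \<sigma> U V X Y where "strict_mono (\<sigma> :: nat \<Rightarrow> nat)"
    "\<And>k. continuous_on UNIV (U k)" "\<And>k. AE x in lebesgue_on \<Omega>. U k x = u (\<sigma> k) x"
    "\<And>k. continuous_on UNIV (V k)" "\<And>k. AE x in lebesgue_on \<Omega>. V k x = v (\<sigma> k) x"
    "uniform_limit UNIV U X sequentially" "uniform_limit UNIV V Y sequentially"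
    "X \<in> W01inf \<Omega>" "Y \<in> W01inf \<Omega>" "\<And>x. x \<in> \<Omega> \<Longrightarrow> 0 \<le> X x" "\<And>x. x \<in> \<Omega> \<Longrightarrow> 0 \<le> Y x"
    "1 \<le> Linf_norm \<Omega> (\<lambda>x. \<bar>X x\<bar> powr \<Gamma> * \<bar>Y x\<bar> powr (1 - \<Gamma>))"
    "max (max (Linf_norm \<Omega> (weak_gradient \<Omega> X)) (holder_seminorm \<Omega> r X))
         (max (Linf_norm \<Omega> (weak_gradient \<Omega> Y)) (holder_seminorm \<Omega> s Y)) \<le> ennreal \<Lambda>"
proof -
  define E where "E n = Lp_pow \<Omega> (p n) (weak_gradient \<Omega> (u n)) + gagliardo_pow \<Omega> (p n) r (u n)
             + Lp_pow \<Omega> (p n) (weak_gradient \<Omega> (v n)) + gagliardo_pow \<Omega> (p n) s (v n)" for n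
  have E: "E n = 2 * lam n" for n
  proof -
    have "x / 1 = x" for x :: ennreal
      using ennreal_divide_times[of x 1 1] by (simp add: divide_ennreal_def)
    then have "lam n = 1 / 2 * E n" using J[of n] coup[of n] by (simp add: J_fun_def E_def)
    then have "2 * lam n = (2 * (1 / 2)) * E n" by (simp only: mult.assoc)
    also have "(2 * (1 / 2) :: ennreal) = 1"
      using ennreal_divide_times[of 2 2 1] by (simp add: ennreal_times_divide)
    finally show ?thesis by simp
  qed
  have Ebound: "\<forall>\<^sub>F n in sequentially. E n \<le> ennreal (2 * M powr p n)" if "M > \<Lambda>" for M
    using \<Lambda>(2)[OF that]
  proof eventually_elim
    case (elim n)
    then have "2 * lam n \<le> 2 * ennreal (M powr p n)" by (intro mult_left_mono) auto
    then show ?case unfolding E by (simp add: ennreal_mult)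
  qed
  have parts: "Lp_pow \<Omega> (p n) (weak_gradient \<Omega> (u n)) \<le> E n" "gagliardo_pow \<Omega> (p n) r (u n) \<le> E n"
    "Lp_pow \<Omega> (p n) (weak_gradient \<Omega> (v n)) \<le> E n" "gagliardo_pow \<Omega> (p n) s (v n) \<le> E n" for n
    unfolding E_def by (auto intro: add_increasing2 add_increasing)
  have bounds: "\<forall>\<^sub>F n in sequentially. Lp_pow \<Omega> (p n) (weak_gradient \<Omega> (u n)) \<le> ennreal (2 * M powr p n)"
    "\<forall>\<^sub>F n in sequentially. gagliardo_pow \<Omega> (p n) r (u n) \<le> ennreal (2 * M powr p n)"
    "\<forall>\<^sub>F n in sequentially. Lp_pow \<Omega> (p n) (weak_gradient \<Omega> (v n)) \<le> ennreal (2 * M powr p n)"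
    "\<forall>\<^sub>F n in sequentially. gagliardo_pow \<Omega> (p n) s (v n) \<le> ennreal (2 * M powr p n)" if "M > \<Lambda>" for M
    using Ebound[OF that] by (auto elim!: eventually_mono intro: order_trans parts)
  have two: "(2::real) > 0" by simp
  have "\<exists>\<sigma>1 U1 X. strict_mono (\<sigma>1 :: nat \<Rightarrow> nat) \<and> (\<forall>k. continuous_on UNIV (U1 k)) \<and>
    (\<forall>k. AE x in lebesgue_on \<Omega>. U1 k x = u (\<sigma>1 k) x) \<and> uniform_limit UNIV U1 X sequentially \<and>
    \<Lambda>-lipschitz_on UNIV X \<and> (\<forall>x. x \<notin> \<Omega> \<longrightarrow> X x = 0)"
    by (rule W01p_compactness[OF \<Omega> uv(1) p(2) \<Lambda>(1) two bounds(1)], assumption) blast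
  then obtain \<sigma>1 U1 X where \<sigma>1: "strict_mono (\<sigma>1 :: nat \<Rightarrow> nat)" and U1: "\<And>k. continuous_on UNIV (U1 k)"
    "\<And>k. AE x in lebesgue_on \<Omega>. U1 k x = u (\<sigma>1 k) x" "uniform_limit UNIV U1 X sequentially"
    and X: "\<Lambda>-lipschitz_on UNIV X" "\<And>x. x \<notin> \<Omega> \<Longrightarrow> X x = 0" by blast
  note f1 = filterlim_subseq[OF \<sigma>1]
  have "\<exists>\<sigma>2 V Y. strict_mono (\<sigma>2 :: nat \<Rightarrow> nat) \<and> (\<forall>k. continuous_on UNIV (V k)) \<and>
    (\<forall>k. AE x in lebesgue_on \<Omega>. V k x = v (\<sigma>1 (\<sigma>2 k)) x) \<and> uniform_limit UNIV V Y sequentially \<and>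
    \<Lambda>-lipschitz_on UNIV Y \<and> (\<forall>x. x \<notin> \<Omega> \<longrightarrow> Y x = 0)"
    \<comment> \<open>The second extraction starts from the first subsequence, so that both
      components finally share the indices \<open>\<sigma>1 (\<sigma>2 k)\<close>.\<close>
    by (rule W01p_compactness[OF \<Omega> uv(2)[of "\<sigma>1 _"] filterlim_compose[OF p(2) f1] \<Lambda>(1) two
          eventually_compose_filterlim[OF bounds(3) f1]], assumption) blast
  then obtain \<sigma>2 V Y where \<sigma>2: "strict_mono (\<sigma>2 :: nat \<Rightarrow> nat)" and V: "\<And>k. continuous_on UNIV (V k)"
    "\<And>k. AE x in lebesgue_on \<Omega>. V k x = v (\<sigma>1 (\<sigma>2 k)) x" "uniform_limit UNIV V Y sequentially"
    and Y: "\<Lambda>-lipschitz_on UNIV Y" "\<And>x. x \<notin> \<Omega> \<Longrightarrow> Y x = 0" by blast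
  note f2 = filterlim_subseq[OF \<sigma>2]
  define \<sigma> where "\<sigma> k = \<sigma>1 (\<sigma>2 k)" for k
  define U where "U k = U1 (\<sigma>2 k)" for k
  have \<sigma>: "strict_mono \<sigma>" using \<sigma>1 \<sigma>2 by (simp add: \<sigma>_def strict_mono_def)
  note f = filterlim_subseq[OF \<sigma>]
  have U: "continuous_on UNIV (U k)" "AE x in lebesgue_on \<Omega>. U k x = u (\<sigma> k) x" for k
    using U1 by (auto simp: U_def \<sigma>_def)
  have Ulim: "uniform_limit UNIV U X sequentially"
    unfolding U_def [abs_def] using filterlim_compose[OF U1(3) f2] .
  have VAE: "AE x in lebesgue_on \<Omega>. V k x = v (\<sigma> k) x" for k using V(2) by (simp add: \<sigma>_def)
  have X\<Omega>: "X \<in> W01inf \<Omega>" by (rule lipschitz_imp_W01inf(1)[OF \<Omega> X])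
  have Y\<Omega>: "Y \<in> W01inf \<Omega>" by (rule lipschitz_imp_W01inf(1)[OF \<Omega> Y])
  have gX: "Linf_norm \<Omega> (weak_gradient \<Omega> X) \<le> ennreal \<Lambda>"
    by (rule Linf_norm_le[OF lipschitz_imp_W01inf(3)[OF \<Omega> X] lipschitz_imp_W01inf(2)[OF \<Omega> X]])
  have gY: "Linf_norm \<Omega> (weak_gradient \<Omega> Y) \<le> ennreal \<Lambda>"
    by (rule Linf_norm_le[OF lipschitz_imp_W01inf(3)[OF \<Omega> Y] lipschitz_imp_W01inf(2)[OF \<Omega> Y]])
  have cX: "continuous_on UNIV X" and cY: "continuous_on UNIV Y"
    using X(1) Y(1) by (auto intro: lipschitz_on_continuous_on)
  have p\<sigma>: "filterlim (\<lambda>k. p (\<sigma> k)) at_top sequentially" by (rule filterlim_compose[OF p(2) f])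
  have hX: "holder_seminorm \<Omega> r X \<le> ennreal \<Lambda>"
    unfolding holder_seminorm_le_iff[OF \<Lambda>(1)]
  proof (intro ballI impI)
    fix x y assume xy: "x \<in> \<Omega>" "y \<in> \<Omega>" "x \<noteq> y"
    show "\<bar>X x - X y\<bar> \<le> \<Lambda> * norm (x - y) powr r"
      by (rule holder_of_gagliardo_bounds[OF \<Omega>(2) cX Ulim U(2) p\<sigma> \<Lambda>(1) r
            eventually_compose_filterlim[OF bounds(2) f] xy])
  qed
  have hY: "holder_seminorm \<Omega> s Y \<le> ennreal \<Lambda>"
    unfolding holder_seminorm_le_iff[OF \<Lambda>(1)]
  proof (intro ballI impI)
    fix x y assume xy: "x \<in> \<Omega>" "y \<in> \<Omega>" "x \<noteq> y"
    show "\<bar>Y x - Y y\<bar> \<le> \<Lambda> * norm (x - y) powr s"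
      by (rule holder_of_gagliardo_bounds[OF \<Omega>(2) cY V(3) VAE p\<sigma> \<Lambda>(1) s
            eventually_compose_filterlim[OF bounds(4) f] xy])
  qed
  have U0: "0 \<le> U k x" if x: "x \<in> \<Omega>" for k x
  proof (rule continuous_AE_nonneg[OF \<Omega>(2) continuous_on_subset[OF U(1)] _ x])
    show "AE x in lebesgue_on \<Omega>. 0 \<le> U k x" using U(2)[of k] pos(1)[of "\<sigma> k"] by eventually_elim simp
  qed simp
  have V0: "0 \<le> V k x" if x: "x \<in> \<Omega>" for k x
  proof (rule continuous_AE_nonneg[OF \<Omega>(2) continuous_on_subset[OF V(1)] _ x])
    show "AE x in lebesgue_on \<Omega>. 0 \<le> V k x" using VAE[of k] pos(2)[of "\<sigma> k"] by eventually_elim simp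
  qed simp
  have X0: "0 \<le> X x" if x: "x \<in> \<Omega>" for x
    by (rule tendsto_lowerbound[OF tendsto_uniform_limitI[OF Ulim]]) (use U0[OF x] in auto)
  have Y0: "0 \<le> Y x" if x: "x \<in> \<Omega>" for x
    by (rule tendsto_lowerbound[OF tendsto_uniform_limitI[OF V(3)]]) (use V0[OF x] in auto)
  have Xm: "X \<in> borel_measurable (lebesgue_on \<Omega>)" and Ym: "Y \<in> borel_measurable (lebesgue_on \<Omega>)"
    using W01inf_measurable X\<Omega> Y\<Omega> by auto
  define \<pi> where "\<pi> x = \<bar>X x\<bar> powr \<Gamma> * \<bar>Y x\<bar> powr (1 - \<Gamma>)" for x
  \<comment> \<open>If the essential supremum were some \<open>q < 1\<close>, uniform convergence
    would eventually keep the products of the approximations below a fixed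
    \<open>\<theta> < 1\<close> almost everywhere. The coupling, an integral of their
    \<open>p\<close>-th powers over a set of finite measure, would then tend to 0 although it is
    always 1.\<close>
  have "1 \<le> Linf_norm \<Omega> \<pi>"
  proof (rule ccontr)
    assume "\<not> 1 \<le> Linf_norm \<Omega> \<pi>"
    then have S1: "Linf_norm \<Omega> \<pi> < 1" by simp
    define q where "q = enn2real (Linf_norm \<Omega> \<pi>)"
    have "Linf_norm \<Omega> \<pi> < top" using S1 by (rule less_trans) simp
    then have q: "Linf_norm \<Omega> \<pi> = ennreal q" "q \<ge> 0" by (simp_all add: q_def)
    have q1: "q < 1" using S1 unfolding q(1) by (simp add: ennreal_less_iff q(2) flip: ennreal_1)
    have AE\<pi>: "AE x in lebesgue_on \<Omega>. norm (\<pi> x) \<le> q" by (rule AE_norm_le_of_Linf_norm) (simp_all add: q)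
    define \<theta> where "\<theta> = (1 + q) / 2"
    have \<theta>: "0 < \<theta>" "\<theta> < 1" "\<theta> = q + (1 - q) / 2" using q q1 by (auto simp: \<theta>_def field_simps)
    obtain B where B: "\<And>x. x \<in> closure \<Omega> \<Longrightarrow> norm (X x) \<le> B" "\<And>x. x \<in> closure \<Omega> \<Longrightarrow> norm (Y x) \<le> B"
    proof -
      have c: "compact (closure \<Omega>)" using \<Omega>(1) by simp
      have "bounded (X ` closure \<Omega> \<union> Y ` closure \<Omega>)"
        unfolding bounded_Un using compact_imp_bounded compact_continuous_image c continuous_on_subset[OF cX subset_UNIV]
          continuous_on_subset[OF cY subset_UNIV] by blast
      then obtain B where "\<And>y. y \<in> X ` closure \<Omega> \<union> Y ` closure \<Omega> \<Longrightarrow> norm y \<le> B"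
        unfolding bounded_iff by blast
      then show ?thesis using that[of B] by blast
    qed
    \<comment> \<open>Dividing \<open>\<alpha>\<close> and \<open>\<beta>\<close> by
      \<open>p\<close> writes the coupling integrand as a \<open>p\<close>-th power of a product
      whose exponents add up to 1.\<close>
    define g where "g k = \<alpha> (\<sigma> k) / p (\<sigma> k)" for k
    have g: "g \<longlonglongrightarrow> \<Gamma>" unfolding g_def [abs_def] using filterlim_compose[OF lim f] .
    have g1: "1 - g k = \<beta> (\<sigma> k) / p (\<sigma> k)" for k
      using \<alpha>\<beta>[of "\<sigma> k"] p(1)[of "\<sigma> k"] by (simp add: g_def field_simps)
    have "uniform_limit \<Omega> (\<lambda>k x. U k x powr g k * V k x powr (1 - g k))
        (\<lambda>x. X x powr \<Gamma> * Y x powr (1 - \<Gamma>)) sequentially"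
    proof (rule uniform_limit_powr_product[OF uniform_limit_on_subset[OF Ulim] uniform_limit_on_subset[OF V(3)] U0 V0 _ _ g \<Gamma>])
      show "0 \<le> X x \<and> X x \<le> B" "0 \<le> Y x \<and> Y x \<le> B" if "x \<in> \<Omega>" for x
        using B[of x] X0[OF that] Y0[OF that] closure_subset[of \<Omega>] that by auto
    qed auto
    moreover have "(1 - q) / 2 > 0" using q1 by simp
    ultimately have "\<forall>\<^sub>F k in sequentially. \<forall>x\<in>\<Omega>. dist (U k x powr g k * V k x powr (1 - g k)) (X x powr \<Gamma> * Y x powr (1 - \<Gamma>)) < (1 - q) / 2"
      by (rule uniform_limitD)
    moreover define m where "m = enn2real (emeasure (lebesgue_on \<Omega>) \<Omega>)"
    have "emeasure (lebesgue_on \<Omega>) \<Omega> < \<infinity>" using emeasure_lebesgue_on_bounded[OF \<Omega>(1)] \<Omega>(2) by simp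
    then have m: "emeasure (lebesgue_on \<Omega>) \<Omega> = ennreal m" "m \<ge> 0" by (simp_all add: m_def)
    have "(\<lambda>k. m * \<theta> powr p (\<sigma> k)) \<longlonglongrightarrow> m * 0"
      by (intro tendsto_mult tendsto_const powr_ratio_tendsto_0 \<theta> p\<sigma>)
    then have "\<forall>\<^sub>F k in sequentially. m * \<theta> powr p (\<sigma> k) < 1" by (rule order_tendstoD) simp
    ultimately have "\<forall>\<^sub>F k in sequentially. False"
    proof eventually_elim
      case (elim k)
      let ?p = "p (\<sigma> k)"
      have pk: "?p > 0" using p(1)[of "\<sigma> k"] by linarith
      have "1 = coupling \<Omega> (\<alpha> (\<sigma> k)) (\<beta> (\<sigma> k)) (U k) (V k)"
        using coup[of "\<sigma> k"] coupling_cong_AE[OF U(2)[of k] VAE[of k]] by simp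
      also have "\<dots> \<le> ennreal (\<theta> powr ?p) * emeasure (lebesgue_on \<Omega>) \<Omega>"
        unfolding coupling_def
      proof (rule nn_integral_lebesgue_on_const_le)
        have "AE x in lebesgue_on \<Omega>. x \<in> \<Omega>" using AE_space[of "lebesgue_on \<Omega>"] by simp
        with AE\<pi> show "AE x in lebesgue_on \<Omega>. ennreal (\<bar>U k x\<bar> powr \<alpha> (\<sigma> k) * \<bar>V k x\<bar> powr \<beta> (\<sigma> k)) \<le> ennreal (\<theta> powr ?p)"
        proof eventually_elim
          case x: (elim x)
          have "X x powr \<Gamma> * Y x powr (1 - \<Gamma>) \<le> q"
            using x(1) X0[OF x(2)] Y0[OF x(2)] by (simp add: \<pi>_def abs_mult)
          moreover have "dist (U k x powr g k * V k x powr (1 - g k)) (X x powr \<Gamma> * Y x powr (1 - \<Gamma>)) < (1 - q) / 2"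
            using elim(1) x(2) by blast
          ultimately have le: "U k x powr g k * V k x powr (1 - g k) \<le> \<theta>"
            unfolding \<theta>(3) dist_real_def by linarith
          have "\<bar>U k x\<bar> powr \<alpha> (\<sigma> k) * \<bar>V k x\<bar> powr \<beta> (\<sigma> k) = (U k x powr g k * V k x powr (1 - g k)) powr ?p"
            unfolding g1 using pk U0[OF x(2)] V0[OF x(2)] by (simp add: g_def powr_mult powr_powr)
          also have "\<dots> \<le> \<theta> powr ?p" using le pk by (intro powr_mono2) auto
          finally show ?case by (rule ennreal_leI)
        qed
      qed
      also have "\<dots> = ennreal (\<theta> powr ?p * m)" unfolding m(1) using m(2) by (intro ennreal_mult[symmetric]) auto
      finally have "1 \<le> m * \<theta> powr ?p"
        by (simp add: mult.commute)
      then show ?case using elim(2) by linarith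
    qed
    then show False by simp
  qed
  then have S: "1 \<le> Linf_norm \<Omega> (\<lambda>x. \<bar>X x\<bar> powr \<Gamma> * \<bar>Y x\<bar> powr (1 - \<Gamma>))" by (simp add: \<pi>_def [abs_def])
  have "max (max (Linf_norm \<Omega> (weak_gradient \<Omega> X)) (holder_seminorm \<Omega> r X))
         (max (Linf_norm \<Omega> (weak_gradient \<Omega> Y)) (holder_seminorm \<Omega> s Y)) \<le> ennreal \<Lambda>"
    using gX gY hX hY by simp
  then show ?thesis
    using that[OF \<sigma> U V(1) VAE Ulim V(3) X\<Omega> Y\<Omega> X0 Y0 S] by blast
qed

text \<open>A ball is connected, so if it meets \<open>\<Omega>\<close> but not its frontier, it
  lies inside. Positivity of \<open>R\<close> holds because the frontier is closed and disjoint from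
  the open set.\<close>

lemma maximal_inner_ball:
  fixes \<Omega> :: "'a::euclidean_space set"
  assumes \<Omega>: "bounded \<Omega>" "open \<Omega>" "\<Omega> \<noteq> {}"
    and R: "is_maximum R ((\<lambda>x. infdist x (frontier \<Omega>)) ` \<Omega>)"
  obtains x0 where "R > 0" "ball x0 R \<subseteq> \<Omega>" "\<And>x. x \<in> \<Omega> \<Longrightarrow> infdist x (frontier \<Omega>) \<le> R"
proof -
  obtain x0 where x0: "x0 \<in> \<Omega>" "R = infdist x0 (frontier \<Omega>)" and max: "\<And>x. x \<in> \<Omega> \<Longrightarrow> infdist x (frontier \<Omega>) \<le> R"
    using R by (auto simp: is_maximum_def)
  have "\<Omega> \<noteq> UNIV" using \<Omega>(1) not_bounded_UNIV by blast
  then have ne: "frontier \<Omega> \<noteq> {}" using \<Omega>(3) by (simp add: frontier_eq_empty)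
  have "x0 \<notin> frontier \<Omega>" using x0 \<Omega>(2) by (simp add: frontier_def interior_open)
  then have "infdist x0 (frontier \<Omega>) \<noteq> 0"
    using in_closed_iff_infdist_zero[OF frontier_closed ne] by blast
  then have R0: "R > 0" using infdist_nonneg[of x0 "frontier \<Omega>"] x0(2) by simp
  have "ball x0 R \<inter> frontier \<Omega> = {}"
  proof (rule ccontr)
    assume "ball x0 R \<inter> frontier \<Omega> \<noteq> {}"
    then obtain y where "y \<in> frontier \<Omega>" "dist x0 y < R" by auto
    then show False using infdist_le[of y "frontier \<Omega>" x0] x0(2) by simp
  qed
  moreover have "x0 \<in> ball x0 R" using R0 by simp
  then have "ball x0 R \<inter> \<Omega> \<noteq> {}" using x0(1) by blast
  ultimately have "ball x0 R \<subseteq> \<Omega>"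
    using connected_Int_frontier[of "ball x0 R" \<Omega>] convex_connected[OF convex_ball, of x0 R] by blast
  then show ?thesis using that R0 max by blast
qed

text \<open>The functions \<open>u n\<close> and \<open>v n\<close> are determined only up to null
  sets, so uniform convergence is stated for continuous versions \<open>U k\<close> and
  \<open>V k\<close>. The passage through \<open>enn2real\<close> is harmless for the limit, since
  the proof shows \<open>lam n\<close> to be finite for large \<open>n\<close>.\<close>

theorem theorem1p3:
  fixes \<Omega> :: "'a::euclidean_space set"
    and r s \<Gamma> R :: real
    and p \<alpha> \<beta> :: "nat \<Rightarrow> real"
    and lam :: "nat \<Rightarrow> ennreal"
    and u v :: "nat \<Rightarrow> 'a \<Rightarrow> real"
  assumes "bounded \<Omega>" "open \<Omega>" "connected \<Omega>" "\<Omega> \<noteq> {}"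
    and "0 < r" "r < 1" "0 < s" "s < 1" "0 < \<Gamma>" "\<Gamma> < 1"
    and "\<And>n. 1 < p n" "\<And>n. 1 \<le> \<alpha> n" "\<And>n. 1 \<le> \<beta> n"
    and "incseq p" "incseq \<alpha>" "incseq \<beta>"
    and "filterlim p at_top sequentially"
    and "filterlim \<alpha> at_top sequentially"
    and "filterlim \<beta> at_top sequentially"
    and "\<And>n. \<alpha> n + \<beta> n = p n"
    and "(\<lambda>n. \<alpha> n / p n) \<longlonglongrightarrow> \<Gamma>"
    and "(\<lambda>n. \<beta> n / p n) \<longlonglongrightarrow> 1 - \<Gamma>"
    and "\<And>n. is_minimum (lam n) {J_fun \<Omega> r s (p n) (\<alpha> n) (\<beta> n) w z | w z.
            w \<in> W01p \<Omega> (p n) \<and> z \<in> W01p \<Omega> (p n) \<and> nonzero_product \<Omega> w z}"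
    and "\<And>n. u n \<in> W01p \<Omega> (p n)" "\<And>n. v n \<in> W01p \<Omega> (p n)"
    and "\<And>n. J_fun \<Omega> r s (p n) (\<alpha> n) (\<beta> n) (u n) (v n) = lam n"
    and "\<And>n. AE x in lebesgue_on \<Omega>. 0 < u n x" "\<And>n. AE x in lebesgue_on \<Omega>. 0 < v n x"
    and "\<And>n. coupling \<Omega> (\<alpha> n) (\<beta> n) (u n) (v n) = 1"
    and "is_maximum R ((\<lambda>x. infdist x (frontier \<Omega>)) ` \<Omega>)"
  shows "\<exists>lam_inf :: real.
    (\<lambda>n. enn2real (lam n) powr (1 / p n)) \<longlonglongrightarrow> lam_inf \<and>
    lam_inf = max (1 / R) (1 / R powr (\<Gamma> * r + (1 - \<Gamma>) * s)) \<and>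
    (\<exists>u_inf v_inf. u_inf \<in> W01inf \<Omega> \<and> v_inf \<in> W01inf \<Omega> \<and>
       Linf_norm \<Omega> (\<lambda>x. u_inf x powr \<Gamma> * v_inf x powr (1 - \<Gamma>)) = 1 \<and>
       (\<exists>\<sigma> U V. strict_mono (\<sigma> :: nat \<Rightarrow> nat) \<and>
          (\<forall>k. continuous_on \<Omega> (U k) \<and> (AE x in lebesgue_on \<Omega>. U k x = u (\<sigma> k) x)) \<and>
          (\<forall>k. continuous_on \<Omega> (V k) \<and> (AE x in lebesgue_on \<Omega>. V k x = v (\<sigma> k) x)) \<and>
          uniform_limit \<Omega> U u_inf sequentially \<and>
          uniform_limit \<Omega> V v_inf sequentially) \<and>
       J_inf \<Omega> r s \<Gamma> u_inf v_inf = ennreal lam_inf \<and>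
       is_minimum (ennreal lam_inf) {J_inf \<Omega> r s \<Gamma> w z | w z.
          w \<in> W01inf \<Omega> \<and> z \<in> W01inf \<Omega> \<and> nonzero_product \<Omega> w z})"
proof -
  note \<Omega> = assms(1,2) and r = assms(5,6) and s = assms(7,8) and \<Gamma> = assms(9,10)
    and p = assms(11,17) and \<alpha> = assms(12) and \<beta> = assms(13) and \<alpha>\<beta> = assms(20)
    and lim = assms(21,22) and lam = assms(23) and uv = assms(24,25) and J = assms(26)
    and pos = assms(27,28) and coup = assms(29)
  obtain x0 where R: "R > 0" "ball x0 R \<subseteq> \<Omega>" "\<And>x. x \<in> \<Omega> \<Longrightarrow> infdist x (frontier \<Omega>) \<le> R"
    by (rule maximal_inner_ball[OF \<Omega> assms(4,30)]) (rule that; simp)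
  define l where "l = max (1 / R) (1 / R powr (\<Gamma> * r + (1 - \<Gamma>) * s))"
  have l: "l > 0" using R(1) by (simp add: l_def less_max_iff_disj)
  have upper: "\<forall>\<^sub>F n in sequentially. lam n \<le> ennreal (M powr p n)" if "M > l" for M
    by (rule minimum_upper_bound[OF \<Omega> R(1,2) r s \<Gamma> p \<alpha> \<beta> \<alpha>\<beta> lim lam that[unfolded l_def]])
  have lower: "ennreal l \<le> J_inf \<Omega> r s \<Gamma> w z"
    if "w \<in> W01inf \<Omega>" "z \<in> W01inf \<Omega>" "nonzero_product \<Omega> w z" for w z
    unfolding l_def by (rule J_inf_lower_bound[OF \<Omega> that r(1) s(1) \<Gamma> R(1,3)])
  \<comment> \<open>A sandwich: numerator at most \<open>\<Lambda>\<close> and denominator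
    \<open>?S \<ge> 1\<close> give a quotient at most \<open>\<Lambda> / ?S\<close>, while the
    general bound gives at least \<open>l\<close>. Hence \<open>l \<le> \<Lambda>\<close>, and for
    \<open>\<Lambda> = l\<close> there is no room left, so the denominator is 1 and the quotient is
    \<open>l\<close>.\<close>
  have J_of_limit: "nonzero_product \<Omega> X Y \<and> \<Lambda> \<ge> l \<and> (\<Lambda> = l \<longrightarrow> J_inf \<Omega> r s \<Gamma> X Y = ennreal l \<and>
      Linf_norm \<Omega> (\<lambda>x. \<bar>X x\<bar> powr \<Gamma> * \<bar>Y x\<bar> powr (1 - \<Gamma>)) = 1)"
    if X: "X \<in> W01inf \<Omega>" and Y: "Y \<in> W01inf \<Omega>" and \<Lambda>: "\<Lambda> \<ge> 0"
      and S: "1 \<le> Linf_norm \<Omega> (\<lambda>x. \<bar>X x\<bar> powr \<Gamma> * \<bar>Y x\<bar> powr (1 - \<Gamma>))"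
      and m: "max (max (Linf_norm \<Omega> (weak_gradient \<Omega> X)) (holder_seminorm \<Omega> r X))
         (max (Linf_norm \<Omega> (weak_gradient \<Omega> Y)) (holder_seminorm \<Omega> s Y)) \<le> ennreal \<Lambda>" for X Y \<Lambda>
  proof -
    let ?S = "Linf_norm \<Omega> (\<lambda>x. \<bar>X x\<bar> powr \<Gamma> * \<bar>Y x\<bar> powr (1 - \<Gamma>))"
    have nz: "nonzero_product \<Omega> X Y"
      unfolding nonzero_product_def
    proof
      assume "AE x in lebesgue_on \<Omega>. X x * Y x = 0"
      then have "AE x in lebesgue_on \<Omega>. norm (\<bar>X x\<bar> powr \<Gamma> * \<bar>Y x\<bar> powr (1 - \<Gamma>)) \<le> 0"
        by eventually_elim auto
      then have "?S \<le> ennreal 0"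
        by (intro Linf_norm_le powr_product_measurable W01inf_measurable X Y)
      then show False using S by simp
    qed
    have JS: "J_inf \<Omega> r s \<Gamma> X Y \<le> ennreal \<Lambda> / ?S"
      unfolding J_inf_def by (rule divide_right_mono_ennreal[OF m])
    have lJ: "ennreal l \<le> J_inf \<Omega> r s \<Gamma> X Y" by (rule lower[OF X Y nz])
    then have lS: "ennreal l \<le> ennreal \<Lambda> / ?S" using JS by (rule order_trans)
    have "?S < top"
    proof (rule ccontr)
      assume "\<not> ?S < top"
      then have "?S = top" by (metis top.not_eq_extremum)
      then show False using lS l by simp
    qed
    define q where "q = enn2real ?S"
    have q: "?S = ennreal q" using \<open>?S < top\<close> by (simp add: q_def)
    have q1: "q \<ge> 1" using S unfolding q by (metis ennreal_1 ennreal_le_iff2 not_one_le_zero)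
    have "ennreal l \<le> ennreal (\<Lambda> / q)"
      using lS unfolding q using q1 \<Lambda> by (simp add: divide_ennreal)
    then have lq: "l \<le> \<Lambda> / q" using q1 \<Lambda> by (simp add: ennreal_le_iff)
    have \<Lambda>q: "\<Lambda> / q \<le> \<Lambda>" using q1 \<Lambda> by (simp add: divide_le_eq mult_le_cancel_left1)
    have "J_inf \<Omega> r s \<Gamma> X Y = ennreal l \<and> ?S = 1" if "\<Lambda> = l"
    proof
      have "q = 1"
      proof (rule ccontr)
        assume "q \<noteq> 1"
        then have "\<Lambda> / q < \<Lambda>" using q1 l that by (simp add: divide_less_eq)
        then show False using lq that by simp
      qed
      then show "?S = 1" unfolding q by simp
      have "J_inf \<Omega> r s \<Gamma> X Y \<le> ennreal (\<Lambda> / q)"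
        using JS unfolding q using q1 \<Lambda> by (simp add: divide_ennreal)
      also have "\<dots> \<le> ennreal l" using \<Lambda>q that by (intro ennreal_leI) simp
      finally show "J_inf \<Omega> r s \<Gamma> X Y = ennreal l" using lJ by (rule antisym)
    qed
    then show ?thesis using nz lq \<Lambda>q by auto
  qed
  have fin: "\<forall>\<^sub>F n in sequentially. lam n < top"
    using upper[of "l + 1"] by (auto elim!: eventually_mono intro: le_less_trans)
  have root: "enn2real (lam n) powr (1 / p n) \<le> M" if "lam n \<le> ennreal (M powr p n)" "M > 0" for n M
  proof -
    have pn: "p n > 0" using p(1)[of n] by linarith
    have "enn2real (lam n) \<le> M powr p n" using that by (intro enn2real_leI) auto
    then have "enn2real (lam n) powr (1 / p n) \<le> (M powr p n) powr (1 / p n)"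
      using pn by (intro powr_mono2) auto
    also have "\<dots> = M" using pn that(2) by (simp add: powr_powr)
    finally show ?thesis .
  qed
  have "(\<lambda>n. enn2real (lam n) powr (1 / p n)) \<longlonglongrightarrow> l"
  proof (rule order_tendstoI)
    fix a assume "l < a"
    then obtain M where M: "l < M" "M < a" using dense by blast
    show "\<forall>\<^sub>F n in sequentially. enn2real (lam n) powr (1 / p n) < a"
      using upper[OF M(1)]
    proof eventually_elim
      case (elim n)
      have "M > 0" using l M(1) by linarith
      from root[OF elim this] show ?case using M(2) by linarith
    qed
  next
    fix a assume a: "a < l"
    show "\<forall>\<^sub>F n in sequentially. a < enn2real (lam n) powr (1 / p n)"
    proof (rule ccontr)
      assume "\<not> (\<forall>\<^sub>F n in sequentially. a < enn2real (lam n) powr (1 / p n))"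
      then have "\<exists>\<^sub>F n in sequentially. enn2real (lam n) powr (1 / p n) \<le> a"
        by (simp add: not_eventually not_less)
      \<comment> \<open>Since \<open>enn2real top = 0\<close>, an infinite \<open>lam n\<close>
        would look like a small root; combining with the eventual finiteness excludes this.\<close>
      then have "\<exists>\<^sub>F n in sequentially. enn2real (lam n) powr (1 / p n) \<le> a \<and> lam n < top"
        using fin by (rule frequently_eventually_frequently)
      then have "infinite {n. enn2real (lam n) powr (1 / p n) \<le> a \<and> lam n < top}"
        by (simp add: frequently_sequentially infinite_nat_iff_unbounded_le)
      then obtain \<tau> where \<tau>: "strict_mono (\<tau> :: nat \<Rightarrow> nat)"
        and \<tau>a: "\<And>k. enn2real (lam (\<tau> k)) powr (1 / p (\<tau> k)) \<le> a" "\<And>k. lam (\<tau> k) < top"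
        using infinite_enumerate by blast
      note f = filterlim_subseq[OF \<tau>]
      have a0: "a \<ge> 0" using \<tau>a(1)[of 0] by (rule order_trans[rotated]) simp
      have bound: "lam (\<tau> k) \<le> ennreal (a powr p (\<tau> k))" for k
      proof -
        have pk: "p (\<tau> k) > 0" using p(1)[of "\<tau> k"] by linarith
        have "enn2real (lam (\<tau> k)) = (enn2real (lam (\<tau> k)) powr (1 / p (\<tau> k))) powr p (\<tau> k)"
          using pk by (simp add: powr_powr)
        also have "\<dots> \<le> a powr p (\<tau> k)" using \<tau>a(1)[of k] pk by (intro powr_mono2) auto
        finally have "ennreal (enn2real (lam (\<tau> k))) \<le> ennreal (a powr p (\<tau> k))" by (rule ennreal_leI)
        then show ?thesis using \<tau>a(2)[of k] by simp
      qed
      have ev: "\<forall>\<^sub>F k in sequentially. lam (\<tau> k) \<le> ennreal (M powr p (\<tau> k))" if M: "M > a" for M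
      proof (rule always_eventually, rule allI)
        fix k
        have "p (\<tau> k) \<ge> 0" using p(1)[of "\<tau> k"] by linarith
        then have "a powr p (\<tau> k) \<le> M powr p (\<tau> k)" using a0 M by (intro powr_mono2) auto
        then show "lam (\<tau> k) \<le> ennreal (M powr p (\<tau> k))" using bound[of k] by (meson ennreal_leI order_trans)
      qed
      \<comment> \<open>The minimizers along \<open>\<tau>\<close> have a limit pair at level
        \<open>\<Lambda> = a\<close>, for which \<open>J_of_limit\<close> yields
        \<open>l \<le> a\<close>.\<close>
      have "a \<ge> l"
        by (rule minimizer_limit[where u = "\<lambda>k. u (\<tau> k)" and v = "\<lambda>k. v (\<tau> k)" and lam = "\<lambda>k. lam (\<tau> k)",
              OF \<Omega> r(1) s(1) \<Gamma> p(1)[of "\<tau> _"] filterlim_compose[OF p(2) f] \<alpha>\<beta>[of "\<tau> _"]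
              filterlim_compose[OF lim(1) f] uv(1)[of "\<tau> _"] uv(2)[of "\<tau> _"] J[of "\<tau> _"]
              pos(1)[of "\<tau> _"] pos(2)[of "\<tau> _"] coup[of "\<tau> _"] a0 ev], assumption)
           (use J_of_limit a0 in blast)
      then show False using a by simp
    qed
  qed
  moreover have "\<exists>u_inf v_inf. u_inf \<in> W01inf \<Omega> \<and> v_inf \<in> W01inf \<Omega> \<and>
       Linf_norm \<Omega> (\<lambda>x. u_inf x powr \<Gamma> * v_inf x powr (1 - \<Gamma>)) = 1 \<and>
       (\<exists>\<sigma> U V. strict_mono (\<sigma> :: nat \<Rightarrow> nat) \<and>
          (\<forall>k. continuous_on \<Omega> (U k) \<and> (AE x in lebesgue_on \<Omega>. U k x = u (\<sigma> k) x)) \<and>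
          (\<forall>k. continuous_on \<Omega> (V k) \<and> (AE x in lebesgue_on \<Omega>. V k x = v (\<sigma> k) x)) \<and>
          uniform_limit \<Omega> U u_inf sequentially \<and>
          uniform_limit \<Omega> V v_inf sequentially) \<and>
       J_inf \<Omega> r s \<Gamma> u_inf v_inf = ennreal l \<and>
       is_minimum (ennreal l) {J_inf \<Omega> r s \<Gamma> w z | w z.
          w \<in> W01inf \<Omega> \<and> z \<in> W01inf \<Omega> \<and> nonzero_product \<Omega> w z}"
  proof -
    have "\<exists>\<sigma> U V X Y. strict_mono (\<sigma> :: nat \<Rightarrow> nat) \<and>
      (\<forall>k. continuous_on UNIV (U k)) \<and> (\<forall>k. AE x in lebesgue_on \<Omega>. U k x = u (\<sigma> k) x) \<and>
      (\<forall>k. continuous_on UNIV (V k)) \<and> (\<forall>k. AE x in lebesgue_on \<Omega>. V k x = v (\<sigma> k) x) \<and>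
      uniform_limit UNIV U X sequentially \<and> uniform_limit UNIV V Y sequentially \<and>
      X \<in> W01inf \<Omega> \<and> Y \<in> W01inf \<Omega> \<and> (\<forall>x\<in>\<Omega>. 0 \<le> X x) \<and> (\<forall>x\<in>\<Omega>. 0 \<le> Y x) \<and>
      1 \<le> Linf_norm \<Omega> (\<lambda>x. \<bar>X x\<bar> powr \<Gamma> * \<bar>Y x\<bar> powr (1 - \<Gamma>)) \<and>
      max (max (Linf_norm \<Omega> (weak_gradient \<Omega> X)) (holder_seminorm \<Omega> r X))
         (max (Linf_norm \<Omega> (weak_gradient \<Omega> Y)) (holder_seminorm \<Omega> s Y)) \<le> ennreal l"
      by (rule minimizer_limit[OF \<Omega> r(1) s(1) \<Gamma> p \<alpha>\<beta> lim(1) uv J pos coup less_imp_le[OF l] upper], assumption) blast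
    then obtain \<sigma> U V X Y where \<sigma>: "strict_mono (\<sigma> :: nat \<Rightarrow> nat)"
      and U: "\<And>k. continuous_on UNIV (U k)" "\<And>k. AE x in lebesgue_on \<Omega>. U k x = u (\<sigma> k) x"
      and V: "\<And>k. continuous_on UNIV (V k)" "\<And>k. AE x in lebesgue_on \<Omega>. V k x = v (\<sigma> k) x"
      and ul: "uniform_limit UNIV U X sequentially" "uniform_limit UNIV V Y sequentially"
      and XY: "X \<in> W01inf \<Omega>" "Y \<in> W01inf \<Omega>"
      and nonneg: "\<And>x. x \<in> \<Omega> \<Longrightarrow> 0 \<le> X x" "\<And>x. x \<in> \<Omega> \<Longrightarrow> 0 \<le> Y x"
      and S: "1 \<le> Linf_norm \<Omega> (\<lambda>x. \<bar>X x\<bar> powr \<Gamma> * \<bar>Y x\<bar> powr (1 - \<Gamma>))"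
      and m: "max (max (Linf_norm \<Omega> (weak_gradient \<Omega> X)) (holder_seminorm \<Omega> r X))
         (max (Linf_norm \<Omega> (weak_gradient \<Omega> Y)) (holder_seminorm \<Omega> s Y)) \<le> ennreal l"
      by blast
    have nz: "nonzero_product \<Omega> X Y" and JXY: "J_inf \<Omega> r s \<Gamma> X Y = ennreal l"
      and S1: "Linf_norm \<Omega> (\<lambda>x. \<bar>X x\<bar> powr \<Gamma> * \<bar>Y x\<bar> powr (1 - \<Gamma>)) = 1"
      using J_of_limit[OF XY less_imp_le[OF l] S m] by auto
    have "Linf_norm \<Omega> (\<lambda>x. X x powr \<Gamma> * Y x powr (1 - \<Gamma>)) = 1"
      unfolding S1[symmetric] Linf_norm_def
    proof (rule esssup_AE_cong)
      have meas: "X \<in> borel_measurable (lebesgue_on \<Omega>)" "Y \<in> borel_measurable (lebesgue_on \<Omega>)"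
        using XY by (auto intro: W01inf_measurable)
      then show "(\<lambda>x. ennreal (norm (X x powr \<Gamma> * Y x powr (1 - \<Gamma>)))) \<in> borel_measurable (lebesgue_on \<Omega>)"
        "(\<lambda>x. ennreal (norm (\<bar>X x\<bar> powr \<Gamma> * \<bar>Y x\<bar> powr (1 - \<Gamma>)))) \<in> borel_measurable (lebesgue_on \<Omega>)"
        by measurable
      show "AE x in lebesgue_on \<Omega>. ennreal (norm (X x powr \<Gamma> * Y x powr (1 - \<Gamma>)))
          = ennreal (norm (\<bar>X x\<bar> powr \<Gamma> * \<bar>Y x\<bar> powr (1 - \<Gamma>)))"
        by (rule AE_I2) (simp add: nonneg)
    qed
    moreover have "continuous_on \<Omega> (U k)" "continuous_on \<Omega> (V k)" for k
      using continuous_on_subset[OF U(1)] continuous_on_subset[OF V(1)] by auto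
    moreover have "uniform_limit \<Omega> U X sequentially" "uniform_limit \<Omega> V Y sequentially"
      using ul by (auto intro: uniform_limit_on_subset)
    moreover have "is_minimum (ennreal l) {J_inf \<Omega> r s \<Gamma> w z | w z.
          w \<in> W01inf \<Omega> \<and> z \<in> W01inf \<Omega> \<and> nonzero_product \<Omega> w z}"
      unfolding is_minimum_def
    proof (intro conjI ballI)
      show "ennreal l \<in> {J_inf \<Omega> r s \<Gamma> w z | w z. w \<in> W01inf \<Omega> \<and> z \<in> W01inf \<Omega> \<and> nonzero_product \<Omega> w z}"
        using JXY XY nz by (intro CollectI exI[of _ X] exI[of _ Y]) simp
      show "ennreal l \<le> j" if "j \<in> {J_inf \<Omega> r s \<Gamma> w z | w z. w \<in> W01inf \<Omega> \<and> z \<in> W01inf \<Omega> \<and> nonzero_product \<Omega> w z}" for j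
        using that lower by blast
    qed
    ultimately show ?thesis using XY JXY \<sigma> U(2) V(2) by blast
  qed
  ultimately show ?thesis unfolding l_def by blast
qed

end
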